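(* Let $\{K_i/F\}_{i\in\omega}$ be a uniformly computable sequence of finite Galois extensions with Galois groups $G_i=\mathrm{Gal}(K_i/F)$ uniformly computable and Galois actions $G_i\curvearrowright K_i$ uniformly computable, and let $C\subseteq\omega$ be a cohesive set. Then $\mathrm{HAut}(\prod_CK_i/\prod_CF)\cong\prod_CG_i$.
   Context: For $A,B\subseteq\omega$, $A\subseteq^* B$ means $A\setminus B$ is finite. A set $C\subseteq\omega$ is cohesive if it is infinite and for every c.e. set $W$ either $C\subseteq^*W$ or $C\subseteq^*\overline{W}$. A sequence of structures is uniformly computable if their domains $\subseteq\omega$ and atomic diagrams are computable uniformly in $i$. The cohesive product $\prod_C\mathcal A_i$ has as domain the classes $[\varphi]$ of partial computable functions $\varphi$ with $\varphi(i)\in\mathcal A_i$ whenever $\varphi(i){\downarrow}$ and $C\subseteq^*\mathrm{dom}(\varphi)$, where $[\varphi]=[\psi]$ iff $C\subseteq^*\{i:\varphi(i){\downarrow}=\psi(i){\downarrow}\}$; operations are pointwise and a relation holds iff it holds at $i$ for all but finitely many $i\in C$. The product of a constant sequence is the cohesive power. Brackets are omitted from elements. Field extensions are presented as triples $(K,F,\Psi)$ with $\Psi:F\to K$ a computable ring homomorphism between computable fields; a sequence $\{K_i/F\}$ is uniformly computable if the fields and maps are uniformly computable. $\prod_CF$ is regarded as a subfield of $\prod_CK_i$. For a structure $\mathcal A$, $\mathcal T_{\mathcal A}=(\mathcal A^{<\omega},\preceq,{}^\wedge)$ is the tree of finite tuples with extension order and concatenation. For $\vec a\in\prod_C\mathcal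 T_{\mathcal A_i}$, the arity $|\vec a|\in\prod_C\mathbb{N}$ is $i\mapsto|\vec a(i)|$. $\mathrm{HAut}(\prod_C\mathcal T_{\mathcal A_i})$ is the group of automorphisms $\sigma$ of $(\prod_C\mathcal T_{\mathcal A_i},\preceq,{}^\wedge)$ with $|\sigma\vec a|=|\vec a|$ for all $\vec a$. Elements of $\prod_C\mathcal A_i$ are identified with elements of arity $1$. Elements $p\in\prod_C(\mathbb{Z}[x_1,x_2,\dots])$ are integral hyper-polynomials ($\mathbb{Z}[x_1,x_2,\dots]$ being presented so that degrees and coefficients are computable); $\mathrm{var}(p)\in\prod_C\mathbb{N}$ is $i\mapsto$ the largest index of a variable occurring in $p(i)$. For $\vec a\in\prod_C\mathcal T_{K_i}$ with $|\vec a|=\mathrm{var}(p)$, $p(\vec a)\in\prod_CK_i$ is $i\mapsto p(i)(\vec a(i))$. Define $$\mathrm{HAut}(\textstyle\prod_CK_i)=\{\sigma\in\mathrm{HAut}(\prod_C\mathcal T_{K_i})\mid\forall p\in\prod_C(\mathbb{Z}[x_1,x_2,\dots])\ \forall\vec a\in\prod_C\mathcal T_{K_i}\,[\,|\vec a|=\mathrm{var}(p)\Rightarrow p(\sigma(\vec a))=\sigma(p(\vec a))\,]\},$$ $$\mathrm{HAut}(\textstyle\prod_CK_i/\prod_CF)=\{\sigma\in\mathrm{HAut}(\prod_CK_i)\mid\forall\vec a\in\prod_C\mathcal T_F\ \sigma(\vec a)=\vec a\}.$$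
   Formalization: The formal theorem additionally assumes that some partial computable function gives the order of G_i for almost all i in C; without this, uniformly computable finite Galois groups can have an uncountable HAut, while the cohesive product of the G_i is countable. *)

theory Defs
  imports "HOL-Algebra.Algebra" "HOL-Library.Nat_Bijection" "HOL-Library.Sublist"
begin

section \<open>Computability\<close>

abbreviation pair_code :: "nat \<Rightarrow> nat \<Rightarrow> nat" (\<open>\<langle>_,/ _\<rangle>\<close>)
  where "\<langle>x, y\<rangle> \<equiv> prod_encode (x, y)"

text \<open>
  The unary partial recursive functions; a function of several arguments is a unary function of
  the Cantor code of its arguments.
  In \<open>prim\<close>, with input \<open>\<langle>a, k\<rangle>\<close>, the recursion is \<open>h 0 = f a\<close> and
  \<open>h (y + 1) = g \<langle>a, \<langle>y, h y\<rangle>\<rangle>\<close>, with result \<open>h k\<close>. In \<open>mu\<close> the search for a zero of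
  \<open>f\<close> diverges unless \<open>f\<close> converges on all the candidates below the zero.
\<close>

inductive partrec :: "(nat \<rightharpoonup> nat) \<Rightarrow> bool" where
  zero: "partrec (\<lambda>n. Some 0)"
| succ: "partrec (\<lambda>n. Some (Suc n))"
| left: "partrec (\<lambda>n. Some (fst (prod_decode n)))"
| right: "partrec (\<lambda>n. Some (snd (prod_decode n)))"
| pair: "partrec f \<Longrightarrow> partrec g \<Longrightarrow>
    partrec (\<lambda>n. Option.bind (f n) (\<lambda>x. map_option (\<lambda>y. \<langle>x, y\<rangle>) (g n)))"
| comp: "partrec f \<Longrightarrow> partrec g \<Longrightarrow> partrec (f \<circ>\<^sub>m g)"
| prim: "partrec f \<Longrightarrow> partrec g \<Longrightarrow>
    partrec (\<lambda>n. case prod_decode n of (a, k) \<Rightarrow>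
      rec_nat (f a) (\<lambda>y r. Option.bind r (\<lambda>v. g \<langle>a, \<langle>y, v\<rangle>\<rangle>)) k)"
| mu: "partrec f \<Longrightarrow>
    partrec (\<lambda>a.
      if \<exists>n. f \<langle>a, n\<rangle> = Some 0 \<and> (\<forall>m<n. f \<langle>a, m\<rangle> \<noteq> None)
      then Some (LEAST n. f \<langle>a, n\<rangle> = Some 0)
      else None)"

definition ce :: "nat set \<Rightarrow> bool"
  where "ce W \<longleftrightarrow> (\<exists>\<phi>. partrec \<phi> \<and> W = dom \<phi>)"

definition decidable :: "nat set \<Rightarrow> bool"
  where "decidable A \<longleftrightarrow> partrec (\<lambda>n. Some (of_bool (n \<in> A)))"

definition almost_subset :: "nat set \<Rightarrow> nat set \<Rightarrow> bool" (infix \<open>\<subseteq>\<^sup>*\<close> 50)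
  where "A \<subseteq>\<^sup>* B \<longleftrightarrow> finite (A - B)"

definition cohesive :: "nat set \<Rightarrow> bool"
  where "cohesive C \<longleftrightarrow> infinite C \<and> (\<forall>W. ce W \<longrightarrow> C \<subseteq>\<^sup>* W \<or> C \<subseteq>\<^sup>* - W)"


section \<open>Uniformly computable sequences\<close>

text \<open>
  The atomic diagram of a structure is given by the graphs of its operations; equality of elements
  is equality of natural numbers.
\<close>

definition ucomp_rings :: "(nat \<Rightarrow> nat ring) \<Rightarrow> bool"
  where "ucomp_rings K \<longleftrightarrow>
    decidable {\<langle>i, x\<rangle> | i x. x \<in> carrier (K i)} \<and>
    decidable {\<langle>i, \<zero>\<^bsub>K i\<^esub>\<rangle> | i. True} \<and>
    decidable {\<langle>i, \<one>\<^bsub>K i\<^esub>\<rangle> | i. True} \<and>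
    decidable {\<langle>i, \<langle>x, \<langle>y, x \<oplus>\<^bsub>K i\<^esub> y\<rangle>\<rangle>\<rangle> | i x y. x \<in> carrier (K i) \<and> y \<in> carrier (K i)} \<and>
    decidable {\<langle>i, \<langle>x, \<langle>y, x \<otimes>\<^bsub>K i\<^esub> y\<rangle>\<rangle>\<rangle> | i x y. x \<in> carrier (K i) \<and> y \<in> carrier (K i)}"

text \<open>
  For a sequence of finite groups this does not imply that their orders are computable: decidable
  domains need not come with computable bounds.
\<close>

definition ucomp_groups :: "(nat \<Rightarrow> nat monoid) \<Rightarrow> bool"
  where "ucomp_groups G \<longleftrightarrow>
    decidable {\<langle>i, x\<rangle> | i x. x \<in> carrier (G i)} \<and>
    decidable {\<langle>i, \<one>\<^bsub>G i\<^esub>\<rangle> | i. True} \<and>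
    decidable {\<langle>i, \<langle>x, \<langle>y, x \<otimes>\<^bsub>G i\<^esub> y\<rangle>\<rangle>\<rangle> | i x y. x \<in> carrier (G i) \<and> y \<in> carrier (G i)}"

definition ucomp_maps :: "(nat \<Rightarrow> nat set) \<Rightarrow> (nat \<Rightarrow> nat \<Rightarrow> nat) \<Rightarrow> bool"
  where "ucomp_maps A f \<longleftrightarrow>
    (\<exists>\<phi>. partrec \<phi> \<and> (\<forall>i. \<forall>x\<in>A i. \<phi> \<langle>i, x\<rangle> = Some (f i x)))"

definition ucomp_actions ::
    "(nat \<Rightarrow> nat monoid) \<Rightarrow> (nat \<Rightarrow> nat ring) \<Rightarrow> (nat \<Rightarrow> nat \<Rightarrow> nat \<Rightarrow> nat) \<Rightarrow> bool"
  where "ucomp_actions G K act \<longleftrightarrow>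
    (\<exists>\<phi>. partrec \<phi> \<and>
      (\<forall>i. \<forall>g\<in>carrier (G i). \<forall>x\<in>carrier (K i). \<phi> \<langle>i, \<langle>g, x\<rangle>\<rangle> = Some (act i g x)))"

definition ucomp_field_extensions ::
    "(nat \<Rightarrow> nat ring) \<Rightarrow> nat ring \<Rightarrow> (nat \<Rightarrow> nat \<Rightarrow> nat) \<Rightarrow> bool"
  where "ucomp_field_extensions K F \<Psi> \<longleftrightarrow>
    field F \<and> ucomp_rings (\<lambda>i. F) \<and>
    (\<forall>i. field (K i)) \<and> ucomp_rings K \<and>
    (\<forall>i. \<Psi> i \<in> ring_hom F (K i)) \<and> ucomp_maps (\<lambda>i. carrier F) \<Psi>"


section \<open>Galois extensions\<close>

definition Gal :: "'a ring \<Rightarrow> 'a set \<Rightarrow> ('a \<Rightarrow> 'a) monoid"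
  where "Gal K E = (BijGroup (carrier K))
    \<lparr>carrier := {f \<in> Bij (carrier K). f \<in> ring_hom K K \<and> (\<forall>x\<in>E. f x = x)}\<rparr>"

definition finite_Galois :: "'a ring \<Rightarrow> 'a set \<Rightarrow> bool"
  where "finite_Galois K E \<longleftrightarrow>
    field K \<and> subfield E K \<and> ring.finite_dimension K E (carrier K) \<and>
    {x \<in> carrier K. \<forall>f\<in>carrier (Gal K E). f x = x} = E"

text \<open>\<open>G\<close> is a presentation of the Galois group of \<open>K\<close> over \<open>E\<close>, acting through \<open>act\<close>.\<close>

definition Galois_action :: "nat monoid \<Rightarrow> nat ring \<Rightarrow> nat set \<Rightarrow> (nat \<Rightarrow> nat \<Rightarrow> nat) \<Rightarrow> bool"
  where "Galois_action G K E act \<longleftrightarrow>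
    group G \<and> (\<lambda>g. \<lambda>x\<in>carrier K. act g x) \<in> iso G (Gal K E)"


section \<open>Cohesive products\<close>

definition cfun :: "nat set \<Rightarrow> (nat \<Rightarrow> nat set) \<Rightarrow> (nat \<rightharpoonup> nat) set"
  where "cfun C A = {\<phi>. partrec \<phi> \<and> (\<forall>i v. \<phi> i = Some v \<longrightarrow> v \<in> A i) \<and> C \<subseteq>\<^sup>* dom \<phi>}"

definition ccls :: "nat set \<Rightarrow> (nat \<Rightarrow> nat set) \<Rightarrow> (nat \<rightharpoonup> nat) \<Rightarrow> (nat \<rightharpoonup> nat) set"
  where "ccls C A \<phi> = {\<psi> \<in> cfun C A. C \<subseteq>\<^sup>* {i. \<exists>v. \<phi> i = Some v \<and> \<psi> i = Some v}}"

definition cprod :: "nat set \<Rightarrow> (nat \<Rightarrow> nat set) \<Rightarrow> (nat \<rightharpoonup> nat) set set"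
  where "cprod C A = ccls C A ` cfun C A"

text \<open>
  Pointwise maps and relations between cohesive products; \<open>B\<close> is the family of domains of the
  target. All representatives of the arguments contribute the same class to the unions.
\<close>

definition cmap1 :: "nat set \<Rightarrow> (nat \<Rightarrow> nat set) \<Rightarrow> (nat \<Rightarrow> nat \<Rightarrow> nat) \<Rightarrow>
    (nat \<rightharpoonup> nat) set \<Rightarrow> (nat \<rightharpoonup> nat) set"
  where "cmap1 C B f U = (\<Union>\<phi>\<in>U. ccls C B (\<lambda>i. map_option (f i) (\<phi> i)))"

definition cmap2 :: "nat set \<Rightarrow> (nat \<Rightarrow> nat set) \<Rightarrow> (nat \<Rightarrow> nat \<Rightarrow> nat \<Rightarrow> nat) \<Rightarrow>
    (nat \<rightharpoonup> nat) set \<Rightarrow> (nat \<rightharpoonup> nat) set \<Rightarrow> (nat \<rightharpoonup> nat) set"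
  where "cmap2 C B f U V =
    (\<Union>\<phi>\<in>U. \<Union>\<psi>\<in>V. ccls C B (\<lambda>i. Option.bind (\<phi> i) (\<lambda>a. map_option (f i a) (\<psi> i))))"

definition crel2 :: "nat set \<Rightarrow> (nat \<Rightarrow> nat \<Rightarrow> nat \<Rightarrow> bool) \<Rightarrow>
    (nat \<rightharpoonup> nat) set \<Rightarrow> (nat \<rightharpoonup> nat) set \<Rightarrow> bool"
  where "crel2 C R U V \<longleftrightarrow>
    (\<exists>\<phi>\<in>U. \<exists>\<psi>\<in>V. C \<subseteq>\<^sup>* {i. \<exists>a b. \<phi> i = Some a \<and> \<psi> i = Some b \<and> R i a b})"

definition cprod_group :: "nat set \<Rightarrow> (nat \<Rightarrow> nat monoid) \<Rightarrow> (nat \<rightharpoonup> nat) set monoid"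
  where "cprod_group C G =
    \<lparr>carrier = cprod C (\<lambda>i. carrier (G i)),
     monoid.mult = cmap2 C (\<lambda>i. carrier (G i)) (\<lambda>i. monoid.mult (G i)),
     monoid.one = ccls C (\<lambda>i. carrier (G i)) (\<lambda>i. Some (monoid.one (G i)))\<rparr>"


section \<open>Trees of tuples\<close>

definition tuples :: "nat set \<Rightarrow> nat set"
  where "tuples A = list_encode ` lists A"

definition cprod_tree :: "nat set \<Rightarrow> (nat \<Rightarrow> nat set) \<Rightarrow> (nat \<rightharpoonup> nat) set set"
  where "cprod_tree C A = cprod C (\<lambda>i. tuples (A i))"

definition tree_le :: "nat set \<Rightarrow> (nat \<rightharpoonup> nat) set \<Rightarrow> (nat \<rightharpoonup> nat) set \<Rightarrow> bool"
  where "tree_le C = crel2 C (\<lambda>i a b. prefix (list_decode a) (list_decode b))"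

definition tree_append :: "nat set \<Rightarrow> (nat \<Rightarrow> nat set) \<Rightarrow>
    (nat \<rightharpoonup> nat) set \<Rightarrow> (nat \<rightharpoonup> nat) set \<Rightarrow> (nat \<rightharpoonup> nat) set"
  where "tree_append C A =
    cmap2 C (\<lambda>i. tuples (A i)) (\<lambda>i a b. list_encode (list_decode a @ list_decode b))"

definition arity :: "nat set \<Rightarrow> (nat \<rightharpoonup> nat) set \<Rightarrow> (nat \<rightharpoonup> nat) set"
  where "arity C = cmap1 C (\<lambda>i. UNIV) (\<lambda>i a. length (list_decode a))"

definition singleton_tuple :: "nat set \<Rightarrow> (nat \<Rightarrow> nat set) \<Rightarrow> (nat \<rightharpoonup> nat) set \<Rightarrow> (nat \<rightharpoonup> nat) set"
  where "singleton_tuple C A = cmap1 C (\<lambda>i. tuples (A i)) (\<lambda>i x. list_encode [x])"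

definition HAut_tree ::
    "nat set \<Rightarrow> (nat \<Rightarrow> nat set) \<Rightarrow> ((nat \<rightharpoonup> nat) set \<Rightarrow> (nat \<rightharpoonup> nat) set) set"
  where "HAut_tree C A = {\<sigma> \<in> Bij (cprod_tree C A).
    (\<forall>a\<in>cprod_tree C A. \<forall>b\<in>cprod_tree C A. tree_le C (\<sigma> a) (\<sigma> b) \<longleftrightarrow> tree_le C a b) \<and>
    (\<forall>a\<in>cprod_tree C A. \<forall>b\<in>cprod_tree C A.
      \<sigma> (tree_append C A a b) = tree_append C A (\<sigma> a) (\<sigma> b)) \<and>
    (\<forall>a\<in>cprod_tree C A. arity C (\<sigma> a) = arity C a)}"


section \<open>Integral hyper-polynomials\<close>

text \<open>
  A polynomial in \<open>\<int>[x\<^sub>1, x\<^sub>2, \<dots>]\<close> is presented by the list of its terms: a coefficient \<open>c\<close> and an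
  exponent list \<open>[e\<^sub>1, \<dots>, e\<^sub>r]\<close> stand for \<open>c x\<^sub>1^e\<^sub>1 \<cdots> x\<^sub>r^e\<^sub>r\<close>. The presentation is
  unique: coefficients are nonzero, exponent lists have no trailing zeros, and the terms are
  listed in strictly increasing order of the codes of their exponent lists.
\<close>

definition poly_terms :: "nat \<Rightarrow> (int \<times> nat list) list"
  where "poly_terms p =
    map (\<lambda>t. case prod_decode t of (c, e) \<Rightarrow> (int_decode c, list_decode e)) (list_decode p)"

definition int_polys :: "nat set"
  where "int_polys = {p.
    (\<forall>(c, e)\<in>set (poly_terms p). c \<noteq> 0 \<and> (e \<noteq> [] \<longrightarrow> last e \<noteq> 0)) \<and>
    sorted_wrt (\<lambda>(c, e) (c', e'). list_encode e < list_encode e') (poly_terms p)}"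

definition poly_var :: "nat \<Rightarrow> nat"
  where "poly_var p = Max (insert 0 ((\<lambda>(c, e). length e) ` set (poly_terms p)))"

definition monom_eval :: "nat ring \<Rightarrow> nat list \<Rightarrow> nat list \<Rightarrow> nat"
  where "monom_eval R e xs =
    foldr (\<lambda>(x, k) m. (x [^]\<^bsub>R\<^esub> k) \<otimes>\<^bsub>R\<^esub> m) (zip xs e) \<one>\<^bsub>R\<^esub>"

definition poly_eval :: "nat ring \<Rightarrow> nat \<Rightarrow> nat list \<Rightarrow> nat"
  where "poly_eval R p xs =
    foldr (\<lambda>(c, e) s. add_pow R c (monom_eval R e xs) \<oplus>\<^bsub>R\<^esub> s) (poly_terms p) \<zero>\<^bsub>R\<^esub>"

definition hyperpolys :: "nat set \<Rightarrow> (nat \<rightharpoonup> nat) set set"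
  where "hyperpolys C = cprod C (\<lambda>i. int_polys)"

definition hyperpoly_var :: "nat set \<Rightarrow> (nat \<rightharpoonup> nat) set \<Rightarrow> (nat \<rightharpoonup> nat) set"
  where "hyperpoly_var C = cmap1 C (\<lambda>i. UNIV) (\<lambda>i. poly_var)"

definition hyperpoly_eval :: "nat set \<Rightarrow> (nat \<Rightarrow> nat ring) \<Rightarrow>
    (nat \<rightharpoonup> nat) set \<Rightarrow> (nat \<rightharpoonup> nat) set \<Rightarrow> (nat \<rightharpoonup> nat) set"
  where "hyperpoly_eval C K =
    cmap2 C (\<lambda>i. carrier (K i)) (\<lambda>i p a. poly_eval (K i) p (list_decode a))"


section \<open>Hyper-automorphisms\<close>

definition HAut_fields ::
    "nat set \<Rightarrow> (nat \<Rightarrow> nat ring) \<Rightarrow> ((nat \<rightharpoonup> nat) set \<Rightarrow> (nat \<rightharpoonup> nat) set) set"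
  where "HAut_fields C K = {\<sigma> \<in> HAut_tree C (\<lambda>i. carrier (K i)).
    \<forall>p\<in>hyperpolys C. \<forall>a\<in>cprod_tree C (\<lambda>i. carrier (K i)).
      arity C a = hyperpoly_var C p \<longrightarrow>
      singleton_tuple C (\<lambda>i. carrier (K i)) (hyperpoly_eval C K p (\<sigma> a)) =
      \<sigma> (singleton_tuple C (\<lambda>i. carrier (K i)) (hyperpoly_eval C K p a))}"

text \<open>\<open>tree_emb\<close> identifies tuples over \<open>F\<close> with tuples over its images \<open>\<Psi> i F\<close>.\<close>

definition tree_emb :: "nat set \<Rightarrow> (nat \<Rightarrow> nat ring) \<Rightarrow> (nat \<Rightarrow> nat \<Rightarrow> nat) \<Rightarrow>
    (nat \<rightharpoonup> nat) set \<Rightarrow> (nat \<rightharpoonup> nat) set"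
  where "tree_emb C K \<Psi> = cmap1 C (\<lambda>i. tuples (carrier (K i)))
    (\<lambda>i a. list_encode (map (\<Psi> i) (list_decode a)))"

definition HAut_group :: "nat set \<Rightarrow> (nat \<Rightarrow> nat ring) \<Rightarrow> nat ring \<Rightarrow> (nat \<Rightarrow> nat \<Rightarrow> nat) \<Rightarrow>
    ((nat \<rightharpoonup> nat) set \<Rightarrow> (nat \<rightharpoonup> nat) set) monoid"
  where "HAut_group C K F \<Psi> = (BijGroup (cprod_tree C (\<lambda>i. carrier (K i))))
    \<lparr>carrier := {\<sigma> \<in> HAut_fields C K.
      \<forall>a\<in>cprod_tree C (\<lambda>i. carrier F). \<sigma> (tree_emb C K \<Psi> a) = tree_emb C K \<Psi> a}\<rparr>"

end

(*
  An element g of the product of the groups G i acts coordinatewise on tuples; call this Theta g. It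
  is injective because a computable search finds elements of K i separating g i from h i whenever
  these differ.

  Conversely, let tau be a hyper-automorphism with tau u = v. Arity and concatenation determine tau
  coordinatewise, and the polynomials x1 + x2 and x1 * x2 make it respect the field operations, so
  by a first-failure argument it respects straight-line programs over the generators u, of
  nonstandard length. If v i were not conjugate to u i for almost all i in C, then a search would
  find such programs relating 0 to a nonzero element: with P = sum_j u_j t^j, the coefficients of
  prod_g (X - g P) lie in F[t], and this polynomial vanishes at P but not at sum_j v_j t^j. So v i is
  almost always conjugate to u i. The order of G i being computable on C, there is a tuple d whose
  pointwise stabilizers are trivial. If tau d = g d, then applying this to the concatenation of d
  with any tuple a shows that tau a = g a.
*)

theory Submission
  imports Defs
begin

section \<open>Computable functions and semidecidable predicates\<close>

text \<open>Cohesiveness decides only c.e. conditions, and an element of a cohesive product must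
  come from a single partial recursive function. So every choice along \<open>C\<close> has to be
  the outcome of a search for a finitely checkable witness, and every case distinction has to
  concern the success of such a search. Failure of conjugacy is a universal statement over
  \<open>G i\<close>. A separating program serves twice: it is a finite certificate of that failure,
  and it is itself a pair of tuples, to which the hyper-automorphism can be applied. Programs may
  use constants from \<open>F\<close> because these are fixed. Conjugacy alone yields a group
  element for each tuple separately; a tuple with trivial stabilizers makes all these elements
  agree. To recognise such a tuple, a search must know when it has listed all of \<open>G i\<close>,
  and this is what the order of the group provides.\<close>

abbreviation cfst :: "nat \<Rightarrow> nat"
  where "cfst n \<equiv> fst (prod_decode n)"

abbreviation csnd :: "nat \<Rightarrow> nat"
  where "csnd n \<equiv> snd (prod_decode n)"

definition computable :: "(nat \<Rightarrow> nat) \<Rightarrow> bool"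
  where "computable f \<longleftrightarrow> partrec (\<lambda>n. Some (f n))"

text \<open>A total computable test of certificates \<open>s\<close> rather than the domain of a
  partial function: connectives and quantifiers then only repackage certificates, without a machine
  model or step counting.\<close>

definition semidec :: "(nat \<Rightarrow> bool) \<Rightarrow> bool"
  where "semidec P \<longleftrightarrow> (\<exists>T. computable T \<and> (\<forall>n. P n \<longleftrightarrow> (\<exists>s. T \<langle>n, s\<rangle> = 0)))"

section \<open>Closure properties of total computable functions\<close>

lemma partrec_subst:
  assumes "partrec \<phi>" "computable f"
  shows "partrec (\<lambda>n. \<phi> (f n))"
  using partrec.comp[OF assms(1) assms(2)[unfolded computable_def]]
  by (simp add: map_comp_def)

lemma computable_comp:
  assumes "computable g" "computable f"
  shows "computable (\<lambda>n. g (f n))"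
  using partrec_subst[OF _ assms(2)] assms(1) unfolding computable_def by fastforce

lemma computable_Suc: "computable f \<Longrightarrow> computable (\<lambda>n. Suc (f n))"
  using computable_comp[of Suc f] partrec.succ unfolding computable_def by simp

lemma computable_fst: "computable f \<Longrightarrow> computable (\<lambda>n. cfst (f n))"
  using computable_comp[of "\<lambda>n. cfst n" f] partrec.left unfolding computable_def by simp

lemma computable_snd: "computable f \<Longrightarrow> computable (\<lambda>n. csnd (f n))"
  using computable_comp[of "\<lambda>n. csnd n" f] partrec.right unfolding computable_def by simp

lemma computable_pair: "computable f \<Longrightarrow> computable g \<Longrightarrow> computable (\<lambda>n. \<langle>f n, g n\<rangle>)"
  using partrec.pair[of "\<lambda>n. Some (f n)" "\<lambda>n. Some (g n)"] unfolding computable_def by simp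

lemma computable_id: "computable (\<lambda>n. n)"
  using computable_pair[of "\<lambda>n. cfst n" "\<lambda>n. csnd n"] partrec.left partrec.right
  unfolding computable_def by simp

lemma computable_const: "computable (\<lambda>n. k)"
proof (induction k)
  case 0
  then show ?case using partrec.zero unfolding computable_def by simp
next
  case (Suc k)
  then show ?case by (rule computable_Suc)
qed

lemmas computable_intros = computable_Suc computable_fst computable_snd computable_pair
  computable_id computable_const

lemma computable_rec:
  assumes f: "computable f" and g: "computable (\<lambda>n. g (cfst n)
      (cfst (csnd n)) (csnd (csnd n)))"
    and k: "computable k"
  shows "computable (\<lambda>n. rec_nat (f n) (\<lambda>y v. g n y v) (k n))"
proof -
  have *: "rec_nat (Some (f a)) (\<lambda>y r. Option.bind r (\<lambda>v. Some (g a y v))) k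
      = Some (rec_nat (f a) (\<lambda>y v. g a y v) k)" for a k
    by (induction k) auto
  have "computable (\<lambda>n. rec_nat (f (cfst n)) (\<lambda>y v. g (cfst n) y v)
      (csnd n))"
    using partrec.prim[OF f[unfolded computable_def] g[unfolded computable_def]]
    unfolding computable_def by (simp add: * case_prod_beta)
  from computable_comp[OF this computable_pair[OF computable_id k]] show ?thesis by simp
qed

lemma computable_pred: "computable f \<Longrightarrow> computable (\<lambda>n. f n - 1)"
proof -
  assume f: "computable f"
  have "computable (\<lambda>n. rec_nat 0 (\<lambda>y v. y) (f n))"
    by (intro computable_rec computable_intros f)
  moreover have "rec_nat 0 (\<lambda>y v. y) k = k - 1" for k :: nat by (cases k) auto
  ultimately show ?thesis by simp
qed

lemma computable_add:
  assumes "computable f" "computable g" shows "computable (\<lambda>n. f n + g n)"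
proof -
  have "computable (\<lambda>n. rec_nat (f n) (\<lambda>y v. Suc v) (g n))"
    by (intro computable_rec computable_intros assms)
  moreover have "rec_nat a (\<lambda>y v. Suc v) k = a + k" for k a :: nat by (induction k) auto
  ultimately show ?thesis by simp
qed

lemma computable_diff:
  assumes "computable f" "computable g" shows "computable (\<lambda>n. f n - g n)"
proof -
  have "computable (\<lambda>n. rec_nat (f n) (\<lambda>y v. v - 1) (g n))"
    by (intro computable_rec computable_pred computable_intros assms)
  moreover have "rec_nat a (\<lambda>y v. v - 1) k = a - k" for k a :: nat by (induction k) auto
  ultimately show ?thesis by simp
qed

lemma computable_mult:
  assumes "computable f" "computable g" shows "computable (\<lambda>n. f n * g n)"
proof -
  have "computable (\<lambda>n. rec_nat 0 (\<lambda>y v. f n + v) (g n))"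
    by (intro computable_rec computable_add computable_comp[OF assms(1)] computable_intros assms)
  moreover have "rec_nat 0 (\<lambda>y v. a + v) k = a * k" for k a :: nat by (induction k) auto
  ultimately show ?thesis by simp
qed

section \<open>Lists coded as numbers\<close>

definition code_drop :: "nat \<Rightarrow> nat \<Rightarrow> nat"
  where "code_drop l k = rec_nat l (\<lambda>_ v. csnd (v - 1)) k"

definition code_nth :: "nat \<Rightarrow> nat \<Rightarrow> nat"
  where "code_nth l k = cfst (code_drop l k - 1)"

definition code_length :: "nat \<Rightarrow> nat"
  where "code_length l = length (list_decode l)"

lemma computable_code_drop:
  "computable f \<Longrightarrow> computable g \<Longrightarrow> computable (\<lambda>n. code_drop (f n) (g n))"
  unfolding code_drop_def
  by (intro computable_rec computable_pred computable_intros)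

lemma computable_code_nth:
  "computable f \<Longrightarrow> computable g \<Longrightarrow> computable (\<lambda>n. code_nth (f n) (g n))"
  unfolding code_nth_def
  by (intro computable_code_drop computable_pred computable_fst)

lemma prod_decode_0 [simp]: "prod_decode 0 = (0, 0)"
  by (simp add: prod_decode_def prod_decode_aux.simps)

lemma list_decode_code_drop: "list_decode (code_drop l k) = drop k (list_decode l)"
proof (induction k)
  case (Suc k)
  have "list_decode (csnd (v - 1)) = tl (list_decode v)" for v
    by (cases v) (auto split: prod.splits)
  then show ?case using Suc by (simp add: code_drop_def drop_Suc tl_drop)
qed (simp add: code_drop_def)

lemma code_nth_eq: "k < code_length l \<Longrightarrow> code_nth l k = list_decode l ! k"
proof -
  assume k: "k < code_length l"
  have *: "cfst (v - 1) = hd (list_decode v)" if "list_decode v \<noteq> []" for v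
    using that by (cases v) (auto split: prod.splits)
  from k show ?thesis
    unfolding code_nth_def
    by (subst *) (auto simp: list_decode_code_drop code_length_def hd_drop_conv_nth)
qed

lemma code_length_encode [simp]: "code_length (list_encode xs) = length xs"
  by (simp add: code_length_def)

lemma code_nth_encode [simp]: "k < length xs \<Longrightarrow> code_nth (list_encode xs) k = xs ! k"
  by (simp add: code_nth_eq)

lemma list_decode_eq_iff_nth:
  "list_decode l = xs \<longleftrightarrow> code_length l = length xs \<and> (\<forall>k<length xs. code_nth l k = xs ! k)"
  by (auto simp: list_eq_iff_nth_eq code_length_def code_nth_eq)

text \<open>Turns a finite piece of a function into a number, so that families of certificates and
  computation histories come within reach of number quantifiers.\<close>

lemma exists_code:
  obtains l where "code_length l = n" "\<And>k. k < n \<Longrightarrow> code_nth l k = f k"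
  by (rule that[of "list_encode (map f [0..<n])"]) auto

section \<open>Closure properties of semidecidable predicates\<close>

lemma semidec_computable_zero: "computable f \<Longrightarrow> semidec (\<lambda>n. f n = 0)"
  unfolding semidec_def
  by (rule exI[of _ "\<lambda>p. f (cfst p)"])
    (simp add: computable_comp[of f] computable_intros)

lemma semidec_subst:
  assumes "semidec P" "computable f" shows "semidec (\<lambda>n. P (f n))"
proof -
  obtain T where T: "computable T" "\<And>n. P n \<longleftrightarrow> (\<exists>s. T \<langle>n, s\<rangle> = 0)"
    using assms(1) unfolding semidec_def by auto
  show ?thesis unfolding semidec_def
    by (rule exI[of _ "\<lambda>p. T \<langle>f (cfst p), csnd p\<rangle>"])
      (simp add: T(2) computable_comp[OF T(1)] computable_comp[OF assms(2)]
        computable_intros)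
qed

lemma semidec_eq:
  assumes "computable f" "computable g" shows "semidec (\<lambda>n. f n = g n)"
proof -
  have "semidec (\<lambda>n. (f n - g n) + (g n - f n) = 0)"
    by (intro semidec_computable_zero computable_add computable_diff assms)
  moreover have "(f n - g n) + (g n - f n) = 0 \<longleftrightarrow> f n = g n" for n by arith
  ultimately show ?thesis by simp
qed

lemma semidec_less: "computable f \<Longrightarrow> computable g \<Longrightarrow> semidec (\<lambda>n. f n < g n)"
  using semidec_computable_zero[of "\<lambda>n. Suc (f n) - g n"]
  by (simp add: computable_Suc computable_diff Suc_le_eq)

lemma semidec_disj:
  assumes "semidec P" "semidec Q" shows "semidec (\<lambda>n. P n \<or> Q n)"
proof -
  obtain T where T: "computable T" "\<And>n. P n \<longleftrightarrow> (\<exists>s. T \<langle>n, s\<rangle> = 0)"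
    using assms(1) unfolding semidec_def by auto
  obtain U where U: "computable U" "\<And>n. Q n \<longleftrightarrow> (\<exists>s. U \<langle>n, s\<rangle> = 0)"
    using assms(2) unfolding semidec_def by auto
  show ?thesis unfolding semidec_def
    by (rule exI[of _ "\<lambda>p. T p * U p"]) (simp add: T(2) U(2) computable_mult[OF T(1) U(1)] ex_disj_distrib)
qed

lemma semidec_conj:
  assumes "semidec P" "semidec Q" shows "semidec (\<lambda>n. P n \<and> Q n)"
proof -
  obtain T where T: "computable T" "\<And>n. P n \<longleftrightarrow> (\<exists>s. T \<langle>n, s\<rangle> = 0)"
    using assms(1) unfolding semidec_def by auto
  obtain U where U: "computable U" "\<And>n. Q n \<longleftrightarrow> (\<exists>s. U \<langle>n, s\<rangle> = 0)"
    using assms(2) unfolding semidec_def by auto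
  let ?W = "\<lambda>p. T \<langle>cfst p, cfst (csnd p)\<rangle> +
      U \<langle>cfst p, csnd (csnd p)\<rangle>"
  have "computable ?W"
    by (intro computable_add computable_comp[OF T(1)] computable_comp[OF U(1)]
        computable_intros)
  moreover have "(P n \<and> Q n) = (\<exists>s. ?W \<langle>n, s\<rangle> = 0)" for n
  proof
    assume "P n \<and> Q n"
    then obtain s t where "T \<langle>n, s\<rangle> = 0" "U \<langle>n, t\<rangle> = 0" using T U by blast
    then show "\<exists>s. ?W \<langle>n, s\<rangle> = 0" by (intro exI[of _ "\<langle>s, t\<rangle>"]) simp
  qed (use T U in auto)
  ultimately show ?thesis unfolding semidec_def by blast
qed

lemma semidec_neq: "computable f \<Longrightarrow> computable g \<Longrightarrow> semidec (\<lambda>n. f n \<noteq> g n)"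
  using semidec_disj[OF semidec_less[of f g] semidec_less[of g f]] by (simp add: neq_iff)

text \<open>Parameters are packed into one number: binding a variable \<open>y\<close> turns \<open>n\<close> into \<open>\<langle>n, y\<rangle>\<close>.\<close>

lemma semidec_ex:
  assumes "semidec (\<lambda>m. P (cfst m) (csnd m))"
  shows "semidec (\<lambda>n. \<exists>y. P n y)"
proof -
  obtain T where T: "computable T"
      "\<And>m. P (cfst m) (csnd m) \<longleftrightarrow> (\<exists>s. T \<langle>m, s\<rangle> = 0)"
    using assms unfolding semidec_def by metis
  let ?W = "\<lambda>p. T \<langle>\<langle>cfst p, cfst (csnd p)\<rangle>,
      csnd (csnd p)\<rangle>"
  have "computable ?W"
    by (intro computable_comp[OF T(1)] computable_intros)
  moreover have "(\<exists>y. P n y) = (\<exists>s. ?W \<langle>n, s\<rangle> = 0)" for n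
  proof
    assume "\<exists>y. P n y"
    then obtain y where "P n y" by blast
    with T(2)[of "\<langle>n, y\<rangle>"] obtain s where "T \<langle>\<langle>n, y\<rangle>, s\<rangle> = 0" by auto
    then show "\<exists>s. ?W \<langle>n, s\<rangle> = 0" by (intro exI[of _ "\<langle>y, s\<rangle>"]) simp
  next
    assume "\<exists>s. ?W \<langle>n, s\<rangle> = 0"
    then obtain s where "?W \<langle>n, s\<rangle> = 0" by blast
    then show "\<exists>y. P n y" using T(2)[of "\<langle>n, cfst s\<rangle>"] by auto
  qed
  ultimately show ?thesis unfolding semidec_def by blast
qed

text \<open>The certificate is a list with one certificate for each \<open>j\<close> below the
  bound; the sum of the tests vanishes only if every one of them does.\<close>

lemma semidec_ball:
  assumes "semidec (\<lambda>m. P (cfst m) (csnd m))" and b: "computable b"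
  shows "semidec (\<lambda>n. \<forall>j<b n. P n j)"
proof -
  obtain T where T: "computable T"
      "\<And>m. P (cfst m) (csnd m) \<longleftrightarrow> (\<exists>s. T \<langle>m, s\<rangle> = 0)"
    using assms unfolding semidec_def by metis
  let ?W = "\<lambda>p. rec_nat 0 (\<lambda>j v. v + T \<langle>\<langle>cfst p, j\<rangle>, code_nth (csnd p) j\<rangle>)
    (b (cfst p))"
  have W: "computable ?W"
    by (intro computable_rec computable_add computable_comp[OF T(1)] computable_code_nth
        computable_comp[OF b]
        computable_intros)
  have rec0: "rec_nat 0 (\<lambda>j v. v + h j) k = 0 \<longleftrightarrow> (\<forall>j<k. h j = 0)" for h :: "nat \<Rightarrow> nat" and k
    by (induction k) (auto simp: less_Suc_eq)
  have "(\<forall>j<b n. P n j) = (\<exists>s. ?W \<langle>n, s\<rangle> = 0)" for n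
  proof
    assume "\<forall>j<b n. P n j"
    then have "\<forall>j. \<exists>s. j < b n \<longrightarrow> T \<langle>\<langle>n, j\<rangle>, s\<rangle> = 0" using T(2)[of "\<langle>n, _\<rangle>"] by auto
    then obtain f where f: "\<And>j. j < b n \<Longrightarrow> T \<langle>\<langle>n, j\<rangle>, f j\<rangle> = 0" by metis
    obtain l where "\<And>k. k < b n \<Longrightarrow> code_nth l k = f k" using exists_code by metis
    with f show "\<exists>s. ?W \<langle>n, s\<rangle> = 0" by (intro exI[of _ l]) (simp add: rec0)
  next
    assume "\<exists>s. ?W \<langle>n, s\<rangle> = 0"
    then show "\<forall>j<b n. P n j" using T(2)[of "\<langle>n, _\<rangle>"] by (auto simp: rec0)
  qed
  with W show ?thesis unfolding semidec_def by blast
qed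

text \<open>Only the values up to \<open>b\<close> matter, so a list of length \<open>Suc b\<close>
  is as good as an infinite sequence \<open>w\<close>.\<close>

lemma ex_sequence_iff_code:
  "(\<exists>w. w 0 = a \<and> (\<forall>j<b. P j (w j) (w (Suc j))) \<and> w b = c)
    \<longleftrightarrow> (\<exists>l. code_nth l 0 = a \<and> (\<forall>j<b. P j (code_nth l j) (code_nth l (Suc j))) \<and> code_nth l b = c)"
  (is "?L = ?R")
proof
  assume ?L
  then obtain w where w: "w 0 = a \<and> (\<forall>j<b. P j (w j) (w (Suc j))) \<and> w b = c" ..
  obtain l where "\<And>k. k < Suc b \<Longrightarrow> code_nth l k = w k" using exists_code by metis
  with w show ?R by (intro exI[of _ l]) auto
qed blast

lemma semidec_iterate:
  assumes "semidec (\<lambda>m. P (cfst m) (cfst (csnd m))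
      (cfst (csnd (csnd m)))
      (csnd (csnd (csnd m))))"
    and b: "computable b" and a: "computable a" and c: "computable c"
  shows "semidec (\<lambda>n. \<exists>w. w 0 = a n \<and> (\<forall>j<b n. P n j (w j) (w (Suc j))) \<and> w (b n) = c n)"
proof -
  show ?thesis
    unfolding ex_sequence_iff_code
    apply (intro semidec_ex semidec_conj semidec_ball semidec_eq computable_code_nth
        computable_comp[OF b] computable_comp[OF c] computable_comp[OF a]
        computable_intros)
    subgoal
      using semidec_subst[OF assms(1), of "\<lambda>m. \<langle>cfst (cfst m), \<langle>csnd m,
          \<langle>code_nth (csnd (cfst m)) (csnd m),
           code_nth (csnd (cfst m)) (Suc (csnd m))\<rangle>\<rangle>\<rangle>"]
      by (simp add: computable_intros computable_code_nth computable_Suc)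
    done
qed

text \<open>Plays the part of Kleene's normal form, by induction on the construction of the
  function: composition becomes an existential quantifier over the intermediate value, primitive
  recursion the existence of a computation history, and minimization a bounded quantifier over the
  candidates below the zero.\<close>

lemma semidec_graph: "partrec \<phi> \<Longrightarrow> semidec (\<lambda>m. \<phi> (cfst m) = Some (csnd m))"
proof (induction rule: partrec.induct)
  case zero
  then show ?case by (simp add: semidec_eq computable_intros)
next
  case succ
  then show ?case by (simp add: semidec_eq computable_intros)
next
  case left
  then show ?case by (simp add: semidec_eq computable_intros)
next
  case right
  then show ?case by (simp add: semidec_eq computable_intros)
next
  case (pair f g)
  have "semidec (\<lambda>m. f (cfst m) = Some (cfst (csnd m)) \<and>
      g (cfst m) = Some (csnd (csnd m)))"
    using semidec_conj[OF semidec_subst[OF pair.IH(1), of "\<lambda>m. \<langle>cfst m, cfst (csnd m)\<rangle>"]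
       semidec_subst[OF pair.IH(2), of "\<lambda>m. \<langle>cfst m, csnd (csnd m)\<rangle>"]]
    by (simp add: computable_intros)
  moreover have "(Option.bind (f n) (\<lambda>x. map_option (\<lambda>y. \<langle>x, y\<rangle>) (g n)) = Some z) \<longleftrightarrow>
      f n = Some (cfst z) \<and> g n = Some (csnd z)" for n z
    by (auto simp: bind_eq_Some_conv)
  ultimately show ?case by simp
next
  case (comp f g)
  have "semidec (\<lambda>m. \<exists>z. g (cfst m) = Some z \<and> f z = Some (csnd m))"
    apply (rule semidec_ex)
    using semidec_conj[OF semidec_subst[OF comp.IH(2), of "\<lambda>m. \<langle>cfst (cfst m), csnd m\<rangle>"]
       semidec_subst[OF comp.IH(1), of "\<lambda>m. \<langle>csnd m, csnd (cfst m)\<rangle>"]]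
    by (simp add: computable_intros)
  then show ?case by (simp add: map_comp_Some_iff)
next
  case (prim f g)
  let ?h = "\<lambda>a. rec_nat (f a) (\<lambda>y r. Option.bind r (\<lambda>v. g \<langle>a, \<langle>y, v\<rangle>\<rangle>))"
  have iff: "?h a k = Some z \<longleftrightarrow> (\<exists>i. f a = Some i \<and>
    (\<exists>w. w 0 = i \<and> (\<forall>j<k. g \<langle>a, \<langle>j, w j\<rangle>\<rangle> = Some (w (Suc j))) \<and> w k = z))" for a k z
  proof (induction k arbitrary: z)
    case 0
    have "\<exists>w. w 0 = z" by (rule exI[of _ "\<lambda>_. z"]) simp
    then show ?case by auto
  next
    case (Suc k)
    have "?h a (Suc k) = Some z \<longleftrightarrow> (\<exists>v. ?h a k = Some v \<and> g \<langle>a, \<langle>k, v\<rangle>\<rangle> = Some z)"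
      by (simp add: bind_eq_Some_conv)
    also have "\<dots> \<longleftrightarrow> (\<exists>v. (\<exists>i. f a = Some i \<and>
        (\<exists>w. w 0 = i \<and> (\<forall>j<k. g \<langle>a, \<langle>j, w j\<rangle>\<rangle> = Some (w (Suc j))) \<and> w k = v)) \<and> g \<langle>a, \<langle>k, v\<rangle>\<rangle> = Some z)"
      unfolding Suc.IH ..
    also have "\<dots> \<longleftrightarrow> (\<exists>i. f a = Some i \<and>
        (\<exists>w. w 0 = i \<and> (\<forall>j<Suc k. g \<langle>a, \<langle>j, w j\<rangle>\<rangle> = Some (w (Suc j))) \<and> w (Suc k) = z))" (is "?L = ?R")
    proof
      assume ?L
      then obtain w where w: "f a = Some (w 0)" "\<forall>j<k. g \<langle>a, \<langle>j, w j\<rangle>\<rangle> = Some (w (Suc j))"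
         "g \<langle>a, \<langle>k, w k\<rangle>\<rangle> = Some z" by blast
      show ?R
        by (rule exI[of _ "w 0"]) (use w in \<open>auto intro!: exI[of _ "w(Suc k := z)"] simp: less_Suc_eq\<close>)
    next
      assume ?R
      then show ?L by (auto simp: less_Suc_eq)
    qed
    finally show ?case .
  qed
  have "semidec (\<lambda>m. \<exists>i. f (cfst (cfst m)) = Some i \<and>
    (\<exists>w. w 0 = i \<and> (\<forall>j<csnd (cfst m).
        g \<langle>cfst (cfst m), \<langle>j, w j\<rangle>\<rangle> = Some (w (Suc j))) \<and>
        w (csnd (cfst m)) = csnd m))"
    apply (intro semidec_ex semidec_conj semidec_iterate computable_intros)
    subgoal
      using semidec_subst[OF prim.IH(1), of "\<lambda>m. \<langle>cfst (cfst (cfst m)), csnd m\<rangle>"]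
      by (simp add: computable_intros)
    subgoal
      using semidec_subst[OF prim.IH(2), of "\<lambda>m. \<langle>\<langle>cfst (cfst (cfst (cfst m))),
        \<langle>cfst (csnd m), cfst (csnd (csnd m))\<rangle>\<rangle>,
          csnd (csnd (csnd m))\<rangle>"]
      by (simp add: computable_intros)
    done
  then show ?case by (simp add: case_prod_beta iff)
next
  case (mu f)
  \<comment> \<open>Below the zero the values are required to be of the form
    \<open>Some (Suc v)\<close>. Being different from \<open>Some 0\<close> would also cover
    divergence, which a search cannot confirm.\<close>
  have iff: "((if \<exists>n. f \<langle>a, n\<rangle> = Some 0 \<and> (\<forall>m<n. f \<langle>a, m\<rangle> \<noteq> None)
      then Some (LEAST n. f \<langle>a, n\<rangle> = Some 0) else None) = Some y) \<longleftrightarrow>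
     f \<langle>a, y\<rangle> = Some 0 \<and> (\<forall>j<y. \<exists>v. f \<langle>a, j\<rangle> = Some (Suc v))" (is "?L \<longleftrightarrow> ?R") for a y
  proof
    assume ?L
    then obtain n where n: "f \<langle>a, n\<rangle> = Some 0" "\<And>m. m<n \<Longrightarrow> f \<langle>a, m\<rangle> \<noteq> None"
      and y: "y = (LEAST n. f \<langle>a, n\<rangle> = Some 0)" by (auto split: if_splits)
    have "y \<le> n" unfolding y by (rule Least_le) (rule n)
    moreover have "f \<langle>a, y\<rangle> = Some 0" unfolding y by (rule LeastI) (rule n)
    moreover have "f \<langle>a, j\<rangle> \<noteq> Some 0" if "j < y" for j using that unfolding y by (rule not_less_Least)
    ultimately show ?R using n(2)
      by (metis less_le_trans not0_implies_Suc option.exhaust)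
  next
    assume R: ?R
    then have "(LEAST n. f \<langle>a, n\<rangle> = Some 0) = y"
      by (intro Least_equality) (auto simp: not_less[symmetric])
    moreover have "\<forall>m<y. f \<langle>a, m\<rangle> \<noteq> None" using R by auto
    ultimately show ?L using R by (simp only: if_True ex_simps) metis
  qed
  have "semidec (\<lambda>m. f \<langle>cfst m, csnd m\<rangle> = Some 0 \<and>
      (\<forall>j<csnd m. \<exists>v. f \<langle>cfst m, j\<rangle> = Some (Suc v)))"
    apply (intro semidec_ex semidec_conj semidec_ball computable_intros)
    subgoal
      using semidec_subst[OF mu.IH, of "\<lambda>m. \<langle>m, 0\<rangle>"]
      by (simp add: computable_intros)
    subgoal
      using semidec_subst[OF mu.IH, of "\<lambda>m. \<langle>\<langle>cfst (cfst (cfst m)),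
        csnd (cfst m)\<rangle>, Suc (csnd m)\<rangle>"]
      by (simp add: computable_intros)
    done
  then show ?case by (simp only: iff)
qed

lemma semidec_partrec:
  assumes "partrec \<phi>" "computable f" "computable g"
  shows "semidec (\<lambda>n. \<phi> (f n) = Some (g n))"
  using semidec_subst[OF semidec_graph[OF assms(1)] computable_pair[OF assms(2,3)]] by simp

lemma partrec_search:
  assumes "computable T"
  shows "partrec (\<lambda>n. if \<exists>s. T \<langle>n, s\<rangle> = 0 then Some (LEAST s. T \<langle>n, s\<rangle> = 0) else None)"
  using partrec.mu[OF assms[unfolded computable_def]] by (simp only: option.inject option.distinct(2) not_False_eq_True simp_thms)

text \<open>The search runs over pairs of a candidate and a certificate for it. \<open>P\<close>
  need not be single-valued: the order of the search makes the choice.\<close>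

lemma semidec_uniformize:
  assumes "semidec (\<lambda>m. P (cfst m) (csnd m))"
  obtains \<phi> where "partrec \<phi>" "\<And>n y. \<phi> n = Some y \<Longrightarrow> P n y" "\<And>n y. P n y \<Longrightarrow> \<exists>z. \<phi> n = Some z"
proof -
  obtain T where T: "computable T"
      "\<And>m. P (cfst m) (csnd m) \<longleftrightarrow> (\<exists>s. T \<langle>m, s\<rangle> = 0)"
    using assms unfolding semidec_def by metis
  let ?W = "\<lambda>p. T \<langle>\<langle>cfst p, cfst (csnd p)\<rangle>,
      csnd (csnd p)\<rangle>"
  have W: "computable ?W"
    by (intro computable_comp[OF T(1)] computable_intros)
  let ?s = "\<lambda>n. if \<exists>s. ?W \<langle>n, s\<rangle> = 0 then Some (LEAST s. ?W \<langle>n, s\<rangle> = 0) else None"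
  let ?\<phi> = "\<lambda>n. map_option (\<lambda>s. cfst s) (?s n)"
  have "?\<phi> = (\<lambda>n. Some (cfst n)) \<circ>\<^sub>m ?s"
    by (auto simp: map_comp_def split: option.splits)
  then have 1: "partrec ?\<phi>"
    using partrec.comp[OF partrec.left partrec_search[OF W]] by simp
  have 2: "P n y" if "?\<phi> n = Some y" for n y
  proof -
    from that obtain s where ex: "\<exists>s. ?W \<langle>n, s\<rangle> = 0" and s: "s = (LEAST s. ?W \<langle>n, s\<rangle> = 0)"
      and y: "y = cfst s"
      by (auto split: if_splits)
    have "?W \<langle>n, s\<rangle> = 0" unfolding s using ex by (rule LeastI_ex)
    then show ?thesis using T(2)[of "\<langle>n, y\<rangle>"] y by auto
  qed
  have 3: "\<exists>z. ?\<phi> n = Some z" if Pny: "P n y" for n y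
  proof -
    from Pny T(2)[of "\<langle>n, y\<rangle>"] obtain s where "T \<langle>\<langle>n, y\<rangle>, s\<rangle> = 0" by auto
    then have "?W \<langle>n, \<langle>y, s\<rangle>\<rangle> = 0" by simp
    then have "\<exists>s. ?W \<langle>n, s\<rangle> = 0" by blast
    then show ?thesis by auto
  qed
  show ?thesis using that[of ?\<phi>] 1 2 3 by blast
qed

text \<open>Every argument has a value, so the search for it always ends, and it can only end at the
  right one.\<close>

lemma computable_if_semidec:
  assumes "semidec (\<lambda>m. f (cfst m) = csnd m)"
  shows "computable f"
proof -
  obtain \<phi> where \<phi>: "partrec \<phi>" "\<And>n y. \<phi> n = Some y \<Longrightarrow> f n = y" "\<And>n y. f n = y \<Longrightarrow> \<exists>z. \<phi> n = Some z"
    by (rule semidec_uniformize[OF assms]) blast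
  then have "\<phi> = (\<lambda>n. Some (f n))" by fastforce
  with \<phi>(1) show ?thesis by (simp add: computable_def)
qed

lemma computable_code_length: "computable f \<Longrightarrow> computable (\<lambda>n. code_length (f n))"
proof -
  have 0: "code_drop l k = 0 \<longleftrightarrow> length (list_decode l) \<le> k" for l k
  proof -
    have "code_drop l k = 0 \<longleftrightarrow> list_decode (code_drop l k) = []"
      by (metis list_decode.simps(1) list_decode_inverse list_encode.simps(1))
    then show ?thesis by (simp add: list_decode_code_drop)
  qed
  \<comment> \<open>The length is the least number of entries whose removal leaves the code 0 of the
    empty list.\<close>
  have iff: "code_length l = k \<longleftrightarrow> code_drop l k = 0 \<and> (\<forall>j<k. code_drop l j \<noteq> 0)" for l k
    unfolding 0 code_length_def
    by (auto simp: not_le) (metis le_antisym linorder_not_le order_refl)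
  have "semidec (\<lambda>m. code_drop (cfst m) (csnd m) = 0 \<and>
      (\<forall>j<csnd m. code_drop (cfst m) j \<noteq> 0))"
    by (intro semidec_conj semidec_ball semidec_eq semidec_neq computable_code_drop computable_intros)
  then have "computable code_length"
    by (intro computable_if_semidec) (simp only: iff)
  then show "computable f \<Longrightarrow> computable (\<lambda>n. code_length (f n))" by (rule computable_comp)
qed

lemma semidec_decidable:
  assumes "decidable A" "computable f"
  shows "semidec (\<lambda>n. f n \<in> A)" "semidec (\<lambda>n. f n \<notin> A)"
proof -
  have c: "computable (\<lambda>n. of_bool (f n \<in> A))"
    using assms computable_comp[of "\<lambda>n. of_bool (n \<in> A)" f] unfolding decidable_def computable_def by simp
  from semidec_computable_zero[OF c] show "semidec (\<lambda>n. f n \<notin> A)" by simp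
  from semidec_eq[OF c computable_const[of 1]] show "semidec (\<lambda>n. f n \<in> A)"
    by (simp only: of_bool_eq_1_iff)
qed

lemma ce_if_semidec:
  assumes "semidec P"
  shows "ce {n. P n}"
proof -
  have "semidec (\<lambda>m. P (cfst m))" 
    by (intro semidec_subst[OF assms] computable_intros)
  then obtain \<phi> where \<phi>: "partrec \<phi>" "\<And>n y. \<phi> n = Some y \<Longrightarrow> P n"
     "\<And>n y. P n \<Longrightarrow> \<exists>z. \<phi> n = Some z" 
    using semidec_uniformize[of "\<lambda>n y. P n"] by metis
  then have "{n. P n} = dom \<phi>" by (auto simp: dom_def)
  with \<phi>(1) show ?thesis unfolding ce_def by blast
qed

section \<open>Relative computability along a set of indices\<close>

text \<open>The filter of the sets that contain almost all of \<open>C\<close>; statements modulo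
  finite sets can then be combined by \<open>eventually_elim\<close>.\<close>

definition cofin :: "nat set \<Rightarrow> nat filter"
  where "cofin C = inf cofinite (principal C)"

lemma eventually_cofin: "eventually P (cofin C) \<longleftrightarrow> C \<subseteq>\<^sup>* {i. P i}"
  unfolding cofin_def eventually_inf_principal eventually_cofinite almost_subset_def
  by (rule arg_cong[where f=finite]) auto

lemma cohesive_cofin_neq_bot:
  assumes "cohesive C" "\<forall>\<^sub>F i in cofin C. P i" "\<forall>\<^sub>F i in cofin C. \<not> P i" shows False
proof -
  from assms(2,3) have "\<forall>\<^sub>F i in cofin C. False" by eventually_elim simp
  with assms(1) show False unfolding eventually_cofin cohesive_def almost_subset_def by simp
qed

text \<open>
  Disregarding finitely many elements of \<open>C\<close> and everything outside \<open>C\<close> makes quantities available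
  that are computable only along \<open>C\<close>, such as the orders of the Galois groups.
\<close>

definition usemidec :: "nat set \<Rightarrow> (nat \<Rightarrow> nat \<Rightarrow> bool) \<Rightarrow> bool"
  where "usemidec C P \<longleftrightarrow> (\<exists>Q. semidec Q \<and> (\<forall>\<^sub>F i in cofin C. \<forall>n. P i n \<longleftrightarrow> Q \<langle>i, n\<rangle>))"

definition ucomputable :: "nat set \<Rightarrow> (nat \<Rightarrow> nat \<Rightarrow> nat) \<Rightarrow> bool"
  where "ucomputable C f \<longleftrightarrow> (\<exists>\<phi>. partrec \<phi> \<and> (\<forall>\<^sub>F i in cofin C. \<forall>n. \<phi> \<langle>i, n\<rangle> = Some (f i n)))"

text \<open>A total function stands for a partial one: only its values at almost all indices in
  \<open>C\<close> carry information. No target domain is fixed; \<open>celem\<close> adds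
  it.\<close>

definition represented :: "nat set \<Rightarrow> (nat \<Rightarrow> nat) \<Rightarrow> bool"
  where "represented C a \<longleftrightarrow> (\<exists>\<phi>. partrec \<phi> \<and> (\<forall>\<^sub>F i in cofin C. \<phi> i = Some (a i)))"

section \<open>Closure properties of functions computable along \<open>C\<close>\<close>

lemma ucomputable_comp:
  assumes "computable h" "ucomputable C f"
  shows "ucomputable C (\<lambda>i n. h (f i n))"
proof -
  obtain \<phi> where \<phi>: "partrec \<phi>" "\<forall>\<^sub>F i in cofin C. \<forall>n. \<phi> \<langle>i, n\<rangle> = Some (f i n)"
    using assms(2) unfolding ucomputable_def by auto
  from partrec.comp[OF assms(1)[unfolded computable_def] \<phi>(1)] show ?thesis
    unfolding ucomputable_def
  proof (intro exI conjI)
    show "\<forall>\<^sub>F i in cofin C. \<forall>n. ((\<lambda>n. Some (h n)) \<circ>\<^sub>m \<phi>) \<langle>i, n\<rangle> = Some (h (f i n))"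
      using \<phi>(2) by eventually_elim simp
  qed
qed

lemma ucomputable_pair:
  assumes "ucomputable C f" "ucomputable C g"
  shows "ucomputable C (\<lambda>i n. \<langle>f i n, g i n\<rangle>)"
proof -
  obtain \<phi> where \<phi>: "partrec \<phi>" "\<forall>\<^sub>F i in cofin C. \<forall>n. \<phi> \<langle>i, n\<rangle> = Some (f i n)"
    using assms(1) unfolding ucomputable_def by auto
  obtain \<psi> where \<psi>: "partrec \<psi>" "\<forall>\<^sub>F i in cofin C. \<forall>n. \<psi> \<langle>i, n\<rangle> = Some (g i n)"
    using assms(2) unfolding ucomputable_def by auto
  from partrec.pair[OF \<phi>(1) \<psi>(1)] show ?thesis
    unfolding ucomputable_def
  proof (intro exI conjI)
    show "\<forall>\<^sub>F i in cofin C. \<forall>n. Option.bind (\<phi> \<langle>i, n\<rangle>) (\<lambda>x. map_option (\<lambda>y. \<langle>x, y\<rangle>) (\<psi> \<langle>i, n\<rangle>))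
        = Some \<langle>f i n, g i n\<rangle>"
      using \<phi>(2) \<psi>(2) by eventually_elim simp
  qed
qed

lemma ucomputable_subst:
  assumes "ucomputable C f" "ucomputable C h"
  shows "ucomputable C (\<lambda>i n. f i (h i n))"
proof -
  obtain \<phi> where \<phi>: "partrec \<phi>" "\<forall>\<^sub>F i in cofin C. \<forall>n. \<phi> \<langle>i, n\<rangle> = Some (f i n)"
    using assms(1) unfolding ucomputable_def by auto
  have "partrec (\<lambda>m. Some (cfst m))" by (rule partrec.left)
  then have "ucomputable C (\<lambda>i n. i)"
    unfolding ucomputable_def by (intro exI conjI) auto
  from ucomputable_pair[OF this assms(2)] obtain \<psi>
    where \<psi>: "partrec \<psi>" "\<forall>\<^sub>F i in cofin C. \<forall>n. \<psi> \<langle>i, n\<rangle> = Some \<langle>i, h i n\<rangle>"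
    unfolding ucomputable_def by auto
  from partrec.comp[OF \<phi>(1) \<psi>(1)] show ?thesis unfolding ucomputable_def
  proof (intro exI conjI)
    show "\<forall>\<^sub>F i in cofin C. \<forall>n. (\<phi> \<circ>\<^sub>m \<psi>) \<langle>i, n\<rangle> = Some (f i (h i n))"
      using \<phi>(2) \<psi>(2) by eventually_elim simp
  qed
qed

lemma ucomputable_computable2:
  assumes "computable (\<lambda>m. h (cfst m) (csnd m))"
    and "ucomputable C f" "ucomputable C g"
  shows "ucomputable C (\<lambda>i n. h (f i n) (g i n))"
  using ucomputable_comp[OF assms(1) ucomputable_pair[OF assms(2,3)]] by simp

lemma ucomputable_computable:
  assumes "computable (\<lambda>m. h (cfst m) (csnd m))"
  shows "ucomputable C h"
  unfolding ucomputable_def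
  using assms[unfolded computable_def] by (intro exI conjI) auto

lemma ucomputable_const: "ucomputable C (\<lambda>i n. k)"
  by (intro ucomputable_computable computable_const)

lemma ucomputable_var: "ucomputable C (\<lambda>i n. n)"
  by (intro ucomputable_computable computable_intros)

lemma ucomputable_index: "ucomputable C (\<lambda>i n. i)"
  by (intro ucomputable_computable computable_intros)

lemma ucomputable_fst: "ucomputable C f \<Longrightarrow> ucomputable C (\<lambda>i n. cfst (f i n))"
  by (rule ucomputable_comp[OF computable_fst[OF computable_id]])

lemma ucomputable_snd: "ucomputable C f \<Longrightarrow> ucomputable C (\<lambda>i n. csnd (f i n))"
  by (rule ucomputable_comp[OF computable_snd[OF computable_id]])

lemma ucomputable_Suc: "ucomputable C f \<Longrightarrow> ucomputable C (\<lambda>i n. Suc (f i n))"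
  by (rule ucomputable_comp[OF computable_Suc[OF computable_id]])

lemma ucomputable_code_length: "ucomputable C f \<Longrightarrow> ucomputable C (\<lambda>i n. code_length (f i n))"
  by (rule ucomputable_comp[OF computable_code_length[OF computable_id]])

lemma ucomputable_add: "ucomputable C f \<Longrightarrow> ucomputable C g \<Longrightarrow> ucomputable C (\<lambda>i n. f i n + g i n)"
  by (rule ucomputable_computable2) (intro computable_add computable_intros)

lemma ucomputable_diff: "ucomputable C f \<Longrightarrow> ucomputable C g \<Longrightarrow> ucomputable C (\<lambda>i n. f i n - g i n)"
  by (rule ucomputable_computable2) (intro computable_diff computable_intros)

lemma ucomputable_code_nth:
  "ucomputable C f \<Longrightarrow> ucomputable C g \<Longrightarrow> ucomputable C (\<lambda>i n. code_nth (f i n) (g i n))"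
  by (rule ucomputable_computable2) (intro computable_code_nth computable_intros)

lemma ucomputable_represented: "represented C a \<Longrightarrow> ucomputable C (\<lambda>i n. a i)"
proof -
  assume "represented C a"
  then obtain \<phi> where \<phi>: "partrec \<phi>" "\<forall>\<^sub>F i in cofin C. \<phi> i = Some (a i)"
    unfolding represented_def by auto
  have "partrec (\<lambda>m. \<phi> (cfst m))"
    by (intro partrec_subst[OF \<phi>(1)] computable_intros)
  moreover have "\<forall>\<^sub>F i in cofin C. \<forall>n. \<phi> (cfst \<langle>i, n\<rangle>) = Some (a i)"
    using \<phi>(2) by eventually_elim simp
  ultimately show ?thesis unfolding ucomputable_def by blast
qed

lemmas ucomputable_intros = ucomputable_const ucomputable_var ucomputable_index ucomputable_fst
  ucomputable_snd ucomputable_Suc ucomputable_code_length ucomputable_add ucomputable_diff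
  ucomputable_code_nth ucomputable_pair ucomputable_represented

section \<open>Closure properties of predicates semidecidable along \<open>C\<close>\<close>

lemma usemidec_semidec:
  assumes "semidec Q" "ucomputable C f"
  shows "usemidec C (\<lambda>i n. Q (f i n))"
proof -
  obtain \<phi> where \<phi>: "partrec \<phi>" "\<forall>\<^sub>F i in cofin C. \<forall>n. \<phi> \<langle>i, n\<rangle> = Some (f i n)"
    using assms(2) unfolding ucomputable_def by auto
  have "semidec (\<lambda>m. \<exists>z. \<phi> m = Some z \<and> Q z)"
    by (intro semidec_ex semidec_conj semidec_partrec[OF \<phi>(1)] semidec_subst[OF assms(1)]
        computable_intros)
  then show ?thesis unfolding usemidec_def
  proof (intro exI conjI)
    show "\<forall>\<^sub>F i in cofin C. \<forall>n. Q (f i n) = (\<exists>z. \<phi> \<langle>i, n\<rangle> = Some z \<and> Q z)"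
      using \<phi>(2) by eventually_elim simp
  qed
qed

lemma usemidec_semidec2:
  assumes "semidec (\<lambda>m. Q (cfst m) (csnd m))" "ucomputable C f" "ucomputable C g"
  shows "usemidec C (\<lambda>i n. Q (f i n) (g i n))"
  using usemidec_semidec[OF assms(1) ucomputable_pair[OF assms(2,3)]] by simp

lemma usemidec_eq: "ucomputable C f \<Longrightarrow> ucomputable C g \<Longrightarrow> usemidec C (\<lambda>i n. f i n = g i n)"
  by (rule usemidec_semidec2) (intro semidec_eq computable_intros)

lemma usemidec_neq: "ucomputable C f \<Longrightarrow> ucomputable C g \<Longrightarrow> usemidec C (\<lambda>i n. f i n \<noteq> g i n)"
  by (rule usemidec_semidec2) (intro semidec_neq computable_intros)

lemma usemidec_less: "ucomputable C f \<Longrightarrow> ucomputable C g \<Longrightarrow> usemidec C (\<lambda>i n. f i n < g i n)"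
  by (rule usemidec_semidec2) (intro semidec_less computable_intros)

lemma usemidec_decidable: "decidable A \<Longrightarrow> ucomputable C f \<Longrightarrow> usemidec C (\<lambda>i n. f i n \<in> A)"
  by (rule usemidec_semidec) (intro semidec_decidable computable_id)

lemma usemidec_partrec:
  "partrec \<phi> \<Longrightarrow> ucomputable C f \<Longrightarrow> ucomputable C g \<Longrightarrow> usemidec C (\<lambda>i n. \<phi> (f i n) = Some (g i n))"
  by (rule usemidec_semidec2) (intro semidec_partrec computable_intros)

lemma usemidec_conj:
  assumes "usemidec C P" "usemidec C Q"
  shows "usemidec C (\<lambda>i n. P i n \<and> Q i n)"
proof -
  obtain P' where P': "semidec P'" "\<forall>\<^sub>F i in cofin C. \<forall>n. P i n \<longleftrightarrow> P' \<langle>i, n\<rangle>"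
    using assms(1) unfolding usemidec_def by auto
  obtain Q' where Q': "semidec Q'" "\<forall>\<^sub>F i in cofin C. \<forall>n. Q i n \<longleftrightarrow> Q' \<langle>i, n\<rangle>"
    using assms(2) unfolding usemidec_def by auto
  show ?thesis unfolding usemidec_def
  proof (intro exI conjI)
    show "semidec (\<lambda>m. P' m \<and> Q' m)" by (intro semidec_conj P' Q')
    show "\<forall>\<^sub>F i in cofin C. \<forall>n. (P i n \<and> Q i n) = (P' \<langle>i, n\<rangle> \<and> Q' \<langle>i, n\<rangle>)"
      using P'(2) Q'(2) by eventually_elim simp
  qed
qed

lemma usemidec_disj:
  assumes "usemidec C P" "usemidec C Q"
  shows "usemidec C (\<lambda>i n. P i n \<or> Q i n)"
proof -
  obtain P' where P': "semidec P'" "\<forall>\<^sub>F i in cofin C. \<forall>n. P i n \<longleftrightarrow> P' \<langle>i, n\<rangle>"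
    using assms(1) unfolding usemidec_def by auto
  obtain Q' where Q': "semidec Q'" "\<forall>\<^sub>F i in cofin C. \<forall>n. Q i n \<longleftrightarrow> Q' \<langle>i, n\<rangle>"
    using assms(2) unfolding usemidec_def by auto
  show ?thesis unfolding usemidec_def
  proof (intro exI conjI)
    show "semidec (\<lambda>m. P' m \<or> Q' m)" by (intro semidec_disj P' Q')
    show "\<forall>\<^sub>F i in cofin C. \<forall>n. (P i n \<or> Q i n) = (P' \<langle>i, n\<rangle> \<or> Q' \<langle>i, n\<rangle>)"
      using P'(2) Q'(2) by eventually_elim simp
  qed
qed

lemma usemidec_ex:
  assumes "usemidec C (\<lambda>i m. P i (cfst m) (csnd m))"
  shows "usemidec C (\<lambda>i n. \<exists>y. P i n y)"
proof -
  obtain Q where Q: "semidec Q"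
     "\<forall>\<^sub>F i in cofin C. \<forall>m. P i (cfst m) (csnd m) \<longleftrightarrow> Q \<langle>i, m\<rangle>"
    using assms unfolding usemidec_def by auto
  have "semidec (\<lambda>p. \<exists>y. Q \<langle>cfst p, \<langle>csnd p, y\<rangle>\<rangle>)"
    by (intro semidec_ex semidec_subst[OF Q(1)] computable_intros)
  then show ?thesis unfolding usemidec_def
  proof (intro exI conjI)
    show "\<forall>\<^sub>F i in cofin C. \<forall>n. (\<exists>y. P i n y) \<longleftrightarrow>
      (\<exists>y. Q \<langle>cfst \<langle>i, n\<rangle>, \<langle>csnd \<langle>i, n\<rangle>, y\<rangle>\<rangle>)"
      using Q(2)
    proof eventually_elim
      case (elim i)
      from elim[rule_format, of "\<langle>_, _\<rangle>"] show ?case by simp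
    qed
  qed
qed

lemma usemidec_ball:
  assumes "usemidec C (\<lambda>i m. P i (cfst m) (csnd m))" "ucomputable C b"
  shows "usemidec C (\<lambda>i n. \<forall>j<b i n. P i n j)"
proof -
  obtain Q where Q: "semidec Q"
     "\<forall>\<^sub>F i in cofin C. \<forall>m. P i (cfst m) (csnd m) \<longleftrightarrow> Q \<langle>i, m\<rangle>"
    using assms(1) unfolding usemidec_def by auto
  \<comment> \<open>\<open>semidec_ball\<close> wants a computable bound, whereas \<open>b\<close>
    is computable only along \<open>C\<close>. The bound is therefore made part of the argument
    first and substituted afterwards.\<close>
  have "semidec (\<lambda>p. \<forall>j<csnd p. Q \<langle>cfst (cfst p),
      \<langle>csnd (cfst p), j\<rangle>\<rangle>)"
    by (intro semidec_ball semidec_subst[OF Q(1)] computable_intros)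
  then have "usemidec C (\<lambda>i n. \<forall>j<b i n. Q \<langle>i, \<langle>n, j\<rangle>\<rangle>)"
    using usemidec_semidec[of "\<lambda>p. \<forall>j<csnd p. Q \<langle>cfst (cfst p),
      \<langle>csnd (cfst p), j\<rangle>\<rangle>" C "\<lambda>i n. \<langle>\<langle>i, n\<rangle>, b i n\<rangle>"]
    by (simp add: ucomputable_pair ucomputable_index ucomputable_var assms(2))
  then obtain R where R: "semidec R" "\<forall>\<^sub>F i in cofin C. \<forall>n. (\<forall>j<b i n. Q \<langle>i, \<langle>n, j\<rangle>\<rangle>) \<longleftrightarrow> R \<langle>i, n\<rangle>"
    unfolding usemidec_def by auto
  show ?thesis unfolding usemidec_def
  proof (intro exI conjI, rule R(1))
    show "\<forall>\<^sub>F i in cofin C. \<forall>n. (\<forall>j<b i n. P i n j) \<longleftrightarrow> R \<langle>i, n\<rangle>"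
      using Q(2) R(2)
    proof eventually_elim
      case (elim i)
      from elim(1)[rule_format, of "\<langle>_, _\<rangle>"] elim(2) show ?case by simp
    qed
  qed
qed

lemma usemidec_iterate:
  assumes "usemidec C (\<lambda>i m. P i (cfst (cfst m)) (csnd m)
      (code_nth (csnd (cfst m)) (csnd m))
      (code_nth (csnd (cfst m)) (Suc (csnd m))))"
    and b: "ucomputable C b" and a: "ucomputable C a" and c: "ucomputable C c"
  shows "usemidec C (\<lambda>i n. \<exists>w. w 0 = a i n \<and> (\<forall>j<b i n. P i n j (w j) (w (Suc j))) \<and> w (b i n) = c i n)"
  unfolding ex_sequence_iff_code
  by (intro usemidec_ex usemidec_conj usemidec_ball usemidec_eq ucomputable_code_nth
      ucomputable_subst[OF a] ucomputable_subst[OF b] ucomputable_subst[OF c]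
      ucomputable_fst ucomputable_snd ucomputable_var ucomputable_const assms(1))

lemmas usemidec_logic = usemidec_conj usemidec_disj usemidec_ex usemidec_ball usemidec_iterate
  usemidec_eq usemidec_neq usemidec_less

lemma usemidec_subst:
  assumes "usemidec C P" "ucomputable C f"
  shows "usemidec C (\<lambda>i n. P i (f i n))"
proof -
  obtain Q where Q: "semidec Q" "\<forall>\<^sub>F i in cofin C. \<forall>n. P i n \<longleftrightarrow> Q \<langle>i, n\<rangle>"
    using assms(1) unfolding usemidec_def by auto
  obtain R where R: "semidec R" "\<forall>\<^sub>F i in cofin C. \<forall>n. Q \<langle>i, f i n\<rangle> \<longleftrightarrow> R \<langle>i, n\<rangle>"
    using usemidec_semidec[OF Q(1) ucomputable_pair[OF ucomputable_index assms(2)]]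
    unfolding usemidec_def by auto
  have "\<forall>\<^sub>F i in cofin C. \<forall>n. P i (f i n) \<longleftrightarrow> R \<langle>i, n\<rangle>"
    using Q(2) R(2) by eventually_elim simp
  with R(1) show ?thesis unfolding usemidec_def by blast
qed

text \<open>A search for witnesses is uniform in the index, so an existential statement that holds
  almost everywhere is witnessed by one partial recursive function. This is the form in which the
  existential part of Los's theorem is used: all elements of cohesive products that have to be
  constructed by choice arise here.\<close>

lemma represented_select:
  assumes "usemidec C P" "\<forall>\<^sub>F i in cofin C. \<exists>y. P i y"
  obtains a where "represented C a" "\<forall>\<^sub>F i in cofin C. P i (a i)"
proof -
  obtain Q where Q: "semidec Q" "\<forall>\<^sub>F i in cofin C. \<forall>n. P i n \<longleftrightarrow> Q \<langle>i, n\<rangle>"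
    using assms(1) unfolding usemidec_def by auto
  have "semidec (\<lambda>m. Q \<langle>cfst m, csnd m\<rangle>)"
    using Q(1) by simp
  then obtain \<phi> where \<phi>: "partrec \<phi>" "\<And>n y. \<phi> n = Some y \<Longrightarrow> Q \<langle>n, y\<rangle>"
      "\<And>n y. Q \<langle>n, y\<rangle> \<Longrightarrow> \<exists>z. \<phi> n = Some z"
    by (rule semidec_uniformize[of "\<lambda>n y. Q \<langle>n, y\<rangle>"]) blast
  show ?thesis
  proof (rule that[of "\<lambda>i. the (\<phi> i)"])
    show "represented C (\<lambda>i. the (\<phi> i))" unfolding represented_def
      by (intro exI conjI, rule \<phi>(1)) (use assms(2) Q(2) in eventually_elim, use \<phi>(3) in fastforce)
    show "\<forall>\<^sub>F i in cofin C. P i (the (\<phi> i))"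
      using assms(2) Q(2) by eventually_elim (use \<phi>(2,3) in fastforce)
  qed
qed

lemma represented_cong:
  assumes "represented C a" "\<forall>\<^sub>F i in cofin C. a i = b i" shows "represented C b"
proof -
  obtain \<phi> where \<phi>: "partrec \<phi>" "\<forall>\<^sub>F i in cofin C. \<phi> i = Some (a i)"
    using assms(1) unfolding represented_def by auto
  have "\<forall>\<^sub>F i in cofin C. \<phi> i = Some (b i)" using \<phi>(2) assms(2) by eventually_elim simp
  with \<phi>(1) show ?thesis unfolding represented_def by blast
qed

text \<open>If the specification leaves no freedom, the search must return \<open>a\<close> itself;
  functions known only through a semidecidable graph are computed in this way.\<close>

lemma represented_unique:
  assumes "usemidec C P" "\<forall>\<^sub>F i in cofin C. \<forall>y. P i y \<longleftrightarrow> y = a i"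
  shows "represented C a"
proof -
  have "\<forall>\<^sub>F i in cofin C. \<exists>y. P i y" using assms(2) by eventually_elim simp
  then obtain b where b: "represented C b" "\<forall>\<^sub>F i in cofin C. P i (b i)"
    using represented_select[OF assms(1)] by blast
  show ?thesis
    by (rule represented_cong[OF b(1)]) (use b(2) assms(2) in eventually_elim, simp)
qed

lemma represented_ucomputable:
  assumes "ucomputable C f" shows "represented C (\<lambda>i. f i 0)"
proof -
  obtain \<phi> where \<phi>: "partrec \<phi>" "\<forall>\<^sub>F i in cofin C. \<forall>n. \<phi> \<langle>i, n\<rangle> = Some (f i n)"
    using assms unfolding ucomputable_def by auto
  have "partrec (\<lambda>i. \<phi> \<langle>i, 0\<rangle>)"
    by (intro partrec_subst[OF \<phi>(1)] computable_intros)
  then show ?thesis unfolding represented_def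
    by (intro exI conjI) (use \<phi>(2) in \<open>auto elim: eventually_mono\<close>)
qed

text \<open>Cohesiveness speaks of c.e. sets of indices, while \<open>P\<close> is c.e. only along
  \<open>C\<close>; fixing the idle argument at 0 turns a semidecidable predicate that agrees with
  \<open>P\<close> along \<open>C\<close> into such a set.\<close>

lemma cohesive_dichotomy:
  assumes "cohesive C" "usemidec C (\<lambda>i n. P i)"
  shows "(\<forall>\<^sub>F i in cofin C. P i) \<or> (\<forall>\<^sub>F i in cofin C. \<not> P i)"
proof -
  obtain Q where Q: "semidec Q" "\<forall>\<^sub>F i in cofin C. \<forall>n. P i \<longleftrightarrow> Q \<langle>i, n\<rangle>"
    using assms(2) unfolding usemidec_def by auto
  have "ce {i. Q \<langle>i, 0\<rangle>}"
    by (intro ce_if_semidec semidec_subst[OF Q(1)] computable_intros)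
  with assms(1) have "C \<subseteq>\<^sup>* {i. Q \<langle>i, 0\<rangle>} \<or> C \<subseteq>\<^sup>* - {i. Q \<langle>i, 0\<rangle>}"
    unfolding cohesive_def by blast
  then have "(\<forall>\<^sub>F i in cofin C. Q \<langle>i, 0\<rangle>) \<or> (\<forall>\<^sub>F i in cofin C. \<not> Q \<langle>i, 0\<rangle>)"
    unfolding eventually_cofin by (simp add: Compl_eq)
  then show ?thesis
  proof
    assume "\<forall>\<^sub>F i in cofin C. Q \<langle>i, 0\<rangle>"
    with Q(2) have "\<forall>\<^sub>F i in cofin C. P i" by eventually_elim simp
    then show ?thesis ..
  next
    assume "\<forall>\<^sub>F i in cofin C. \<not> Q \<langle>i, 0\<rangle>"
    with Q(2) have "\<forall>\<^sub>F i in cofin C. \<not> P i" by eventually_elim simp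
    then show ?thesis ..
  qed
qed

text \<open>If \<open>P\<close> does not hold almost always, it fails almost always, and then
  \<open>Q\<close> takes over; a search is needed for \<open>P\<close> alone.\<close>

lemma cohesive_disj:
  assumes "cohesive C" "usemidec C (\<lambda>i n. P i)" "\<forall>\<^sub>F i in cofin C. P i \<or> Q i"
  shows "(\<forall>\<^sub>F i in cofin C. P i) \<or> (\<forall>\<^sub>F i in cofin C. Q i)"
  using cohesive_dichotomy[OF assms(1,2)]
proof
  assume "\<forall>\<^sub>F i in cofin C. \<not> P i"
  with assms(3) have "\<forall>\<^sub>F i in cofin C. Q i" by eventually_elim simp
  then show ?thesis ..
qed simp


section \<open>Elements of cohesive products\<close>

definition celem :: "nat set \<Rightarrow> (nat \<Rightarrow> nat set) \<Rightarrow> (nat \<Rightarrow> nat) \<Rightarrow> bool"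
  where "celem C A a \<longleftrightarrow> (\<exists>\<phi>\<in>cfun C A. \<forall>\<^sub>F i in cofin C. \<phi> i = Some (a i))"

text \<open>\<open>cl C A a\<close> is empty unless \<open>celem C A a\<close>, which is why the
  rules that need a member of the class assume \<open>celem\<close>.\<close>

definition cl :: "nat set \<Rightarrow> (nat \<Rightarrow> nat set) \<Rightarrow> (nat \<Rightarrow> nat) \<Rightarrow> (nat \<rightharpoonup> nat) set"
  where "cl C A a = ccls C A (\<lambda>i. Some (a i))"

lemma ccls_eq_cl:
  assumes "\<forall>\<^sub>F i in cofin C. \<phi> i = Some (a i)"
  shows "ccls C A \<phi> = cl C A a"
proof -
  have "(\<forall>\<^sub>F i in cofin C. \<exists>v. \<phi> i = Some v \<and> \<psi> i = Some v) \<longleftrightarrow>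
      (\<forall>\<^sub>F i in cofin C. \<exists>v. Some (a i) = Some v \<and> \<psi> i = Some v)" for \<psi>
    by (rule eventually_subst) (use assms in eventually_elim, simp)
  then show ?thesis unfolding ccls_def cl_def eventually_cofin by simp
qed

lemma mem_cl_iff: "\<psi> \<in> cl C A a \<longleftrightarrow> \<psi> \<in> cfun C A \<and> (\<forall>\<^sub>F i in cofin C. \<psi> i = Some (a i))"
  unfolding cl_def ccls_def eventually_cofin by simp

lemma cl_cong: "\<forall>\<^sub>F i in cofin C. a i = b i \<Longrightarrow> cl C A a = cl C A b"
  unfolding cl_def[of C A a] by (rule ccls_eq_cl) simp

lemma cl_eq_iff:
  assumes "celem C A a"
  shows "cl C A a = cl C A b \<longleftrightarrow> (\<forall>\<^sub>F i in cofin C. a i = b i)"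
proof
  assume eq: "cl C A a = cl C A b"
  obtain \<phi> where \<phi>: "\<phi> \<in> cfun C A" "\<forall>\<^sub>F i in cofin C. \<phi> i = Some (a i)"
    using assms unfolding celem_def by auto
  then have "\<phi> \<in> cl C A b" by (simp add: mem_cl_iff flip: eq)
  then have "\<forall>\<^sub>F i in cofin C. \<phi> i = Some (b i)" by (simp add: mem_cl_iff)
  with \<phi>(2) show "\<forall>\<^sub>F i in cofin C. a i = b i" by eventually_elim simp
qed (rule cl_cong)

lemma cl_nonempty: "celem C A a \<Longrightarrow> cl C A a \<noteq> {}"
  unfolding celem_def using mem_cl_iff by blast

lemma cl_in_cprod: "celem C A a \<Longrightarrow> cl C A a \<in> cprod C A"
  unfolding celem_def cprod_def using ccls_eq_cl by blast

lemma cprodE: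
  assumes "U \<in> cprod C A"
  obtains a where "celem C A a" "U = cl C A a"
proof -
  obtain \<phi> where \<phi>: "\<phi> \<in> cfun C A" "U = ccls C A \<phi>" using assms unfolding cprod_def by auto
  have "\<forall>\<^sub>F i in cofin C. i \<in> dom \<phi>" using \<phi>(1) by (simp add: eventually_cofin cfun_def)
  then have ev: "\<forall>\<^sub>F i in cofin C. \<phi> i = Some (the (\<phi> i))" by eventually_elim auto
  show ?thesis
    by (rule that[of "\<lambda>i. the (\<phi> i)"]) (use \<phi> ev ccls_eq_cl[OF ev] celem_def in auto)
qed

lemma celem_represented: "celem C A a \<Longrightarrow> represented C a"
  unfolding celem_def represented_def cfun_def by auto

lemma celem_mem: "celem C A a \<Longrightarrow> \<forall>\<^sub>F i in cofin C. a i \<in> A i"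
  unfolding celem_def cfun_def by (auto elim: eventually_mono)

text \<open>\<open>cfun\<close> demands values in \<open>A i\<close> wherever the function
  converges, not just at almost all indices in \<open>C\<close>. A function computing
  \<open>a\<close> is therefore restricted to the indices at which membership of its value is
  confirmed; this uses the uniform semidecidability of the domains.\<close>

lemma celemI:
  assumes "semidec (\<lambda>m. csnd m \<in> A (cfst m))"
    and "represented C a" and mem: "\<forall>\<^sub>F i in cofin C. a i \<in> A i"
  shows "celem C A a"
proof -
  obtain \<phi> where \<phi>: "partrec \<phi>" "\<forall>\<^sub>F i in cofin C. \<phi> i = Some (a i)"
    using assms(2) unfolding represented_def by auto
  have "semidec (\<lambda>m. csnd m \<in> A (cfst m) \<and>
      \<phi> (cfst m) = Some (csnd m))"
    by (intro semidec_conj assms semidec_graph \<phi>)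
  then obtain \<psi> where \<psi>: "partrec \<psi>" "\<And>n y. \<psi> n = Some y \<Longrightarrow> y \<in> A n \<and> \<phi> n = Some y"
     "\<And>n y. y \<in> A n \<and> \<phi> n = Some y \<Longrightarrow> \<exists>z. \<psi> n = Some z"
    by (rule semidec_uniformize[of "\<lambda>n y. y \<in> A n \<and> \<phi> n = Some y"]) blast
  have ev: "\<forall>\<^sub>F i in cofin C. \<psi> i = Some (a i)"
    using \<phi>(2) mem
  proof eventually_elim
    case (elim i)
    then obtain z where "\<psi> i = Some z" using \<psi>(3) by blast
    with \<psi>(2)[of i z] elim show ?case by simp
  qed
  then have "C \<subseteq>\<^sup>* dom \<psi>"
    unfolding eventually_cofin almost_subset_def by (rule finite_subset[rotated]) auto
  with \<psi> have "\<psi> \<in> cfun C A" unfolding cfun_def by blast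
  with ev show ?thesis unfolding celem_def by blast
qed

lemma cmap1_cl:
  assumes "celem C A a"
  shows "cmap1 C B f (cl C A a) = cl C B (\<lambda>i. f i (a i))"
proof -
  have "ccls C B (\<lambda>i. map_option (f i) (\<phi> i)) = cl C B (\<lambda>i. f i (a i))" if "\<phi> \<in> cl C A a" for \<phi>
    by (rule ccls_eq_cl) (use that in \<open>auto simp: mem_cl_iff elim: eventually_mono\<close>)
  with cl_nonempty[OF assms] show ?thesis unfolding cmap1_def by auto
qed

lemma cmap2_cl:
  assumes "celem C A a" "celem C A' b"
  shows "cmap2 C B f (cl C A a) (cl C A' b) = cl C B (\<lambda>i. f i (a i) (b i))"
proof -
  have "ccls C B (\<lambda>i. Option.bind (\<phi> i) (\<lambda>x. map_option (f i x) (\<psi> i))) = cl C B (\<lambda>i. f i (a i) (b i))"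
    if "\<phi> \<in> cl C A a" "\<psi> \<in> cl C A' b" for \<phi> \<psi>
    by (rule ccls_eq_cl) (use that in \<open>auto simp: mem_cl_iff elim: eventually_elim2\<close>)
  with cl_nonempty[OF assms(1)] cl_nonempty[OF assms(2)] show ?thesis unfolding cmap2_def by auto
qed

lemma crel2_cl:
  assumes "celem C A a" "celem C A' b"
  shows "crel2 C R (cl C A a) (cl C A' b) \<longleftrightarrow> (\<forall>\<^sub>F i in cofin C. R i (a i) (b i))"
proof -
  have *: "(\<forall>\<^sub>F i in cofin C. \<exists>x y. \<phi> i = Some x \<and> \<psi> i = Some y \<and> R i x y) \<longleftrightarrow>
     (\<forall>\<^sub>F i in cofin C. R i (a i) (b i))"
    if "\<phi> \<in> cl C A a" "\<psi> \<in> cl C A' b" for \<phi> \<psi>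
  proof (rule eventually_subst)
    from that have "\<forall>\<^sub>F i in cofin C. \<phi> i = Some (a i)" "\<forall>\<^sub>F i in cofin C. \<psi> i = Some (b i)"
      by (auto simp: mem_cl_iff)
    then show "\<forall>\<^sub>F i in cofin C. (\<exists>x y. \<phi> i = Some x \<and> \<psi> i = Some y \<and> R i x y) = R i (a i) (b i)"
      by eventually_elim auto
  qed
  then show ?thesis
    using cl_nonempty[OF assms(1)] cl_nonempty[OF assms(2)]
    unfolding crel2_def eventually_cofin[symmetric] by fast
qed

section \<open>Partial homomorphisms on a Galois extension\<close>

lemma (in cring) finprod_add_eq_finsum_subsets:
  assumes "finite S" "y \<in> carrier R" "h \<in> S \<rightarrow> carrier R"
  shows "(\<Otimes>s\<in>S. y \<oplus> h s) = (\<Oplus>T\<in>Pow S. y [^] (card S - card T) \<otimes> (\<Otimes>t\<in>T. h t))"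
  using assms(1,3)
proof (induction S rule: finite_induct)
  case empty
  then show ?case by simp
next
  case (insert a S)
  have a: "h a \<in> carrier R" and h: "h \<in> S \<rightarrow> carrier R" using insert.prems by auto
  have hT: "(\<Otimes>t\<in>T. h t) \<in> carrier R" if "T \<subseteq> S" for T
    using that h by (intro finprod_closed) auto
  let ?F = "\<lambda>n T. y [^] (n - card T) \<otimes> (\<Otimes>t\<in>T. h t)"
  have F: "?F n \<in> Pow S \<rightarrow> carrier R" for n using hT assms(2) by auto
  have cardT: "card T \<le> card S" "finite T" if "T \<subseteq> S" for T
    using that insert.hyps(1) by (auto intro: card_mono finite_subset)
  have 1: "?F (Suc (card S)) T = y \<otimes> ?F (card S) T" if "T \<in> Pow S" for T
  proof -
    have "Suc (card S) - card T = Suc (card S - card T)" using cardT that by (simp add: Suc_diff_le)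
    then show ?thesis using assms(2) hT[of T] that by (simp add: nat_pow_Suc2 m_assoc m_lcomm)
  qed
  have 2: "?F (Suc (card S)) (insert a T) = h a \<otimes> ?F (card S) T" if T: "T \<in> Pow S" for T
  proof -
    have "a \<notin> T" using T insert.hyps(2) by auto
    moreover have "h \<in> T \<rightarrow> carrier R" using h T by auto
    ultimately have "(\<Otimes>t\<in>insert a T. h t) = h a \<otimes> (\<Otimes>t\<in>T. h t)" "card (insert a T) = Suc (card T)"
      using cardT(2)[of T] T a by (auto intro!: finprod_insert)
    then show ?thesis using a hT[of T] T assms(2) by (simp add: m_lcomm)
  qed
  have inj: "inj_on (insert a) (Pow S)"
    using insert.hyps(2) by (auto simp: inj_on_def) 
  have disj: "Pow S \<inter> insert a ` Pow S = {}" using insert.hyps(2) by auto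
  have F2: "?F (Suc (card S)) \<in> insert a ` Pow S \<rightarrow> carrier R"
    by (intro Pi_I, elim imageE) (metis 2 a F[of "card S", THEN funcset_mem] m_closed)
  have F1: "?F (Suc (card S)) \<in> Pow S \<rightarrow> carrier R" by (rule F)
  \<comment> \<open>Choosing \<open>y\<close> from the factor at \<open>a\<close> leads to the
    subsets without \<open>a\<close>, choosing \<open>h a\<close> to those with it.\<close>
  have "(\<Oplus>T\<in>Pow (insert a S). ?F (card (insert a S)) T) = (\<Oplus>T\<in>Pow S \<union> insert a ` Pow S. ?F (Suc (card S)) T)"
    using insert.hyps by (simp add: Pow_insert)
  also have "\<dots> = (\<Oplus>T\<in>Pow S. ?F (Suc (card S)) T) \<oplus> (\<Oplus>T\<in>insert a ` Pow S. ?F (Suc (card S)) T)"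
    by (rule finsum_Un_disjoint) (use insert.hyps(1) disj F1 F2 in auto)
  also have "(\<Oplus>T\<in>insert a ` Pow S. ?F (Suc (card S)) T) = (\<Oplus>T\<in>Pow S. ?F (Suc (card S)) (insert a T))"
    by (rule finsum_reindex[OF F2 inj])
  also have "\<dots> = (\<Oplus>T\<in>Pow S. h a \<otimes> ?F (card S) T)"
    by (rule finsum_cong') (use 2 F[of "card S"] a in auto)
  also have "\<dots> = h a \<otimes> (\<Oplus>T\<in>Pow S. ?F (card S) T)"
    by (rule finsum_rdistr[symmetric]) (use insert.hyps(1) a F in auto)
  also have "(\<Oplus>T\<in>Pow S. ?F (Suc (card S)) T) = (\<Oplus>T\<in>Pow S. y \<otimes> ?F (card S) T)"
    by (rule finsum_cong') (use 1 F[of "card S"] assms(2) in auto)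
  also have "\<dots> = y \<otimes> (\<Oplus>T\<in>Pow S. ?F (card S) T)"
    by (rule finsum_rdistr[symmetric]) (use insert.hyps(1) assms(2) F in auto)
  also have "y \<otimes> (\<Oplus>T\<in>Pow S. ?F (card S) T) \<oplus> h a \<otimes> (\<Oplus>T\<in>Pow S. ?F (card S) T)
      = (y \<oplus> h a) \<otimes> (\<Oplus>T\<in>Pow S. ?F (card S) T)"
    using F[of "card S"] a assms(2) by (intro l_distr[symmetric] finsum_closed) auto
  also have "\<dots> = (y \<oplus> h a) \<otimes> (\<Otimes>s\<in>S. y \<oplus> h s)"
    using insert.IH[OF h] by simp
  also have "\<dots> = (\<Otimes>s\<in>insert a S. y \<oplus> h s)"
    using insert.hyps a h assms(2) by (intro finprod_insert[symmetric]) auto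
  finally show ?case by simp
qed

text \<open>The elementary symmetric polynomial of degree \<open>k\<close> in the family
  \<open>h\<close>. The sum is over sets of indices, so coinciding values of \<open>h\<close> count
  with multiplicity.\<close>

definition (in cring) esym :: "('i \<Rightarrow> 'a) \<Rightarrow> 'i set \<Rightarrow> nat \<Rightarrow> 'a"
  where "esym h S k = (\<Oplus>T\<in>{T. T \<subseteq> S \<and> card T = k}. \<Otimes>t\<in>T. h t)"

lemma (in cring) esym_closed:
  assumes "h \<in> S \<rightarrow> carrier R" shows "esym h S k \<in> carrier R"
  unfolding esym_def using assms by (intro finsum_closed Pi_I finprod_closed) auto

lemma (in cring) finprod_add_eq_esym:
  assumes S: "finite S" and y: "y \<in> carrier R" and h: "h \<in> S \<rightarrow> carrier R"
  shows "(\<Otimes>s\<in>S. y \<oplus> h s) = (\<Oplus>k\<in>{..card S}. y [^] (card S - k) \<otimes> esym h S k)"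
proof -
  let ?A = "\<lambda>k. {T. T \<subseteq> S \<and> card T = k}"
  have hT: "(\<Otimes>t\<in>T. h t) \<in> carrier R" if "T \<subseteq> S" for T
    using that h by (intro finprod_closed) auto
  have un: "Pow S = (\<Union>k\<in>{..card S}. ?A k)"
    using card_mono[OF S] by auto
  have fin: "finite (?A k)" for k using S by auto
  have "(\<Otimes>s\<in>S. y \<oplus> h s) = (\<Oplus>T\<in>Pow S. y [^] (card S - card T) \<otimes> (\<Otimes>t\<in>T. h t))"
    by (rule finprod_add_eq_finsum_subsets[OF assms])
  also have "\<dots> = (\<Oplus>k\<in>{..card S}. \<Oplus>T\<in>?A k. y [^] (card S - card T) \<otimes> (\<Otimes>t\<in>T. h t))"
    unfolding un by (rule add.finprod_UN_disjoint) (use fin hT y in \<open>auto simp: pairwise_def disjnt_def\<close>)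
  also have "\<dots> = (\<Oplus>k\<in>{..card S}. y [^] (card S - k) \<otimes> esym h S k)"
  proof (rule finsum_cong')
    fix k assume "k \<in> {..card S}"
    have "(\<Oplus>T\<in>?A k. y [^] (card S - card T) \<otimes> (\<Otimes>t\<in>T. h t)) =
        (\<Oplus>T\<in>?A k. y [^] (card S - k) \<otimes> (\<Otimes>t\<in>T. h t))"
      by (rule finsum_cong') (use hT y in auto)
    also have "\<dots> = y [^] (card S - k) \<otimes> esym h S k"
      unfolding esym_def by (rule finsum_rdistr[symmetric]) (use fin hT y in auto)
    finally show "(\<Oplus>T\<in>?A k. y [^] (card S - card T) \<otimes> (\<Otimes>t\<in>T. h t)) = y [^] (card S - k) \<otimes> esym h S k" .
  qed (use y esym_closed[OF h] in auto)
  finally show ?thesis .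
qed

text \<open>\<open>\<pi>\<close> permutes the subsets of size \<open>k\<close>, so
  \<open>\<tau>\<close> only permutes the summands.\<close>

lemma (in cring) hom_esym:
  assumes \<tau>: "\<tau> \<in> ring_hom R R" and \<pi>: "bij_betw \<pi> S S" and h: "h \<in> S \<rightarrow> carrier R"
    and eq: "\<And>s. s \<in> S \<Longrightarrow> \<tau> (h s) = h (\<pi> s)"
  shows "\<tau> (esym h S k) = esym h S k"
proof -
  interpret \<tau>: ring_hom_cring R R \<tau>
    by (intro ring_hom_cring.intro ring_hom_cring_axioms.intro is_cring \<tau>)
  let ?A = "{T. T \<subseteq> S \<and> card T = k}"
  have hT: "(\<Otimes>t\<in>T. h t) \<in> carrier R" if "T \<subseteq> S" for T
    using that h by (intro finprod_closed) auto
  have inj: "inj_on \<pi> S" and im: "\<pi> ` S = S" using \<pi> by (auto simp: bij_betw_def)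
  have inj': "inj_on ((`) \<pi>) ?A"
    by (rule inj_onI) (metis (no_types, lifting) inj inj_on_image_eq_iff mem_Collect_eq)
  have im': "(`) \<pi> ` ?A = ?A"
  proof (intro equalityI subsetI)
    fix T assume "T \<in> (`) \<pi> ` ?A"
    then show "T \<in> ?A" using im card_image[OF inj_on_subset[OF inj]] by auto
  next
    fix T assume T: "T \<in> ?A"
    have "T \<subseteq> \<pi> ` S" using T im by simp
    then have pre: "\<pi> ` (S \<inter> \<pi> -` T) = T" by auto
    have "card (\<pi> ` (S \<inter> \<pi> -` T)) = card (S \<inter> \<pi> -` T)"
      by (rule card_image[OF inj_on_subset[OF inj]]) simp
    with pre T show "T \<in> (`) \<pi> ` ?A" by (intro image_eqI[of _ _ "S \<inter> \<pi> -` T"]) auto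
  qed
  have "\<tau> (esym h S k) = (\<Oplus>T\<in>?A. \<tau> (\<Otimes>t\<in>T. h t))"
    unfolding esym_def using hT by (subst \<tau>.hom_finsum) (auto simp: comp_def)
  also have "\<dots> = (\<Oplus>T\<in>?A. \<Otimes>t\<in>\<pi> ` T. h t)"
  proof (rule finsum_cong')
    fix T assume "T \<in> ?A"
    then have T: "T \<subseteq> S" by auto
    have "\<tau> (\<Otimes>t\<in>T. h t) = (\<Otimes>t\<in>T. \<tau> (h t))"
      using T h by (subst \<tau>.hom_finprod) (auto simp: comp_def)
    also have "\<dots> = (\<Otimes>t\<in>T. h (\<pi> t))"
      using T eq im h by (intro finprod_cong') auto
    also have "\<dots> = (\<Otimes>t\<in>\<pi> ` T. h t)"
      using T im h by (intro finprod_reindex[symmetric] inj_on_subset[OF inj]) auto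
    finally show "\<tau> (\<Otimes>t\<in>T. h t) = (\<Otimes>t\<in>\<pi> ` T. h t)" .
  qed (use hT im in \<open>auto intro!: hT\<close>)
  also have "\<dots> = (\<Oplus>T\<in>(`) \<pi> ` ?A. \<Otimes>t\<in>T. h t)"
    using hT by (intro finsum_reindex[symmetric] inj') (unfold im', auto)
  also have "\<dots> = esym h S k" unfolding im' esym_def ..
  finally show ?thesis .
qed

text \<open>
  The coefficients of the polynomial with roots \<open>f s\<close> are invariant, so \<open>rel\<close> takes its root
  \<open>f s0\<close> to a root.
\<close>

lemma (in domain) related_to_conjugate:
  assumes S: "finite S" and f: "f \<in> S \<rightarrow> carrier R" and s0: "s0 \<in> S"
    and hom: "\<And>\<tau>. \<tau> \<in> \<Sigma> \<Longrightarrow> \<tau> \<in> ring_hom R R"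
    and perm: "\<And>\<tau>. \<tau> \<in> \<Sigma> \<Longrightarrow> \<exists>\<pi>. bij_betw \<pi> S S \<and> (\<forall>s\<in>S. \<tau> (f s) = f (\<pi> s))"
    and rel_carrier: "\<And>x y. (x, y) \<in> rel \<Longrightarrow> x \<in> carrier R \<and> y \<in> carrier R"
    and rel_add: "\<And>x y x' y'. (x, y) \<in> rel \<Longrightarrow> (x', y') \<in> rel \<Longrightarrow> (x \<oplus> x', y \<oplus> y') \<in> rel"
    and rel_mult: "\<And>x y x' y'. (x, y) \<in> rel \<Longrightarrow> (x', y') \<in> rel \<Longrightarrow> (x \<otimes> x', y \<otimes> y') \<in> rel"
    and rel_fixed: "\<And>e. e \<in> carrier R \<Longrightarrow> (\<forall>\<tau>\<in>\<Sigma>. \<tau> e = e) \<Longrightarrow> (e, e) \<in> rel"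
    and rel_zero: "\<And>y. (\<zero>, y) \<in> rel \<Longrightarrow> y = \<zero>"
    and PQ: "(f s0, Q) \<in> rel"
  shows "\<exists>s\<in>S. Q = f s"
proof -
  \<comment> \<open>With the roots negated, the factors are sums and the coefficients carry no
    signs; for \<open>rel\<close> only closure under sums and products is assumed.\<close>
  let ?h = "\<lambda>s. \<ominus> f s"
  let ?e = "esym ?h S"
  have h: "?h \<in> S \<rightarrow> carrier R" using f by auto
  have Q: "Q \<in> carrier R" using PQ rel_carrier by blast
  have s0c: "f s0 \<in> carrier R" using f s0 by auto
  have e: "?e k \<in> carrier R" for k by (rule esym_closed[OF h])
  have inv: "\<tau> (?e k) = ?e k" if \<tau>: "\<tau> \<in> \<Sigma>" for \<tau> k
  proof -
    interpret \<tau>: ring_hom_cring R R \<tau>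
      by (intro ring_hom_cring.intro ring_hom_cring_axioms.intro is_cring hom \<tau>)
    obtain \<pi> where \<pi>: "bij_betw \<pi> S S" "\<And>s. s \<in> S \<Longrightarrow> \<tau> (f s) = f (\<pi> s)" using perm[OF \<tau>] by blast
    show ?thesis
    proof (rule hom_esym[OF hom[OF \<tau>] \<pi>(1) h])
      fix s assume "s \<in> S"
      then have "f s \<in> carrier R" using f by auto
      with \<pi>(2)[OF \<open>s \<in> S\<close>] show "\<tau> (\<ominus> f s) = \<ominus> f (\<pi> s)" by simp
    qed
  qed
  have rel_e: "(?e k, ?e k) \<in> rel" for k by (rule rel_fixed[OF e]) (simp add: inv)
  have rel_1: "(\<one>, \<one>) \<in> rel" and rel_0: "(\<zero>, \<zero>) \<in> rel"
    using hom ring_hom_zero[OF hom ring_axioms ring_axioms] ring_hom_one[OF hom]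
    by (auto intro!: rel_fixed)
  have rel_pow: "(f s0 [^] (n::nat), Q [^] n) \<in> rel" for n
    by (induction n) (auto intro: rel_1 rel_mult PQ)
  let ?p = "\<lambda>y A. (\<Oplus>k\<in>A. y [^] (card S - k) \<otimes> ?e k)"
  have "finite A \<Longrightarrow> (?p (f s0) A, ?p Q A) \<in> rel" for A
  proof (induction A rule: finite_induct)
    case (insert k A)
    have "?p y (insert k A) = y [^] (card S - k) \<otimes> ?e k \<oplus> ?p y A" if "y \<in> carrier R" for y
      using insert.hyps that e by (intro finsum_insert) auto
    then show ?case
      using insert.IH Q s0c by (auto intro!: rel_add rel_mult rel_pow rel_e)
  qed (simp add: rel_0)
  from this[of "{..card S}"]
  have "((\<Otimes>s\<in>S. f s0 \<oplus> ?h s), (\<Otimes>s\<in>S. Q \<oplus> ?h s)) \<in> rel"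
    by (simp add: finprod_add_eq_esym[OF S _ h] Q s0c)
  moreover have "(\<Otimes>s\<in>S. f s0 \<oplus> ?h s) = \<zero>"
  proof -
    have c: "(\<lambda>s. f s0 \<oplus> ?h s) \<in> S - {s0} \<rightarrow> carrier R" using f s0c by auto
    have "(\<Otimes>s\<in>insert s0 (S - {s0}). f s0 \<oplus> ?h s) = (f s0 \<oplus> ?h s0) \<otimes> (\<Otimes>s\<in>S - {s0}. f s0 \<oplus> ?h s)"
      using S c s0c by (intro finprod_insert) auto
    moreover have "insert s0 (S - {s0}) = S" using s0 by auto
    ultimately show ?thesis using s0c c by (simp add: r_neg)
  qed
  ultimately have "(\<Otimes>s\<in>S. Q \<oplus> ?h s) = \<zero>" using rel_zero by simp
  moreover have "finite A \<Longrightarrow> A \<subseteq> S \<Longrightarrow> (\<Otimes>s\<in>A. Q \<oplus> ?h s) = \<zero> \<Longrightarrow> \<exists>s\<in>A. Q \<oplus> ?h s = \<zero>" for A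
  proof (induction A rule: finite_induct)
    case (insert s A)
    have A: "(\<lambda>s. Q \<oplus> ?h s) \<in> A \<rightarrow> carrier R" using insert.prems Q f by auto
    have s: "Q \<oplus> ?h s \<in> carrier R" using insert.prems Q f by auto
    have "(Q \<oplus> ?h s) \<otimes> (\<Otimes>s\<in>A. Q \<oplus> ?h s) = \<zero>"
      using insert.hyps insert.prems A s by simp
    then have "Q \<oplus> ?h s = \<zero> \<or> (\<Otimes>s\<in>A. Q \<oplus> ?h s) = \<zero>"
      by (rule integral[OF _ s]) (rule finprod_closed[OF A])
    then show ?case using insert.IH insert.prems by auto
  qed simp
  ultimately obtain s where s: "s \<in> S" "Q \<oplus> ?h s = \<zero>" using S by blast
  then have "Q = f s" using Q f r_right_minus_eq[of Q "f s"] by (auto simp: a_minus_def)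
  with s(1) show ?thesis ..
qed

text \<open>Lets the automorphisms of a field act coefficientwise on polynomials over it, where a
  whole tuple becomes a single element.\<close>

lemma (in cring) UP_map_hom:
  assumes "\<tau> \<in> ring_hom R R"
  shows "(\<lambda>p n. \<tau> (p n)) \<in> ring_hom (UP R) (UP R)"
proof -
  interpret \<tau>: ring_hom_cring R R \<tau>
    by (intro ring_hom_cring.intro ring_hom_cring_axioms.intro is_cring assms)
  have cl: "(\<lambda>n. \<tau> (p n)) \<in> up R" if p: "p \<in> up R" for p
  proof -
    from p obtain n where "bound \<zero> n p" by auto
    then have "bound \<zero> n (\<lambda>n. \<tau> (p n))" by (simp add: bound_def)
    then show ?thesis using p by auto
  qed
  show ?thesis
  proof (rule ring_hom_memI)
    fix p q assume "p \<in> carrier (UP R)" "q \<in> carrier (UP R)"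
    then have p: "p \<in> up R" and q: "q \<in> up R" by (auto simp: UP_def)
    show "(\<lambda>n. \<tau> ((p \<otimes>\<^bsub>UP R\<^esub> q) n)) = (\<lambda>n. \<tau> (p n)) \<otimes>\<^bsub>UP R\<^esub> (\<lambda>n. \<tau> (q n))"
    proof
      fix n
      have "\<tau> (\<Oplus>i\<in>{..n}. p i \<otimes> q (n - i)) = (\<Oplus>i\<in>{..n}. \<tau> (p i) \<otimes> \<tau> (q (n - i)))"
        using p q by (subst \<tau>.hom_finsum) (auto intro!: finsum_cong' simp: comp_def mem_upD)
      then show "\<tau> ((p \<otimes>\<^bsub>UP R\<^esub> q) n) = ((\<lambda>n. \<tau> (p n)) \<otimes>\<^bsub>UP R\<^esub> (\<lambda>n. \<tau> (q n))) n"
        using p q cl by (simp add: UP_def)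
    qed
    show "(\<lambda>n. \<tau> ((p \<oplus>\<^bsub>UP R\<^esub> q) n)) = (\<lambda>n. \<tau> (p n)) \<oplus>\<^bsub>UP R\<^esub> (\<lambda>n. \<tau> (q n))"
      using p q cl by (auto simp: UP_def mem_upD)
  next
    show "(\<lambda>n. \<tau> (\<one>\<^bsub>UP R\<^esub> n)) = \<one>\<^bsub>UP R\<^esub>" by (auto simp: UP_def)
  qed (use cl in \<open>auto simp: UP_def\<close>)
qed

section \<open>Automorphisms of a finite Galois extension\<close>

lemma mem_Gal_iff: "\<gamma> \<in> carrier (Gal K E) \<longleftrightarrow>
    \<gamma> \<in> Bij (carrier K) \<and> \<gamma> \<in> ring_hom K K \<and> (\<forall>x\<in>E. \<gamma> x = x)"
  by (simp add: Gal_def)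

lemma mult_Gal:
  assumes "\<gamma> \<in> carrier (Gal K E)" "\<delta> \<in> carrier (Gal K E)"
  shows "\<gamma> \<otimes>\<^bsub>Gal K E\<^esub> \<delta> = compose (carrier K) \<gamma> \<delta>"
  using assms by (simp add: mem_Gal_iff) (simp add: Gal_def BijGroup_def)

lemma compose_Gal:
  assumes "\<gamma> \<in> carrier (Gal K E)" "\<delta> \<in> carrier (Gal K E)" "ring K" "E \<subseteq> carrier K"
  shows "compose (carrier K) \<gamma> \<delta> \<in> carrier (Gal K E)"
proof -
  have \<gamma>: "\<gamma> \<in> ring_hom K K" and \<delta>: "\<delta> \<in> ring_hom K K" using assms(1,2) by (auto simp: mem_Gal_iff)
  interpret ring K by fact
  note hom = ring_hom_closed[OF \<delta>] ring_hom_mult[OF \<gamma>] ring_hom_mult[OF \<delta>] ring_hom_add[OF \<gamma>]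
    ring_hom_add[OF \<delta>] ring_hom_one[OF \<gamma>] ring_hom_one[OF \<delta>]
  have "compose (carrier K) \<gamma> \<delta> \<in> ring_hom K K"
    by (rule ring_hom_memI) (simp_all add: compose_def hom ring_hom_closed[OF \<gamma>])
  then show ?thesis
    using assms by (auto simp: mem_Gal_iff compose_Bij) (auto simp: compose_def)
qed

text \<open>An automorphism over \<open>E\<close> is determined by its values on a finite spanning
  list, and each entry can only move to a root of a nonzero polynomial over \<open>E\<close> that
  vanishes at it.\<close>

lemma finite_Gal:
  assumes "finite_Galois K E" shows "finite (carrier (Gal K E))"
proof -
  interpret K: field K using assms by (simp add: finite_Galois_def)
  have E: "subfield E K" and fd: "K.finite_dimension E (carrier K)"
    using assms by (auto simp: finite_Galois_def)
  have Ec: "E \<subseteq> carrier K" using E subfieldE(3) by blast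
  obtain Us where Us: "set Us \<subseteq> carrier K" "K.Span E Us = carrier K"
    using fd K.exists_base[OF E] by blast
  let ?roots = "\<lambda>u. (\<lambda>\<gamma>. \<gamma> u) ` carrier (Gal K E)"
  have fin: "finite (?roots u)" if u: "u \<in> carrier K" for u
  proof -
    have "(K.algebraic over E) u"
      by (rule K.finite_dimension_imp_algebraic[OF E K.carrier_is_subring fd u])
    then obtain p where p: "p \<in> carrier (E[X]\<^bsub>K\<^esub>)" "p \<noteq> []" "K.eval p u = \<zero>\<^bsub>K\<^esub>"
      using K.algebraicE[OF subfieldE(1)[OF E] u] by blast
    have pE: "set p \<subseteq> E" using p(1) unfolding univ_poly_def polynomial_def by auto
    have pK: "p \<in> carrier (poly_ring K)"
      using p(1) Ec unfolding univ_poly_def polynomial_def by auto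
    have "K.is_root p (\<gamma> u)" if \<gamma>: "\<gamma> \<in> carrier (Gal K E)" for \<gamma>
    proof -
      have h: "\<gamma> \<in> ring_hom K K" and fix_E: "\<And>x. x \<in> E \<Longrightarrow> \<gamma> x = x" using \<gamma> by (auto simp: mem_Gal_iff)
      interpret \<gamma>: ring_hom_ring K K \<gamma> by (intro ring_hom_ringI2 K.ring_axioms h)
      have "map \<gamma> p = p" using pE fix_E by (intro map_idI) auto
      then have "K.eval p (\<gamma> u) = \<zero>\<^bsub>K\<^esub>" using \<gamma>.eval_hom'[of u p] u pE Ec p(3) by auto
      then show ?thesis using p(2) u by (simp add: K.is_root_def)
    qed
    then have "?roots u \<subseteq> {x. K.is_root p x}" by auto
    then show ?thesis using K.finite_number_of_roots[OF pK] finite_subset by blast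
  qed
  let ?A = "\<Union>u\<in>set Us. ?roots u"
  have "finite {xs. set xs \<subseteq> ?A \<and> length xs = length Us}"
    by (intro finite_lists_length_eq finite_UN_I fin) (use Us in auto)
  moreover have "(\<lambda>\<gamma>. map \<gamma> Us) ` carrier (Gal K E) \<subseteq> {xs. set xs \<subseteq> ?A \<and> length xs = length Us}"
    by (force simp: image_iff)
  moreover have "inj_on (\<lambda>\<gamma>. map \<gamma> Us) (carrier (Gal K E))"
  proof (rule inj_onI)
    fix \<gamma> \<delta> assume \<gamma>: "\<gamma> \<in> carrier (Gal K E)" and \<delta>: "\<delta> \<in> carrier (Gal K E)" and eq: "map \<gamma> Us = map \<delta> Us"
    have comb: "\<gamma> (K.combine Ks Us) = K.combine Ks (map \<gamma> Us)" if \<gamma>: "\<gamma> \<in> carrier (Gal K E)" and Ks: "set Ks \<subseteq> E" for \<gamma> Ks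
    proof -
      have h: "\<gamma> \<in> ring_hom K K" and fix_E: "\<And>x. x \<in> E \<Longrightarrow> \<gamma> x = x" using \<gamma> by (auto simp: mem_Gal_iff)
      interpret \<gamma>: ring_hom_ring K K \<gamma> by (intro ring_hom_ringI2 K.ring_axioms h)
      show ?thesis using Ks Us(1)
      proof (induction Ks Us rule: K.combine.induct)
        case (1 k Ks u Us)
        then have "k \<in> carrier K" "K.combine Ks Us \<in> carrier K" "u \<in> carrier K" using Ec by auto
        with 1 fix_E[of k] show ?case by simp
      qed auto
    qed
    have "\<gamma> x = \<delta> x" if "x \<in> carrier K" for x
    proof -
      have "x \<in> K.Span E Us" using that by (simp only: Us(2))
      then have "x \<in> {K.combine Ks Us | Ks. set Ks \<subseteq> E}" by (simp only: K.Span_eq_combine_set[OF E Us(1)])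
      then obtain Ks where "set Ks \<subseteq> E" "x = K.combine Ks Us" by blast
      then show ?thesis using comb[OF \<gamma>] comb[OF \<delta>] eq by simp
    qed
    then show "\<gamma> = \<delta>"
      using \<gamma> \<delta> by (intro extensionalityI[of _ "carrier K"]) (auto simp: mem_Gal_iff Bij_def)
  qed
  ultimately show ?thesis using finite_imageD finite_subset by blast
qed

text \<open>Treating the entries one at a time would give a separate automorphism for each of them.
  As coefficients of one polynomial in \<open>UP K\<close> they are all moved by the same
  automorphism. No primitive element is involved, so \<open>K\<close> may be finite and the entries
  need not generate it.\<close>

lemma related_tuples_conjugate:
  fixes K :: "'a ring"
  assumes Gal: "finite_Galois K E"
    and rel_carrier: "\<And>x y. (x, y) \<in> rel \<Longrightarrow> x \<in> carrier K \<and> y \<in> carrier K"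
    and rel_add: "\<And>x y x' y'. (x, y) \<in> rel \<Longrightarrow> (x', y') \<in> rel \<Longrightarrow> (x \<oplus>\<^bsub>K\<^esub> x', y \<oplus>\<^bsub>K\<^esub> y') \<in> rel"
    and rel_mult: "\<And>x y x' y'. (x, y) \<in> rel \<Longrightarrow> (x', y') \<in> rel \<Longrightarrow> (x \<otimes>\<^bsub>K\<^esub> x', y \<otimes>\<^bsub>K\<^esub> y') \<in> rel"
    and rel_E: "\<And>e. e \<in> E \<Longrightarrow> (e, e) \<in> rel"
    and rel_zero: "\<And>y. (\<zero>\<^bsub>K\<^esub>, y) \<in> rel \<Longrightarrow> y = \<zero>\<^bsub>K\<^esub>"
    and us: "length us = length vs" "\<And>j. j < length us \<Longrightarrow> (us ! j, vs ! j) \<in> rel"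
  shows "\<exists>\<gamma>\<in>carrier (Gal K E). vs = map \<gamma> us"
proof -
  interpret K: field K using Gal by (simp add: finite_Galois_def)
  interpret UP_domain K "UP K" by (simp add: UP_domain_def K.domain_axioms)
  let ?D = "UP K"
  let ?G = "carrier (Gal K E)"
  have E: "subfield E K" using Gal by (auto simp: finite_Galois_def)
  have Ec: "E \<subseteq> carrier K" using E subfieldE(3) by blast
  have fixed: "x \<in> E" if "x \<in> carrier K" "\<forall>\<gamma>\<in>?G. \<gamma> x = x" for x
    using Gal that unfolding finite_Galois_def by blast
  have D: "p \<in> carrier ?D \<longleftrightarrow> p \<in> up K" for p by (simp add: UP_def)
  \<comment> \<open>The tuple as a coefficient sequence padded by zeros; the padding is related to
    itself by \<open>rel_0\<close>.\<close>
  define P where "P us n = (if n < length us then us ! n else \<zero>\<^bsub>K\<^esub>)" for us n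
  have P: "P us \<in> up K" if "set us \<subseteq> carrier K" for us
  proof
    show "P us n \<in> carrier K" for n using that by (auto simp: P_def)
    show "\<exists>n. bound \<zero>\<^bsub>K\<^esub> n (P us)" by (rule exI[of _ "length us"]) (simp add: P_def bound_def)
  qed
  let ?map = "\<lambda>\<gamma> p n. \<gamma> (p n :: 'a) :: 'a"
  have usc: "set us \<subseteq> carrier K" and vsc: "set vs \<subseteq> carrier K"
    using us rel_carrier by (auto simp: set_conv_nth)
  \<comment> \<open>The base point among the conjugates. The identity is restricted to the carrier
    because members of \<open>Bij\<close> are extensional.\<close>
  let ?id = "\<lambda>x\<in>carrier K. x"
  have id: "?id \<in> ?G"
    using Ec by (auto simp: mem_Gal_iff id_Bij intro!: ring_hom_memI)
  define rel' where "rel' = {(p, q). p \<in> up K \<and> q \<in> up K \<and> (\<forall>n. (p n, q n) \<in> rel)}"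
  have rel_0: "(\<zero>\<^bsub>K\<^esub>, \<zero>\<^bsub>K\<^esub>) \<in> rel"
    using rel_E subringE(2)[OF subfieldE(1)[OF E]] by blast
  have rel_sum: "((\<Oplus>\<^bsub>K\<^esub>i\<in>A. f i), (\<Oplus>\<^bsub>K\<^esub>i\<in>A. g i)) \<in> rel"
    if "finite A" "\<And>i. i \<in> A \<Longrightarrow> (f i, g i) \<in> rel" for A :: "nat set" and f g
    using that
  proof (induction A rule: finite_induct)
    case (insert i A)
    have "f \<in> insert i A \<rightarrow> carrier K" "g \<in> insert i A \<rightarrow> carrier K"
      using insert.prems rel_carrier by blast+
    with insert show ?case by (simp add: rel_add)
  qed (simp add: rel_0)
  have "\<exists>\<gamma>\<in>?G. P vs = ?map \<gamma> (P us)"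
  proof (rule related_to_conjugate[where \<Sigma> = "?map ` ?G" and rel = rel' and ?s0.0 = ?id])
    show "finite ?G" by (rule finite_Gal[OF Gal])
    show "(\<lambda>\<gamma>. ?map \<gamma> (P us)) \<in> ?G \<rightarrow> carrier ?D"
      using ring_hom_closed[OF K.UP_map_hom] P[OF usc] D by (auto simp: mem_Gal_iff)
    show "?id \<in> ?G" by (rule id)
    show "\<tau> \<in> ring_hom ?D ?D" if "\<tau> \<in> ?map ` ?G" for \<tau>
      using that K.UP_map_hom by (auto simp: mem_Gal_iff)
    show "\<exists>\<pi>. bij_betw \<pi> ?G ?G \<and> (\<forall>\<gamma>\<in>?G. \<tau> (?map \<gamma> (P us)) = ?map (\<pi> \<gamma>) (P us))"
      if "\<tau> \<in> ?map ` ?G" for \<tau>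
    proof -
      from that obtain \<delta> where \<delta>: "\<delta> \<in> ?G" and \<tau>: "\<tau> = ?map \<delta>" by auto
      \<comment> \<open>\<open>\<delta>\<close> permutes the conjugates of \<open>P us\<close> by
        left translation in the finite group.\<close>
      let ?\<pi> = "\<lambda>\<gamma>. compose (carrier K) \<delta> \<gamma>"
      have cl: "?\<pi> ` ?G \<subseteq> ?G" using compose_Gal[OF \<delta> _ K.ring_axioms Ec] by auto
      have "inj_on ?\<pi> ?G"
      proof (rule inj_onI)
        fix \<gamma> \<gamma>' assume \<gamma>: "\<gamma> \<in> ?G" "\<gamma>' \<in> ?G" and eq: "?\<pi> \<gamma> = ?\<pi> \<gamma>'"
        have "inj_on \<delta> (carrier K)" using \<delta> by (auto simp: mem_Gal_iff Bij_def bij_betw_def)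
        moreover have "\<delta> (\<gamma> x) = \<delta> (\<gamma>' x)" if "x \<in> carrier K" for x
          using fun_cong[OF eq, of x] that by (simp add: compose_def)
        ultimately have "\<gamma> x = \<gamma>' x" if "x \<in> carrier K" for x
          using that \<gamma> by (auto simp: mem_Gal_iff inj_on_def intro: ring_hom_closed)
        then show "\<gamma> = \<gamma>'"
          using \<gamma> by (intro extensionalityI[of _ "carrier K"]) (auto simp: mem_Gal_iff Bij_def)
      qed
      with cl have "bij_betw ?\<pi> ?G ?G"
        using endo_inj_surj[OF finite_Gal[OF Gal] cl] by (auto simp: bij_betw_def)
      moreover have "\<tau> (?map \<gamma> (P us)) = ?map (?\<pi> \<gamma>) (P us)" if "\<gamma> \<in> ?G" for \<gamma>
        using mem_upD[OF P[OF usc]] by (auto simp: \<tau> compose_def)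
      ultimately show ?thesis by blast
    qed
    show "x \<in> carrier ?D \<and> y \<in> carrier ?D" if "(x, y) \<in> rel'" for x y
      using that by (auto simp: rel'_def D)
    show "(x \<oplus>\<^bsub>?D\<^esub> x', y \<oplus>\<^bsub>?D\<^esub> y') \<in> rel'" if "(x, y) \<in> rel'" "(x', y') \<in> rel'" for x y x' y'
      using that rel_add by (auto simp: rel'_def UP_def K.up_add_closed)
    show "(x \<otimes>\<^bsub>?D\<^esub> x', y \<otimes>\<^bsub>?D\<^esub> y') \<in> rel'" if "(x, y) \<in> rel'" "(x', y') \<in> rel'" for x y x' y'
    proof -
      have xy: "x \<in> up K" "x' \<in> up K" "y \<in> up K" "y' \<in> up K" "\<And>n. (x n, y n) \<in> rel" "\<And>n. (x' n, y' n) \<in> rel"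
        using that by (auto simp: rel'_def)
      then have "x \<otimes>\<^bsub>?D\<^esub> x' \<in> up K" "y \<otimes>\<^bsub>?D\<^esub> y' \<in> up K"
        using m_closed[of x x'] m_closed[of y y'] by (auto simp: D)
      moreover have "((x \<otimes>\<^bsub>?D\<^esub> x') n, (y \<otimes>\<^bsub>?D\<^esub> y') n) \<in> rel" for n
        unfolding UP_def by (simp add: xy(1-4), rule rel_sum, simp, rule rel_mult, rule xy(5), rule xy(6))
      ultimately show ?thesis by (auto simp: rel'_def)
    qed
    \<comment> \<open>The Galois condition enters here: a polynomial fixed by the whole group has
      its coefficients in the fixed field, which is \<open>E\<close>.\<close>
    show "(e, e) \<in> rel'" if e: "e \<in> carrier ?D" "\<forall>\<tau>\<in>?map ` ?G. \<tau> e = e" for e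
    proof -
      have "e n \<in> E" for n
        by (rule fixed) (use e in \<open>auto simp: D mem_upD fun_eq_iff\<close>)
      with e(1) show ?thesis by (auto simp: rel'_def D rel_E)
    qed
    show "y = \<zero>\<^bsub>?D\<^esub>" if "(\<zero>\<^bsub>?D\<^esub>, y) \<in> rel'" for y
      using that rel_zero by (auto simp: rel'_def UP_def)
    have "?map ?id (P us) = P us" using mem_upD[OF P[OF usc]] by auto
    then show "(?map ?id (P us), P vs) \<in> rel'"
      using us rel_0 P[OF usc] P[OF vsc] by (auto simp: rel'_def P_def)
  qed
  then obtain \<gamma> where \<gamma>: "\<gamma> \<in> ?G" "P vs = ?map \<gamma> (P us)" by blast
  have "vs = map \<gamma> us"
  proof (rule nth_equalityI)
    show "vs ! j = map \<gamma> us ! j" if "j < length vs" for j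
      using fun_cong[OF \<gamma>(2), of j] that us(1) by (simp add: P_def)
  qed (use us in simp)
  with \<gamma>(1) show ?thesis by blast
qed

section \<open>Computable operations on tuples\<close>

lemma tuples_iff: "a \<in> tuples A \<longleftrightarrow> set (list_decode a) \<subseteq> A"
  unfolding tuples_def by (auto simp: image_iff intro: exI[of _ "list_decode a"] bexI[of _ "list_decode a"])

lemma list_encode_in_tuples [simp]: "list_encode xs \<in> tuples A \<longleftrightarrow> set xs \<subseteq> A"
  by (simp add: tuples_iff)

lemma tuples_nth: "a \<in> tuples A \<Longrightarrow> k < code_length a \<Longrightarrow> code_nth a k \<in> A"
  unfolding tuples_iff code_nth_eq by (auto simp: code_nth_eq code_length_def)

lemma tuples_iff_nth: "a \<in> tuples A \<longleftrightarrow> (\<forall>k<code_length a. code_nth a k \<in> A)"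
proof
  assume "\<forall>k<code_length a. code_nth a k \<in> A"
  then show "a \<in> tuples A"
    unfolding tuples_iff by (auto simp: code_nth_eq code_length_def in_set_conv_nth)
qed (simp add: tuples_nth)

lemma semidec_tuples:
  assumes "semidec (\<lambda>m. csnd m \<in> A (cfst m))"
  shows "semidec (\<lambda>m. csnd m \<in> tuples (A (cfst m)))"
proof -
  have "semidec (\<lambda>m. \<forall>k<code_length (csnd m). code_nth (csnd m) k \<in> A (cfst m))"
  proof (rule semidec_ball)
    show "semidec (\<lambda>m. code_nth (csnd (cfst m)) (csnd m)
        \<in> A (cfst (cfst m)))"
      using semidec_subst[OF assms, of "\<lambda>m. \<langle>cfst (cfst m),
          code_nth (csnd (cfst m)) (csnd m)\<rangle>"]
      by (simp add: computable_intros computable_code_nth)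
  qed (intro computable_code_length computable_intros)
  then show ?thesis by (simp only: tuples_iff_nth)
qed

definition code_append :: "nat \<Rightarrow> nat \<Rightarrow> nat"
  where "code_append a b = list_encode (list_decode a @ list_decode b)"

definition code_map :: "(nat \<Rightarrow> nat) \<Rightarrow> nat \<Rightarrow> nat"
  where "code_map f a = list_encode (map f (list_decode a))"

definition code_take :: "nat \<Rightarrow> nat \<Rightarrow> nat"
  where "code_take k a = list_encode (take k (list_decode a))"

text \<open>Length and entries pin down a code, and both can be checked along \<open>C\<close>; so
  the result of an operation on tuples can be found by searching for the code that fits.\<close>

lemma eq_list_encode_iff:
  "y = list_encode xs \<longleftrightarrow> code_length y = length xs \<and> (\<forall>k<length xs. code_nth y k = xs ! k)"
  by (metis list_decode_eq_iff_nth list_decode_inverse list_encode_inverse)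

lemma represented_code_append:
  assumes a: "represented C a" and b: "represented C b"
  shows "represented C (\<lambda>i. code_append (a i) (b i))"
proof -
  \<comment> \<open>\<open>code_length a < Suc k\<close> expresses
    \<open>code_length a \<le> k\<close> by the strict comparison for which semidecidability is
    available.\<close>
  have nth: "(k < code_length a \<and> code_nth y k = code_nth a k \<or>
      code_length a < Suc k \<and> code_nth y k = code_nth b (k - code_length a))
      \<longleftrightarrow> code_nth y k = (list_decode a @ list_decode b) ! k"
    if "k < code_length a + code_length b" for a b y k
  proof (cases "k < code_length a")
    case False
    then have "k - code_length a < code_length b" using that by arith
    with False show ?thesis by (simp add: nth_append code_nth_eq flip: code_length_def)
  qed (simp add: nth_append code_nth_eq flip: code_length_def)
  have iff: "(code_length y = code_length a + code_length b \<and> (\<forall>k<code_length a + code_length b.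
      k < code_length a \<and> code_nth y k = code_nth a k \<or>
      code_length a < Suc k \<and> code_nth y k = code_nth b (k - code_length a))) \<longleftrightarrow> y = code_append a b" for a b y
    unfolding code_append_def eq_list_encode_iff length_append code_length_def[symmetric]
    using nth by auto
  have "usemidec C (\<lambda>i y. code_length y = code_length (a i) + code_length (b i) \<and>
    (\<forall>k<code_length (a i) + code_length (b i). k < code_length (a i) \<and> code_nth y k = code_nth (a i) k \<or>
      code_length (a i) < Suc k \<and> code_nth y k = code_nth (b i) (k - code_length (a i))))"
    by (intro usemidec_logic ucomputable_intros a b)
  from represented_unique[OF this] show ?thesis by (simp add: iff)
qed

lemma represented_code_take:
  assumes a: "represented C a" and j: "represented C j" and "\<forall>\<^sub>F i in cofin C. j i \<le> code_length (a i)"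
  shows "represented C (\<lambda>i. code_take (j i) (a i))"
proof -
  have iff: "code_length y = j \<and> (\<forall>k<j. code_nth y k = code_nth a k) \<longleftrightarrow> y = code_take j a"
    if "j \<le> code_length a" for j a y
    using that unfolding code_take_def eq_list_encode_iff
    by (auto simp: min_def code_nth_eq simp flip: code_length_def)
  have "usemidec C (\<lambda>i y. code_length y = j i \<and> (\<forall>k<j i. code_nth y k = code_nth (a i) k))"
    by (intro usemidec_logic ucomputable_intros a j)
  then show ?thesis
    by (rule represented_unique) (use assms(3) in eventually_elim, simp add: iff)
qed

lemma represented_code_nth:
  "represented C a \<Longrightarrow> represented C j \<Longrightarrow> represented C (\<lambda>i. code_nth (a i) (j i))"
  using represented_ucomputable[OF ucomputable_code_nth[OF ucomputable_represented ucomputable_represented]] by simp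

lemma represented_code_drop:
  assumes "represented C a" "represented C j"
  shows "represented C (\<lambda>i. code_drop (a i) (j i))"
  using represented_ucomputable[OF ucomputable_computable2[of code_drop,
    OF _ ucomputable_represented[OF assms(1)] ucomputable_represented[OF assms(2)]]]
  by (simp add: computable_code_drop computable_intros)

lemma represented_Suc: "represented C j \<Longrightarrow> represented C (\<lambda>i. Suc (j i))"
  using represented_ucomputable[OF ucomputable_Suc[OF ucomputable_represented]] by simp

text \<open>The code of \<open>[x]\<close> is \<open>Suc \<langle>x, 0\<rangle>\<close>.\<close>

lemma represented_singleton: "represented C x \<Longrightarrow> represented C (\<lambda>i. list_encode [x i])"
  using represented_ucomputable[OF ucomputable_Suc[OF ucomputable_pair[OF ucomputable_represented ucomputable_const[of C 0]]]]
  by simp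

lemma represented_const: "represented C (\<lambda>i. k)"
  using represented_ucomputable[OF ucomputable_const] .

text \<open>\<open>f\<close> may be incomputable away from the entries of \<open>a\<close>, as the
  field operations may be outside the carriers; its graph \<open>P\<close> has to be right at these
  entries only.\<close>

lemma represented_code_map:
  assumes a: "represented C a"
    and P: "usemidec C (\<lambda>i m. P i (cfst m) (csnd m))"
    and f: "\<forall>\<^sub>F i in cofin C. \<forall>x\<in>set (list_decode (a i)). \<forall>y. P i x y \<longleftrightarrow> y = f i x"
  shows "represented C (\<lambda>i. code_map (f i) (a i))"
proof -
  have P': "usemidec C (\<lambda>i n. P i (x i n) (y i n))" if "ucomputable C x" "ucomputable C y" for x y
    using usemidec_subst[OF P ucomputable_pair[OF that]] by simp
  have "usemidec C (\<lambda>i y. code_length y = code_length (a i) \<and>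
      (\<forall>k<code_length (a i). P i (code_nth (a i) k) (code_nth y k)))"
    by (intro usemidec_logic P' ucomputable_intros a)
  then show ?thesis
  proof (rule represented_unique)
    show "\<forall>\<^sub>F i in cofin C. \<forall>y. (code_length y = code_length (a i) \<and>
      (\<forall>k<code_length (a i). P i (code_nth (a i) k) (code_nth y k))) \<longleftrightarrow> y = code_map (f i) (a i)"
      using f
    proof eventually_elim
      case (elim i)
      then have "P i (code_nth (a i) k) y \<longleftrightarrow> y = f i (code_nth (a i) k)" if "k < code_length (a i)" for k y
        using that by (simp add: code_nth_eq code_length_def)
      then show ?case
        unfolding code_map_def eq_list_encode_iff
        by (auto simp: code_nth_eq simp flip: code_length_def)
    qed
  qed
qed

section \<open>Uniformly computable Galois extensions\<close>

locale uniform_Galois =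
  fixes K :: "nat \<Rightarrow> nat ring" and F :: "nat ring" and \<Psi> :: "nat \<Rightarrow> nat \<Rightarrow> nat"
    and G :: "nat \<Rightarrow> nat monoid" and act :: "nat \<Rightarrow> nat \<Rightarrow> nat \<Rightarrow> nat" and C :: "nat set"
  assumes extensions: "ucomp_field_extensions K F \<Psi>"
    and finite_Galois: "\<And>i. finite_Galois (K i) (\<Psi> i ` carrier F)"
    and groups: "ucomp_groups G"
    and Galois_action: "\<And>i. Galois_action (G i) (K i) (\<Psi> i ` carrier F) (act i)"
    and actions: "ucomp_actions G K act"
    and cohesive: "cohesive C"
begin

abbreviation "KC \<equiv> \<lambda>i. carrier (K i)"
abbreviation "GC \<equiv> \<lambda>i. carrier (G i)"
abbreviation "TC \<equiv> \<lambda>i. tuples (carrier (K i))"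

section \<open>The presented Galois groups and their actions\<close>

lemma field_K: "field (K i)" and Psi_hom: "\<Psi> i \<in> ring_hom F (K i)" and ring_F: "ring F"
  using extensions unfolding ucomp_field_extensions_def by (auto simp: field.is_ring)

lemma ring_K: "ring (K i)"
  using field_K field.is_ring by blast

lemma group_G: "group (G i)"
  using Galois_action unfolding Galois_action_def by blast

lemma act_iso: "(\<lambda>g. \<lambda>x\<in>KC i. act i g x) \<in> iso (G i) (Gal (K i) (\<Psi> i ` carrier F))"
  using Galois_action unfolding Galois_action_def by blast

lemma act_Gal: "g \<in> GC i \<Longrightarrow> (\<lambda>x\<in>KC i. act i g x) \<in> carrier (Gal (K i) (\<Psi> i ` carrier F))"
  using act_iso unfolding iso_def bij_betw_def by blast

lemma Gal_act:
  assumes "\<gamma> \<in> carrier (Gal (K i) (\<Psi> i ` carrier F))"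
  obtains g where "g \<in> GC i" "\<And>x. x \<in> KC i \<Longrightarrow> \<gamma> x = act i g x"
proof -
  obtain g where "g \<in> GC i" "\<gamma> = (\<lambda>x\<in>KC i. act i g x)"
    using assms act_iso[of i] unfolding iso_def bij_betw_def by blast
  then show ?thesis using that by simp
qed

lemma act_closed:
  assumes "g \<in> GC i" "x \<in> KC i" shows "act i g x \<in> KC i"
proof -
  have "(\<lambda>x\<in>KC i. act i g x) \<in> ring_hom (K i) (K i)"
    using act_Gal[OF assms(1)] unfolding mem_Gal_iff by blast
  from ring_hom_closed[OF this assms(2)] assms(2) show ?thesis by simp
qed

lemma act_hom:
  assumes "g \<in> GC i" shows "act i g \<in> ring_hom (K i) (K i)"
proof -
  interpret ring "K i" by (rule ring_K)
  have h: "(\<lambda>x\<in>KC i. act i g x) \<in> ring_hom (K i) (K i)"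
    using act_Gal[OF assms] unfolding mem_Gal_iff by blast
  show ?thesis
    by (rule ring_hom_memI)
      (use act_closed[OF assms] ring_hom_mult[OF h] ring_hom_add[OF h] ring_hom_one[OF h] in auto)
qed

lemma act_Psi: "g \<in> GC i \<Longrightarrow> c \<in> carrier F \<Longrightarrow> act i g (\<Psi> i c) = \<Psi> i c"
  using act_Gal[of g i] ring_hom_closed[OF Psi_hom] unfolding mem_Gal_iff by auto

lemma act_mult:
  assumes "g \<in> GC i" "h \<in> GC i" "x \<in> KC i"
  shows "act i (g \<otimes>\<^bsub>G i\<^esub> h) x = act i g (act i h x)"
proof -
  have "(\<lambda>x\<in>KC i. act i (g \<otimes>\<^bsub>G i\<^esub> h) x) =
      compose (KC i) (\<lambda>x\<in>KC i. act i g x) (\<lambda>x\<in>KC i. act i h x)"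
    using hom_mult[OF Group.iso_imp_homomorphism[OF act_iso[of i]] assms(1,2)]
      mult_Gal[OF act_Gal[OF assms(1)] act_Gal[OF assms(2)]] by simp
  from fun_cong[OF this, of x] show ?thesis
    using assms act_closed by (simp add: compose_def)
qed

text \<open>By \<open>act_mult\<close> the unit acts as an idempotent map, and an injective
  idempotent map is the identity.\<close>

lemma act_one:
  assumes "x \<in> KC i"
  shows "act i \<one>\<^bsub>G i\<^esub> x = x"
proof -
  interpret G: group "G i" by (rule group_G)
  have "act i \<one>\<^bsub>G i\<^esub> (act i \<one>\<^bsub>G i\<^esub> x) = act i \<one>\<^bsub>G i\<^esub> x"
    using act_mult[of "\<one>\<^bsub>G i\<^esub>" i "\<one>\<^bsub>G i\<^esub>" x] assms by simp
  moreover have "inj_on (act i \<one>\<^bsub>G i\<^esub>) (KC i)"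
    using act_Gal[of "\<one>\<^bsub>G i\<^esub>" i] unfolding mem_Gal_iff Bij_def bij_betw_def by (auto simp: inj_on_def)
  ultimately show ?thesis using assms act_closed[of "\<one>\<^bsub>G i\<^esub>" i x] by (auto simp: inj_on_def)
qed

lemma act_faithful:
  assumes "g \<in> GC i" "h \<in> GC i" "\<And>x. x \<in> KC i \<Longrightarrow> act i g x = act i h x"
  shows "g = h"
proof -
  have "(\<lambda>x\<in>KC i. act i g x) = (\<lambda>x\<in>KC i. act i h x)"
    using assms(3) by (auto simp: restrict_def)
  then show ?thesis using act_iso[of i] assms(1,2) unfolding iso_def bij_betw_def inj_on_def by blast
qed

lemma finite_G: "finite (GC i)"
  using act_iso[of i] finite_Gal[OF finite_Galois[of i]] bij_betw_finite unfolding iso_def by blast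

section \<open>Semidecidability of carriers and operations\<close>

lemma mem_pair_set_iff: "m \<in> {\<langle>i, x\<rangle> | i x. P i x} \<longleftrightarrow> P (cfst m) (csnd m)"
proof
  assume "P (cfst m) (csnd m)"
  then have "m = \<langle>cfst m, csnd m\<rangle> \<and> P (cfst m) (csnd m)" by simp
  then show "m \<in> {\<langle>i, x\<rangle> | i x. P i x}" by blast
qed auto

lemma semidec_carrier_K: "semidec (\<lambda>m. csnd m \<in> carrier (K (cfst m)))"
  and semidec_carrier_G: "semidec (\<lambda>m. csnd m \<in> carrier (G (cfst m)))"
  and semidec_carrier_F: "semidec (\<lambda>m. csnd m \<in> carrier F)"
proof -
  have "decidable {\<langle>i, x\<rangle> | i x. x \<in> KC i}" "decidable {\<langle>i, x\<rangle> | i x. x \<in> GC i}"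
    "decidable {\<langle>i::nat, x\<rangle> | i x. x \<in> carrier F}"
    using extensions groups unfolding ucomp_field_extensions_def ucomp_rings_def ucomp_groups_def by auto
  from this[THEN semidec_decidable(1), OF computable_id]
  show "semidec (\<lambda>m. csnd m \<in> carrier (K (cfst m)))"
    "semidec (\<lambda>m. csnd m \<in> carrier (G (cfst m)))"
    "semidec (\<lambda>m. csnd m \<in> carrier F)"
    unfolding mem_pair_set_iff by auto
qed

lemmas celem_K = celemI[OF semidec_carrier_K]
lemmas celem_G = celemI[OF semidec_carrier_G]
lemmas celem_tuple = celemI[OF semidec_tuples[OF semidec_carrier_K]]
lemmas celem_tuple_F = celemI[OF semidec_tuples[OF semidec_carrier_F]]

lemma usemidec_K: "ucomputable C x \<Longrightarrow> usemidec C (\<lambda>i n. x i n \<in> KC i)"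
  using usemidec_semidec2[OF semidec_carrier_K ucomputable_index] .

lemma usemidec_G: "ucomputable C x \<Longrightarrow> usemidec C (\<lambda>i n. x i n \<in> GC i)"
  using usemidec_semidec2[OF semidec_carrier_G ucomputable_index] .

lemma usemidec_F: "ucomputable C x \<Longrightarrow> usemidec C (\<lambda>i n. x i n \<in> carrier F)"
  using usemidec_semidec2[OF semidec_carrier_F ucomputable_index] .

text \<open>Outside the carriers the operations need not be computable, so their graphs are restricted.\<close>

definition "add_graph i x y z \<longleftrightarrow> x \<in> KC i \<and> y \<in> KC i \<and> z = x \<oplus>\<^bsub>K i\<^esub> y"
definition "mult_graph i x y z \<longleftrightarrow> x \<in> KC i \<and> y \<in> KC i \<and> z = x \<otimes>\<^bsub>K i\<^esub> y"
definition "mult_graph_G i x y z \<longleftrightarrow> x \<in> GC i \<and> y \<in> GC i \<and> z = x \<otimes>\<^bsub>G i\<^esub> y"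
definition "act_graph i g x y \<longleftrightarrow> g \<in> GC i \<and> x \<in> KC i \<and> y = act i g x"
definition "Psi_graph i c y \<longleftrightarrow> c \<in> carrier F \<and> y = \<Psi> i c"

lemma usemidec_operation_graphs:
  assumes "ucomputable C x" "ucomputable C y" "ucomputable C z"
  shows usemidec_add_graph: "usemidec C (\<lambda>i n. add_graph i (x i n) (y i n) (z i n))"
    and usemidec_mult_graph: "usemidec C (\<lambda>i n. mult_graph i (x i n) (y i n) (z i n))"
    and usemidec_mult_graph_G: "usemidec C (\<lambda>i n. mult_graph_G i (x i n) (y i n) (z i n))"
proof -
  have "decidable {\<langle>i, \<langle>x, \<langle>y, x \<oplus>\<^bsub>K i\<^esub> y\<rangle>\<rangle>\<rangle> | i x y. x \<in> KC i \<and> y \<in> KC i}"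
    "decidable {\<langle>i, \<langle>x, \<langle>y, x \<otimes>\<^bsub>K i\<^esub> y\<rangle>\<rangle>\<rangle> | i x y. x \<in> KC i \<and> y \<in> KC i}"
    "decidable {\<langle>i, \<langle>x, \<langle>y, x \<otimes>\<^bsub>G i\<^esub> y\<rangle>\<rangle>\<rangle> | i x y. x \<in> GC i \<and> y \<in> GC i}"
    using extensions groups
    unfolding ucomp_field_extensions_def ucomp_rings_def ucomp_groups_def by auto
  note this[THEN usemidec_decidable, OF ucomputable_pair[OF ucomputable_index
      ucomputable_pair[OF assms(1) ucomputable_pair[OF assms(2,3)]]]]
  then show "usemidec C (\<lambda>i n. add_graph i (x i n) (y i n) (z i n))"
    "usemidec C (\<lambda>i n. mult_graph i (x i n) (y i n) (z i n))"
    "usemidec C (\<lambda>i n. mult_graph_G i (x i n) (y i n) (z i n))"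
    unfolding add_graph_def mult_graph_def mult_graph_G_def by (simp_all add: conj_ac)
qed

lemma usemidec_act_graph:
  assumes "ucomputable C g" "ucomputable C x" "ucomputable C y"
  shows "usemidec C (\<lambda>i n. act_graph i (g i n) (x i n) (y i n))"
proof -
  obtain \<phi> where \<phi>: "partrec \<phi>" 
    "\<And>i g x. g \<in> GC i \<Longrightarrow> x \<in> KC i \<Longrightarrow> \<phi> \<langle>i, \<langle>g, x\<rangle>\<rangle> = Some (act i g x)"
    using actions unfolding ucomp_actions_def by blast
  have "act_graph i g x y \<longleftrightarrow> g \<in> GC i \<and> x \<in> KC i \<and> \<phi> \<langle>i, \<langle>g, x\<rangle>\<rangle> = Some y" for i g x y
    unfolding act_graph_def using \<phi>(2) by auto
  then show ?thesis
    by (simp only:) (intro usemidec_conj usemidec_G usemidec_K usemidec_partrec[OF \<phi>(1)] ucomputable_intros assms)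
qed

lemma usemidec_Psi_graph:
  assumes "ucomputable C x" "ucomputable C y"
  shows "usemidec C (\<lambda>i n. Psi_graph i (x i n) (y i n))"
proof -
  obtain \<phi> where \<phi>: "partrec \<phi>" "\<And>i x. x \<in> carrier F \<Longrightarrow> \<phi> \<langle>i, x\<rangle> = Some (\<Psi> i x)"
    using extensions unfolding ucomp_field_extensions_def ucomp_maps_def by blast
  have "Psi_graph i x y \<longleftrightarrow> x \<in> carrier F \<and> \<phi> \<langle>i, x\<rangle> = Some y" for i x y
    unfolding Psi_graph_def using \<phi>(2) by auto
  then show ?thesis
    by (simp only:) (intro usemidec_conj usemidec_F usemidec_partrec[OF \<phi>(1)] ucomputable_intros assms)
qed

lemma represented_constants:
  "represented C (\<lambda>i. \<zero>\<^bsub>K i\<^esub>)" "represented C (\<lambda>i. \<one>\<^bsub>K i\<^esub>)" "represented C (\<lambda>i. \<one>\<^bsub>G i\<^esub>)"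
proof -
  have *: "represented C f" if "decidable {\<langle>i, f i\<rangle> | i. True}" for f
  proof (rule represented_unique)
    show "usemidec C (\<lambda>i y. \<langle>i, y\<rangle> \<in> {\<langle>i, f i\<rangle> | i. True})"
      by (intro usemidec_decidable that ucomputable_intros)
  qed auto
  show "represented C (\<lambda>i. \<zero>\<^bsub>K i\<^esub>)" "represented C (\<lambda>i. \<one>\<^bsub>K i\<^esub>)" "represented C (\<lambda>i. \<one>\<^bsub>G i\<^esub>)"
    using extensions groups unfolding ucomp_field_extensions_def ucomp_rings_def ucomp_groups_def
    by (auto intro: *)
qed

end

section \<open>Evaluation of integral polynomials\<close>

text \<open>Each step determines the next value, so up to \<open>n\<close> the only history is
  \<open>W\<close>. This brings recursively defined values into the shape that
  \<open>usemidec_iterate\<close> handles.\<close>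

lemma ex_sequence_iff:
  assumes "W 0 = u" "\<And>j v. j < n \<Longrightarrow> Q j (W j) v \<longleftrightarrow> v = W (Suc j)"
  shows "(\<exists>w. w 0 = u \<and> (\<forall>j<n. Q j (w j) (w (Suc j))) \<and> w n = z) \<longleftrightarrow> z = W n"
proof
  assume "\<exists>w. w 0 = u \<and> (\<forall>j<n. Q j (w j) (w (Suc j))) \<and> w n = z"
  then obtain w where w: "w 0 = u" "\<And>j. j < n \<Longrightarrow> Q j (w j) (w (Suc j))" "w n = z" by blast
  have "j \<le> n \<Longrightarrow> w j = W j" for j
  proof (induction j)
    case (Suc j)
    then show ?case using w(2)[of j] assms(2)[of j "w (Suc j)"] by simp
  qed (simp add: w assms)
  with w(3) show "z = W n" by blast
qed (use assms in blast)

text \<open>\<open>foldr\<close> works from the right: after \<open>j\<close> steps the last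
  \<open>j\<close> entries have been consumed.\<close>

lemma foldr_drop_step:
  assumes "j < length zs"
  shows "foldr f (drop (length zs - Suc j) zs) u
    = f (zs ! (length zs - Suc j)) (foldr f (drop (length zs - j) zs) u)"
proof -
  have "drop (length zs - Suc j) zs = zs ! (length zs - Suc j) # drop (Suc (length zs - Suc j)) zs"
    using assms by (intro Cons_nth_drop_Suc[symmetric]) auto
  then show ?thesis using assms by (simp add: Suc_diff_Suc)
qed

lemma monom_eval_closed:
  assumes "ring R" "set xs \<subseteq> carrier R"
  shows "monom_eval R e xs \<in> carrier R"
proof -
  interpret ring R by fact
  have "set zs \<subseteq> carrier R \<times> UNIV \<Longrightarrow> foldr (\<lambda>(x, k) m. (x [^]\<^bsub>R\<^esub> k) \<otimes>\<^bsub>R\<^esub> m) zs \<one>\<^bsub>R\<^esub> \<in> carrier R"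
    for zs :: "(nat \<times> nat) list"
    by (induction zs) auto
  moreover have "set (zip xs e) \<subseteq> carrier R \<times> UNIV"
    using assms(2) by (auto dest: set_zip_leftD)
  ultimately show ?thesis unfolding monom_eval_def by blast
qed

lemma poly_eval_closed:
  assumes "ring R" "set xs \<subseteq> carrier R"
  shows "poly_eval R p xs \<in> carrier R"
proof -
  interpret ring R by fact
  have "foldr (\<lambda>(c, e) s. add_pow R c (monom_eval R e xs) \<oplus>\<^bsub>R\<^esub> s) zs \<zero>\<^bsub>R\<^esub> \<in> carrier R"
    for zs :: "(int \<times> nat list) list"
    by (induction zs) (auto simp: monom_eval_closed[OF assms])
  then show ?thesis unfolding poly_eval_def .
qed

lemma hom_monom_eval:
  assumes "ring R" "h \<in> ring_hom R R" "set xs \<subseteq> carrier R"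
  shows "monom_eval R e (map h xs) = h (monom_eval R e xs)"
proof -
  interpret h: ring_hom_ring R R h by (intro ring_hom_ringI2 assms)
  show ?thesis using assms(3)
  proof (induction xs arbitrary: e)
    case (Cons x xs)
    then have "h (monom_eval R e (x # xs)) = monom_eval R e (map h (x # xs))" if "e = k # ks" for k ks
      using that monom_eval_closed[OF assms(1), of xs ks] by (simp add: monom_eval_def h.hom_nat_pow)
    then show ?case by (cases e) (auto simp: monom_eval_def)
  qed (simp add: monom_eval_def)
qed

lemma hom_poly_eval:
  assumes "ring R" "h \<in> ring_hom R R" "set xs \<subseteq> carrier R"
  shows "poly_eval R p (map h xs) = h (poly_eval R p xs)"
proof -
  interpret h: ring_hom_ring R R h by (intro ring_hom_ringI2 assms)
  interpret ha: group_hom "add_monoid R" "add_monoid R" h by (rule h.a_group_hom)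
  have add_pow: "h (add_pow R (c::int) x) = add_pow R c (h x)" if "x \<in> carrier R" for c x
    using ha.hom_int_pow[of x c] that by (simp add: add_pow_def)
  have cl: "foldr (\<lambda>(c, e) s. add_pow R c (monom_eval R e xs) \<oplus>\<^bsub>R\<^esub> s) zs \<zero>\<^bsub>R\<^esub> \<in> carrier R"
    for zs :: "(int \<times> nat list) list"
    by (induction zs) (auto simp: monom_eval_closed[OF assms(1,3)])
  have "foldr (\<lambda>(c, e) s. add_pow R c (monom_eval R e (map h xs)) \<oplus>\<^bsub>R\<^esub> s) zs \<zero>\<^bsub>R\<^esub> =
    h (foldr (\<lambda>(c, e) s. add_pow R c (monom_eval R e xs) \<oplus>\<^bsub>R\<^esub> s) zs \<zero>\<^bsub>R\<^esub>)"
    for zs :: "(int \<times> nat list) list"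
    by (induction zs)
      (auto simp: hom_monom_eval[OF assms] add_pow monom_eval_closed[OF assms(1,3)] cl)
  then show ?thesis unfolding poly_eval_def .
qed

context uniform_Galois
begin

definition "pow_graph i x e z \<longleftrightarrow> x \<in> KC i \<and> z = x [^]\<^bsub>K i\<^esub> (e :: nat)"
definition "scale_graph i (m :: nat) x z \<longleftrightarrow> x \<in> KC i \<and> z = add_pow (K i) m x"
definition "int_scale_graph i c x z \<longleftrightarrow> x \<in> KC i \<and> z = add_pow (K i) (int_decode c) x"
definition "monom_graph i e a z \<longleftrightarrow>
  a \<in> TC i \<and> z = monom_eval (K i) (list_decode e) (list_decode a)"
definition "poly_graph i p a z \<longleftrightarrow>
  a \<in> TC i \<and> z = poly_eval (K i) p (list_decode a)"

section \<open>Computability of polynomial evaluation along \<open>C\<close>\<close>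

lemma usemidec_pow_graph:
  assumes x: "ucomputable C x" and e: "ucomputable C e" and z: "ucomputable C z"
  shows "usemidec C (\<lambda>i n. pow_graph i (x i n) (e i n) (z i n))"
proof -
  have iff: "pow_graph i x e z \<longleftrightarrow> x \<in> KC i \<and>
    (\<exists>w. w 0 = \<one>\<^bsub>K i\<^esub> \<and> (\<forall>j<e. mult_graph i (w j) x (w (Suc j))) \<and> w e = z)" for i x e z
  proof (cases "x \<in> KC i")
    case True
    interpret ring "K i" by (rule ring_K)
    show ?thesis
      using True by (subst ex_sequence_iff[where W = "\<lambda>j. x [^]\<^bsub>K i\<^esub> j"])
        (auto simp: pow_graph_def mult_graph_def)
  qed (simp add: pow_graph_def)
  show ?thesis unfolding iff
    by (intro usemidec_conj usemidec_K usemidec_iterate usemidec_mult_graph assms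
        ucomputable_subst[OF x] ucomputable_intros represented_constants)
qed

lemma usemidec_scale_graph:
  assumes m: "ucomputable C m" and x: "ucomputable C x" and z: "ucomputable C z"
  shows "usemidec C (\<lambda>i n. scale_graph i (m i n) (x i n) (z i n))"
proof -
  have iff: "scale_graph i m x z \<longleftrightarrow> x \<in> KC i \<and>
    (\<exists>w. w 0 = \<zero>\<^bsub>K i\<^esub> \<and> (\<forall>j<m. add_graph i (w j) x (w (Suc j))) \<and> w m = z)" for i m x z
  proof (cases "x \<in> KC i")
    case True
    interpret ring "K i" by (rule ring_K)
    show ?thesis
      using True by (subst ex_sequence_iff[where W = "\<lambda>j. add_pow (K i) j x"])
        (auto simp: scale_graph_def add_graph_def)
  qed (simp add: scale_graph_def)
  show ?thesis unfolding iff
    by (intro usemidec_conj usemidec_K usemidec_iterate usemidec_add_graph assms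
        ucomputable_subst[OF x] ucomputable_intros represented_constants)
qed

lemma usemidec_int_scale_graph:
  assumes c: "ucomputable C c" and x: "ucomputable C x" and z: "ucomputable C z"
  shows "usemidec C (\<lambda>i n. int_scale_graph i (c i n) (x i n) (z i n))"
proof -
  \<comment> \<open>The code \<open>m + m\<close> stands for the integer \<open>m\<close>, and
    \<open>Suc (m + m)\<close> for \<open>- int (Suc m)\<close>. Negation is not among the
    operations of the presentation, so a negative multiple is found as the solution \<open>z\<close>
    of an equation \<open>v \<oplus> z = \<zero>\<close>.\<close>
  have iff: "int_scale_graph i c x z \<longleftrightarrow> (\<exists>m. c = m + m \<and> scale_graph i m x z) \<or>
    (\<exists>m. c = Suc (m + m) \<and> (\<exists>v. scale_graph i (Suc m) x v \<and> add_graph i v z \<zero>\<^bsub>K i\<^esub>))" for i c x z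
  proof (cases "x \<in> KC i")
    case True
    interpret ring "K i" by (rule ring_K)
    show ?thesis
    proof (cases "even c")
      case even: True
      then obtain m where m: "c = m + m" by (metis evenE mult_2)
      then have "int_decode c = int m" by (simp add: int_decode_def sum_decode_def)
      then have "int_scale_graph i c x z \<longleftrightarrow> scale_graph i m x z"
        by (simp add: int_scale_graph_def scale_graph_def add_pow_int_ge)
      moreover have "m' = m" if "m + m = m' + m'" for m' using that by arith
      moreover have "m + m \<noteq> Suc (m' + m')" for m' by arith
      ultimately show ?thesis unfolding m by blast
    next
      case odd: False
      then obtain m where m: "c = Suc (m + m)" by (metis oddE mult_2 Suc_eq_plus1)
      then have dec: "int_decode c = - int (Suc m)" by (simp add: int_decode_def sum_decode_def)
      let ?v = "add_pow (K i) (Suc m) x"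
      have v: "?v \<in> KC i" using True by (rule add.nat_pow_closed)
      have "add_pow (K i) (int_decode c) x = \<ominus>\<^bsub>K i\<^esub> ?v"
      proof -
        have "nat (- (- int (Suc m))) = Suc m" "- int (Suc m) < 0" by simp_all
        then show ?thesis unfolding dec using add_pow_int_lt[of "- int (Suc m)" "K i" x] by metis
      qed
      moreover have "z = \<ominus>\<^bsub>K i\<^esub> ?v \<longleftrightarrow> z \<in> KC i \<and> \<zero>\<^bsub>K i\<^esub> = ?v \<oplus>\<^bsub>K i\<^esub> z"
      proof
        assume "z = \<ominus>\<^bsub>K i\<^esub> ?v"
        then show "z \<in> KC i \<and> \<zero>\<^bsub>K i\<^esub> = ?v \<oplus>\<^bsub>K i\<^esub> z" using a_inv_closed[OF v] r_neg[OF v] by metis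
      next
        assume z: "z \<in> KC i \<and> \<zero>\<^bsub>K i\<^esub> = ?v \<oplus>\<^bsub>K i\<^esub> z"
        then have "z \<oplus>\<^bsub>K i\<^esub> ?v = \<zero>\<^bsub>K i\<^esub>" using a_comm[OF v, of z] by metis
        then show "z = \<ominus>\<^bsub>K i\<^esub> ?v" using minus_equality[of z ?v] v z by metis
      qed
      ultimately have "int_scale_graph i c x z \<longleftrightarrow> (\<exists>v. scale_graph i (Suc m) x v \<and> add_graph i v z \<zero>\<^bsub>K i\<^esub>)"
        unfolding int_scale_graph_def scale_graph_def add_graph_def using True v by metis
      moreover have "m' = m" if "Suc (m + m) = Suc (m' + m')" for m' using that by arith
      moreover have "Suc (m + m) \<noteq> m' + m'" for m' by arith
      ultimately show ?thesis unfolding m by blast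
    qed
  qed (simp add: int_scale_graph_def scale_graph_def)
  show ?thesis unfolding iff
    by (intro usemidec_logic usemidec_scale_graph usemidec_add_graph
        ucomputable_subst[OF x] ucomputable_subst[OF c] ucomputable_subst[OF z] ucomputable_intros represented_constants)
qed

lemma usemidec_tuples: "ucomputable C a \<Longrightarrow> usemidec C (\<lambda>i n. a i n \<in> TC i)"
  using usemidec_semidec2[OF semidec_tuples[OF semidec_carrier_K] ucomputable_index] .

lemma usemidec_monom_graph:
  assumes e: "ucomputable C e" and a: "ucomputable C a" and z: "ucomputable C z"
  shows "usemidec C (\<lambda>i n. monom_graph i (e i n) (a i n) (z i n))"
proof -
  \<comment> \<open>The minimum of the two lengths, written with truncated subtraction:
    \<open>zip\<close> stops at the end of the shorter list.\<close>
  let ?L = "\<lambda>e a. code_length a - (code_length a - code_length e)"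
  have iff: "monom_graph i e a z \<longleftrightarrow> a \<in> TC i \<and>
    (\<exists>w. w 0 = \<one>\<^bsub>K i\<^esub> \<and> (\<forall>j<?L e a. \<exists>p. pow_graph i (code_nth a (?L e a - Suc j)) (code_nth e (?L e a - Suc j)) p
        \<and> mult_graph i p (w j) (w (Suc j))) \<and> w (?L e a) = z)" for i e a z
  proof (cases "a \<in> TC i")
    case True
    interpret ring "K i" by (rule ring_K)
    let ?xs = "list_decode a" and ?es = "list_decode e"
    let ?zs = "zip ?xs ?es" and ?f = "\<lambda>(x, k) m. (x [^]\<^bsub>K i\<^esub> k) \<otimes>\<^bsub>K i\<^esub> m"
    have L: "?L e a = length ?zs" by (simp add: code_length_def)
    have xs: "set ?xs \<subseteq> KC i" using True by (simp add: tuples_iff)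
    have cl: "foldr ?f (drop k ?zs) \<one>\<^bsub>K i\<^esub> \<in> KC i" for k
      using monom_eval_closed[OF ring_axioms, of "drop k ?xs" "drop k ?es"] xs
      by (auto simp: monom_eval_def drop_zip dest: in_set_dropD)
    have "(\<exists>w. w 0 = \<one>\<^bsub>K i\<^esub> \<and> (\<forall>j<?L e a. \<exists>p. pow_graph i (code_nth a (?L e a - Suc j)) (code_nth e (?L e a - Suc j)) p
        \<and> mult_graph i p (w j) (w (Suc j))) \<and> w (?L e a) = z)
      \<longleftrightarrow> z = foldr ?f (drop (length ?zs - ?L e a) ?zs) \<one>\<^bsub>K i\<^esub>"
    proof (rule ex_sequence_iff[where W = "\<lambda>j. foldr ?f (drop (length ?zs - j) ?zs) \<one>\<^bsub>K i\<^esub>"])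
      fix j v assume "j < ?L e a"
      then have j: "j < length ?zs" unfolding L .
      let ?k = "length ?zs - Suc j"
      have k: "?k < code_length a" "?k < code_length e" using j by (auto simp: code_length_def)
      have mem: "?xs ! ?k \<in> KC i" using xs k by (auto simp: code_length_def)
      have "?zs ! ?k = (?xs ! ?k, ?es ! ?k)" using j by (intro nth_zip) auto
      then show "(\<exists>p. pow_graph i (code_nth a (?L e a - Suc j)) (code_nth e (?L e a - Suc j)) p
          \<and> mult_graph i p (foldr ?f (drop (length ?zs - j) ?zs) \<one>\<^bsub>K i\<^esub>) v)
        \<longleftrightarrow> v = foldr ?f (drop (length ?zs - Suc j) ?zs) \<one>\<^bsub>K i\<^esub>"
        unfolding L foldr_drop_step[OF j] code_nth_eq[OF k(1)] code_nth_eq[OF k(2)]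
        using cl mem by (auto simp: pow_graph_def mult_graph_def)
    qed simp
    then show ?thesis using True L by (simp add: monom_graph_def monom_eval_def)
  qed (simp add: monom_graph_def)
  show ?thesis unfolding iff
    by (intro usemidec_conj usemidec_tuples usemidec_logic usemidec_mult_graph usemidec_pow_graph assms
        ucomputable_subst[OF a] ucomputable_subst[OF e] ucomputable_intros represented_constants)
qed

lemma usemidec_poly_graph:
  assumes p: "ucomputable C p" and a: "ucomputable C a" and z: "ucomputable C z"
  shows "usemidec C (\<lambda>i n. poly_graph i (p i n) (a i n) (z i n))"
proof -
  let ?t = "\<lambda>p j. code_nth p (code_length p - Suc j)"
  have iff: "poly_graph i p a z \<longleftrightarrow> a \<in> TC i \<and>
    (\<exists>w. w 0 = \<zero>\<^bsub>K i\<^esub> \<and> (\<forall>j<code_length p. \<exists>m v. monom_graph i (csnd (?t p j)) a m \<and>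
        int_scale_graph i (cfst (?t p j)) m v \<and> add_graph i v (w j) (w (Suc j))) \<and> w (code_length p) = z)" for i p a z
  proof (cases "a \<in> TC i")
    case True
    interpret ring "K i" by (rule ring_K)
    let ?xs = "list_decode a" and ?zs = "list_decode p"
    let ?f = "\<lambda>t s. add_pow (K i) (int_decode (cfst t))
      (monom_eval (K i) (list_decode (csnd t)) ?xs) \<oplus>\<^bsub>K i\<^esub> s"
    have xs: "set ?xs \<subseteq> KC i" using True by (simp add: tuples_iff)
    have cl: "foldr ?f zs \<zero>\<^bsub>K i\<^esub> \<in> KC i" for zs
      by (induction zs) (auto simp: monom_eval_closed[OF ring_axioms xs])
    have "(\<exists>w. w 0 = \<zero>\<^bsub>K i\<^esub> \<and> (\<forall>j<code_length p. \<exists>m v. monom_graph i (csnd (?t p j)) a m \<and>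
        int_scale_graph i (cfst (?t p j)) m v \<and> add_graph i v (w j) (w (Suc j))) \<and> w (code_length p) = z)
      \<longleftrightarrow> z = foldr ?f (drop (length ?zs - code_length p) ?zs) \<zero>\<^bsub>K i\<^esub>"
    proof (rule ex_sequence_iff[where W = "\<lambda>j. foldr ?f (drop (length ?zs - j) ?zs) \<zero>\<^bsub>K i\<^esub>"])
      fix j v assume j: "j < code_length p"
      then have j': "j < length ?zs" by (simp add: code_length_def)
      have k: "length ?zs - Suc j < code_length p" using j by (simp add: code_length_def)
      show "(\<exists>m v'. monom_graph i (csnd (?t p j)) a m \<and>
        int_scale_graph i (cfst (?t p j)) m v' \<and>
          add_graph i v' (foldr ?f (drop (length ?zs - j) ?zs) \<zero>\<^bsub>K i\<^esub>) v)
        \<longleftrightarrow> v = foldr ?f (drop (length ?zs - Suc j) ?zs) \<zero>\<^bsub>K i\<^esub>"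
        unfolding foldr_drop_step[OF j'] code_length_def[of p] code_nth_eq[OF k]
        using cl True monom_eval_closed[OF ring_axioms xs]
        by (auto simp: monom_graph_def int_scale_graph_def add_graph_def)
    qed simp
    moreover have "poly_eval (K i) p ?xs = foldr ?f ?zs \<zero>\<^bsub>K i\<^esub>"
      by (simp add: poly_eval_def poly_terms_def foldr_map comp_def case_prod_beta)
    ultimately show ?thesis using True by (simp add: poly_graph_def code_length_def)
  qed (simp add: poly_graph_def)
  show ?thesis unfolding iff
    by (intro usemidec_conj usemidec_tuples usemidec_logic usemidec_monom_graph
        usemidec_int_scale_graph usemidec_add_graph assms
        ucomputable_subst[OF a] ucomputable_subst[OF p] ucomputable_intros represented_constants)
qed

lemma celem_poly_eval:
  assumes p: "represented C p" and a: "celem C (\<lambda>i. TC i) a"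
  shows "celem C (\<lambda>i. KC i) (\<lambda>i. poly_eval (K i) (p i) (list_decode (a i)))"
proof (rule celem_K)
  note mem = celem_mem[OF a]
  show "represented C (\<lambda>i. poly_eval (K i) (p i) (list_decode (a i)))"
  proof (rule represented_unique)
    show "usemidec C (\<lambda>i z. poly_graph i (p i) (a i) z)"
      by (intro usemidec_poly_graph ucomputable_intros p celem_represented[OF a])
    show "\<forall>\<^sub>F i in cofin C. \<forall>z. poly_graph i (p i) (a i) z \<longleftrightarrow> z = poly_eval (K i) (p i) (list_decode (a i))"
      using mem by eventually_elim (simp add: poly_graph_def)
  qed
  show "\<forall>\<^sub>F i in cofin C. poly_eval (K i) (p i) (list_decode (a i)) \<in> KC i"
    using mem by eventually_elim (simp add: tuples_iff poly_eval_closed ring_K)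
qed

end

section \<open>The action of the cohesive product of the Galois groups\<close>

lemma code_map_append: "code_map f (code_append a b) = code_append (code_map f a) (code_map f b)"
  by (simp add: code_map_def code_append_def)

lemma code_length_map [simp]: "code_length (code_map f a) = code_length a"
  by (simp add: code_map_def code_length_def)

lemma code_map_in_tuples: "a \<in> tuples A \<Longrightarrow> (\<And>x. x \<in> A \<Longrightarrow> f x \<in> B) \<Longrightarrow> code_map f a \<in> tuples B"
  by (auto simp: tuples_iff code_map_def)

lemma code_map_cong: "a \<in> tuples A \<Longrightarrow> (\<And>x. x \<in> A \<Longrightarrow> f x = g x) \<Longrightarrow> code_map f a = code_map g a"
  unfolding code_map_def by (intro arg_cong[of _ _ list_encode] map_cong) (auto simp: tuples_iff)

lemma code_map_ident: "a \<in> tuples A \<Longrightarrow> (\<And>x. x \<in> A \<Longrightarrow> f x = x) \<Longrightarrow> code_map f a = a"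
  using code_map_cong[of a A f "\<lambda>x. x"] by (simp add: code_map_def)

lemma code_map_code_map: "code_map f (code_map g a) = code_map (\<lambda>x. f (g x)) a"
  by (simp add: code_map_def comp_def)

lemma code_append_in_tuples: "a \<in> tuples A \<Longrightarrow> b \<in> tuples A \<Longrightarrow> code_append a b \<in> tuples A"
  by (auto simp: tuples_iff code_append_def)

lemma semidec_UNIV: "semidec (\<lambda>m. csnd m \<in> UNIV)"
  using semidec_eq[OF computable_id computable_id] by simp

context uniform_Galois
begin

abbreviation "tact i g \<equiv> code_map (act i g)"

lemma tact_closed: "g \<in> GC i \<Longrightarrow> a \<in> TC i \<Longrightarrow> tact i g a \<in> TC i"
  by (rule code_map_in_tuples) (auto intro: act_closed)

lemma tact_mult:
  assumes "g \<in> GC i" "h \<in> GC i" "a \<in> TC i"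
  shows "tact i (g \<otimes>\<^bsub>G i\<^esub> h) a = tact i g (tact i h a)"
  unfolding code_map_code_map by (rule code_map_cong[OF assms(3)]) (rule act_mult[OF assms(1,2)])

lemma tact_one: "a \<in> TC i \<Longrightarrow> tact i \<one>\<^bsub>G i\<^esub> a = a"
  by (rule code_map_ident) (auto intro: act_one)

lemma tact_inv:
  assumes "g \<in> GC i" "a \<in> TC i"
  shows "tact i (inv\<^bsub>G i\<^esub> g) (tact i g a) = a"
proof -
  interpret G: group "G i" by (rule group_G)
  show ?thesis using tact_mult[of "inv\<^bsub>G i\<^esub> g" i g a] assms by (simp add: tact_one)
qed

lemma celem_tact:
  assumes g: "celem C GC g" and a: "celem C TC a"
  shows "celem C TC (\<lambda>i. tact i (g i) (a i))"
proof (rule celem_tuple)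
  note mem = celem_mem[OF g] celem_mem[OF a]
  show "represented C (\<lambda>i. tact i (g i) (a i))"
  proof (rule represented_code_map[OF celem_represented[OF a]])
    show "usemidec C (\<lambda>i m. act_graph i (g i) (cfst m) (csnd m))"
      by (intro usemidec_act_graph ucomputable_intros celem_represented[OF g])
    show "\<forall>\<^sub>F i in cofin C. \<forall>x\<in>set (list_decode (a i)). \<forall>y. act_graph i (g i) x y \<longleftrightarrow> y = act i (g i) x"
      using mem by eventually_elim (auto simp: act_graph_def tuples_iff)
  qed
  show "\<forall>\<^sub>F i in cofin C. tact i (g i) (a i) \<in> TC i"
    using mem by eventually_elim (rule tact_closed)
qed

section \<open>The group structure of the cohesive product\<close>

lemma celem_G_one: "celem C GC (\<lambda>i. \<one>\<^bsub>G i\<^esub>)"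
  by (rule celem_G[OF represented_constants(3)]) (simp add: group.is_monoid[OF group_G] monoid.one_closed)

lemma celem_G_mult:
  assumes g: "celem C GC g" and h: "celem C GC h"
  shows "celem C GC (\<lambda>i. g i \<otimes>\<^bsub>G i\<^esub> h i)"
proof (rule celem_G)
  note mem = celem_mem[OF g] celem_mem[OF h]
  show "represented C (\<lambda>i. g i \<otimes>\<^bsub>G i\<^esub> h i)"
  proof (rule represented_unique)
    show "usemidec C (\<lambda>i y. mult_graph_G i (g i) (h i) y)"
      by (intro usemidec_mult_graph_G ucomputable_intros celem_represented[OF g] celem_represented[OF h])
    show "\<forall>\<^sub>F i in cofin C. \<forall>y. mult_graph_G i (g i) (h i) y \<longleftrightarrow> y = g i \<otimes>\<^bsub>G i\<^esub> h i"
      using mem by eventually_elim (auto simp: mult_graph_G_def)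
  qed
  show "\<forall>\<^sub>F i in cofin C. g i \<otimes>\<^bsub>G i\<^esub> h i \<in> GC i"
    using mem by eventually_elim (rule monoid.m_closed[OF group.is_monoid[OF group_G]])
qed

text \<open>Inverses are not part of the presentation of \<open>G i\<close>; they are found by
  searching for a left inverse, which is unique.\<close>

lemma celem_G_inv:
  assumes g: "celem C GC g"
  shows "celem C GC (\<lambda>i. inv\<^bsub>G i\<^esub> g i)"
proof (rule celem_G)
  note mem = celem_mem[OF g]
  show "represented C (\<lambda>i. inv\<^bsub>G i\<^esub> g i)"
  proof (rule represented_unique)
    show "usemidec C (\<lambda>i y. mult_graph_G i y (g i) \<one>\<^bsub>G i\<^esub>)"
      by (intro usemidec_mult_graph_G ucomputable_intros celem_represented[OF g] represented_constants)
    show "\<forall>\<^sub>F i in cofin C. \<forall>y. mult_graph_G i y (g i) \<one>\<^bsub>G i\<^esub> \<longleftrightarrow> y = inv\<^bsub>G i\<^esub> g i"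
      using mem
    proof eventually_elim
      case (elim i)
      interpret G: group "G i" by (rule group_G)
      have "y = inv\<^bsub>G i\<^esub> g i" if "y \<in> GC i" "\<one>\<^bsub>G i\<^esub> = y \<otimes>\<^bsub>G i\<^esub> g i" for y
        using G.inv_equality[OF that(2)[symmetric] elim that(1)] by simp
      with elim show ?case by (auto simp: mult_graph_G_def)
    qed
  qed
  show "\<forall>\<^sub>F i in cofin C. inv\<^bsub>G i\<^esub> g i \<in> GC i"
    using mem by eventually_elim (rule group.inv_closed[OF group_G])
qed

lemma carrier_cprod_group: "carrier (cprod_group C G) = cprod C GC"
  and one_cprod_group: "\<one>\<^bsub>cprod_group C G\<^esub> = cl C GC (\<lambda>i. \<one>\<^bsub>G i\<^esub>)"
  by (simp_all add: cprod_group_def cl_def)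

lemma mult_cprod_group:
  "celem C GC g \<Longrightarrow> celem C GC h \<Longrightarrow>
    cl C GC g \<otimes>\<^bsub>cprod_group C G\<^esub> cl C GC h = cl C GC (\<lambda>i. g i \<otimes>\<^bsub>G i\<^esub> h i)"
  by (simp add: cprod_group_def cmap2_cl)

lemma group_cprod_group: "group (cprod_group C G)"
proof (rule groupI; (unfold carrier_cprod_group)?)
  fix U V assume "U \<in> cprod C GC" "V \<in> cprod C GC"
  then show "U \<otimes>\<^bsub>cprod_group C G\<^esub> V \<in> cprod C GC"
    by (elim cprodE) (simp add: mult_cprod_group cl_in_cprod celem_G_mult)
  fix W assume "W \<in> cprod C GC"
  with \<open>U \<in> cprod C GC\<close> \<open>V \<in> cprod C GC\<close> obtain u v w where uvw: "celem C GC u" "celem C GC v" "celem C GC w"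
    "U = cl C GC u" "V = cl C GC v" "W = cl C GC w" by (elim cprodE) blast
  have "\<forall>\<^sub>F i in cofin C. u i \<otimes>\<^bsub>G i\<^esub> v i \<otimes>\<^bsub>G i\<^esub> w i = u i \<otimes>\<^bsub>G i\<^esub> (v i \<otimes>\<^bsub>G i\<^esub> w i)"
    using uvw(1-3)[THEN celem_mem] by eventually_elim (rule monoid.m_assoc[OF group.is_monoid[OF group_G]])
  then show "U \<otimes>\<^bsub>cprod_group C G\<^esub> V \<otimes>\<^bsub>cprod_group C G\<^esub> W =
      U \<otimes>\<^bsub>cprod_group C G\<^esub> (V \<otimes>\<^bsub>cprod_group C G\<^esub> W)"
    using uvw by (simp add: mult_cprod_group celem_G_mult) (rule cl_cong)
next
  show "\<one>\<^bsub>cprod_group C G\<^esub> \<in> cprod C GC"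
    by (simp add: one_cprod_group cl_in_cprod celem_G_one)
next
  fix U assume "U \<in> cprod C GC"
  then obtain u where u: "celem C GC u" "U = cl C GC u" by (rule cprodE)
  have "\<forall>\<^sub>F i in cofin C. \<one>\<^bsub>G i\<^esub> \<otimes>\<^bsub>G i\<^esub> u i = u i"
    using u(1)[THEN celem_mem] by eventually_elim (rule monoid.l_one[OF group.is_monoid[OF group_G]])
  then show "\<one>\<^bsub>cprod_group C G\<^esub> \<otimes>\<^bsub>cprod_group C G\<^esub> U = U"
    by (simp add: u one_cprod_group mult_cprod_group celem_G_one) (rule cl_cong)
  have "\<forall>\<^sub>F i in cofin C. (inv\<^bsub>G i\<^esub> u i) \<otimes>\<^bsub>G i\<^esub> u i = \<one>\<^bsub>G i\<^esub>"
    using u(1)[THEN celem_mem] by eventually_elim (rule group.l_inv[OF group_G])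
  then have "cl C GC (\<lambda>i. inv\<^bsub>G i\<^esub> u i) \<otimes>\<^bsub>cprod_group C G\<^esub> U = \<one>\<^bsub>cprod_group C G\<^esub>"
    by (simp add: u one_cprod_group mult_cprod_group celem_G_inv) (rule cl_cong)
  then show "\<exists>V\<in>cprod C GC. V \<otimes>\<^bsub>cprod_group C G\<^esub> U = \<one>\<^bsub>cprod_group C G\<^esub>"
    using cl_in_cprod[OF celem_G_inv[OF u(1)]] by blast
qed

section \<open>The action of the product group on the tree\<close>

definition Theta :: "(nat \<rightharpoonup> nat) set \<Rightarrow> (nat \<rightharpoonup> nat) set \<Rightarrow> (nat \<rightharpoonup> nat) set"
  where "Theta U = (\<lambda>V\<in>cprod_tree C KC. cmap2 C TC (\<lambda>i. tact i) U V)"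

lemma cl_in_cprod_tree: "celem C TC a \<Longrightarrow> cl C TC a \<in> cprod_tree C KC"
  unfolding cprod_tree_def by (rule cl_in_cprod)

lemma cprod_treeE:
  assumes "V \<in> cprod_tree C KC" obtains a where "celem C TC a" "V = cl C TC a"
  using assms unfolding cprod_tree_def by (rule cprodE)

lemma Theta_cl:
  "celem C GC g \<Longrightarrow> celem C TC a \<Longrightarrow> Theta (cl C GC g) (cl C TC a) = cl C TC (\<lambda>i. tact i (g i) (a i))"
  by (simp add: Theta_def cl_in_cprod_tree cmap2_cl)

lemma Theta_closed:
  "U \<in> cprod C GC \<Longrightarrow> V \<in> cprod_tree C KC \<Longrightarrow> Theta U V \<in> cprod_tree C KC"
  by (elim cprodE cprod_treeE) (simp add: Theta_cl cl_in_cprod_tree celem_tact)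

lemma Theta_mult:
  assumes "U \<in> cprod C GC" "U' \<in> cprod C GC" "V \<in> cprod_tree C KC"
  shows "Theta (U \<otimes>\<^bsub>cprod_group C G\<^esub> U') V = Theta U (Theta U' V)"
proof -
  from assms obtain g h a where *: "celem C GC g" "celem C GC h" "celem C TC a"
    "U = cl C GC g" "U' = cl C GC h" "V = cl C TC a" by (elim cprodE cprod_treeE) blast
  have "\<forall>\<^sub>F i in cofin C. tact i (g i \<otimes>\<^bsub>G i\<^esub> h i) (a i) = tact i (g i) (tact i (h i) (a i))"
    using *(1-3)[THEN celem_mem] by eventually_elim (rule tact_mult)
  then show ?thesis
    using * by (simp add: mult_cprod_group Theta_cl celem_G_mult celem_tact) (rule cl_cong)
qed

lemma Theta_one: "V \<in> cprod_tree C KC \<Longrightarrow> Theta \<one>\<^bsub>cprod_group C G\<^esub> V = V"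
proof -
  assume "V \<in> cprod_tree C KC"
  then obtain a where a: "celem C TC a" "V = cl C TC a" by (rule cprod_treeE)
  have "\<forall>\<^sub>F i in cofin C. tact i \<one>\<^bsub>G i\<^esub> (a i) = a i"
    using a(1)[THEN celem_mem] by eventually_elim (rule tact_one)
  then show ?thesis using a by (simp add: one_cprod_group Theta_cl celem_G_one) (rule cl_cong)
qed

lemma Theta_Bij:
  assumes U: "U \<in> cprod C GC"
  shows "Theta U \<in> Bij (cprod_tree C KC)"
proof -
  interpret P: group "cprod_group C G" by (rule group_cprod_group)
  have U': "inv\<^bsub>cprod_group C G\<^esub> U \<in> cprod C GC" using P.inv_closed U by (simp add: carrier_cprod_group)
  have "bij_betw (Theta U) (cprod_tree C KC) (cprod_tree C KC)"
    by (rule bij_betw_byWitness[where f' = "Theta (inv\<^bsub>cprod_group C G\<^esub> U)"])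
      (use U U' in \<open>auto simp: Theta_closed Theta_one carrier_cprod_group simp flip: Theta_mult\<close>)
  then show ?thesis by (simp add: Bij_def Theta_def)
qed

section \<open>Tree operations and polynomials on representatives\<close>

lemma tree_le_cl:
  "celem C TC a \<Longrightarrow> celem C TC b \<Longrightarrow> tree_le C (cl C TC a) (cl C TC b) \<longleftrightarrow>
    (\<forall>\<^sub>F i in cofin C. prefix (list_decode (a i)) (list_decode (b i)))"
  unfolding tree_le_def by (rule crel2_cl)

lemma tree_append_cl:
  "celem C TC a \<Longrightarrow> celem C TC b \<Longrightarrow>
    tree_append C KC (cl C TC a) (cl C TC b) = cl C TC (\<lambda>i. code_append (a i) (b i))"
  unfolding tree_append_def code_append_def by (rule cmap2_cl)

lemma celem_append:
  assumes a: "celem C TC a" and b: "celem C TC b"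
  shows "celem C TC (\<lambda>i. code_append (a i) (b i))"
proof (rule celem_tuple)
  show "\<forall>\<^sub>F i in cofin C. code_append (a i) (b i) \<in> TC i"
    using celem_mem[OF a] celem_mem[OF b] by eventually_elim (rule code_append_in_tuples)
qed (intro represented_code_append celem_represented[OF a] celem_represented[OF b])

lemma arity_cl: "celem C TC a \<Longrightarrow> arity C (cl C TC a) = cl C (\<lambda>i. UNIV) (\<lambda>i. code_length (a i))"
  unfolding arity_def code_length_def by (rule cmap1_cl)

lemma celem_nat: "represented C a \<Longrightarrow> celem C (\<lambda>i. UNIV) a"
  by (rule celemI[OF semidec_UNIV]) auto

lemma represented_code_length: "represented C a \<Longrightarrow> represented C (\<lambda>i. code_length (a i))"
  using represented_ucomputable[OF ucomputable_code_length[OF ucomputable_represented]] by simp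

lemma singleton_tuple_cl:
  "celem C KC x \<Longrightarrow> singleton_tuple C KC (cl C KC x) = cl C TC (\<lambda>i. list_encode [x i])"
  unfolding singleton_tuple_def by (rule cmap1_cl)

lemma celem_singleton:
  assumes x: "celem C KC x" shows "celem C TC (\<lambda>i. list_encode [x i])"
proof (rule celem_tuple)
  show "\<forall>\<^sub>F i in cofin C. list_encode [x i] \<in> TC i"
    using celem_mem[OF x] by eventually_elim (simp del: list_encode.simps)
qed (rule represented_singleton[OF celem_represented[OF x]])

lemma hyperpoly_eval_cl:
  "celem C (\<lambda>i. int_polys) p \<Longrightarrow> celem C TC a \<Longrightarrow>
    hyperpoly_eval C K (cl C (\<lambda>i. int_polys) p) (cl C TC a)
      = cl C KC (\<lambda>i. poly_eval (K i) (p i) (list_decode (a i)))"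
  unfolding hyperpoly_eval_def by (rule cmap2_cl)

lemma celem_map_Psi:
  assumes c: "celem C (\<lambda>i. tuples (carrier F)) c"
  shows "celem C TC (\<lambda>i. code_map (\<Psi> i) (c i))"
proof (rule celem_tuple)
  note mem = celem_mem[OF c]
  show "represented C (\<lambda>i. code_map (\<Psi> i) (c i))"
  proof (rule represented_code_map[OF celem_represented[OF c]])
    show "usemidec C (\<lambda>i m. Psi_graph i (cfst m) (csnd m))"
      by (intro usemidec_Psi_graph ucomputable_intros)
    show "\<forall>\<^sub>F i in cofin C. \<forall>x\<in>set (list_decode (c i)). \<forall>y. Psi_graph i x y \<longleftrightarrow> y = \<Psi> i x"
      using mem by eventually_elim (auto simp: Psi_graph_def tuples_iff)
  qed
  show "\<forall>\<^sub>F i in cofin C. code_map (\<Psi> i) (c i) \<in> TC i"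
    using mem by eventually_elim (auto intro!: code_map_in_tuples ring_hom_closed[OF Psi_hom])
qed

lemma tree_emb_cl:
  "celem C (\<lambda>i. tuples (carrier F)) c \<Longrightarrow>
    tree_emb C K \<Psi> (cl C (\<lambda>i. tuples (carrier F)) c) = cl C TC (\<lambda>i. code_map (\<Psi> i) (c i))"
  unfolding tree_emb_def code_map_def by (rule cmap1_cl)

lemma Theta_HAut_tree:
  assumes U: "U \<in> cprod C GC"
  shows "Theta U \<in> HAut_tree C KC"
proof -
  obtain g where g: "celem C GC g" "U = cl C GC g" using U by (rule cprodE)
  have "tree_le C (Theta U A) (Theta U B) \<longleftrightarrow> tree_le C A B"
    if "A \<in> cprod_tree C KC" "B \<in> cprod_tree C KC" for A B
  proof -
    from that obtain a b where ab: "celem C TC a" "celem C TC b" "A = cl C TC a" "B = cl C TC b"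
      by (elim cprod_treeE) blast
    have mono: "prefix (list_decode (code_map f a)) (list_decode (code_map f b))"
      if "prefix (list_decode a) (list_decode b)" for f a b
      using that by (simp add: code_map_def map_mono_prefix)
    have "\<forall>\<^sub>F i in cofin C. prefix (list_decode (tact i (g i) (a i))) (list_decode (tact i (g i) (b i)))
        \<longleftrightarrow> prefix (list_decode (a i)) (list_decode (b i))"
      using g(1)[THEN celem_mem] ab(1,2)[THEN celem_mem]
    proof eventually_elim
      case (elim i)
      \<comment> \<open>The instance of \<open>mono\<close> at the inverse group element removes the
        action again and gives the implication from the images back to \<open>a i\<close> and
        \<open>b i\<close>.\<close>
      show ?case
        using mono[of "tact i (g i) (a i)" "tact i (g i) (b i)" "act i (inv\<^bsub>G i\<^esub> g i)"] mono[of "a i" "b i"]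
        by (auto simp: tact_inv elim)
    qed
    from eventually_subst[OF this] show ?thesis
      using g ab by (simp add: Theta_cl tree_le_cl celem_tact)
  qed
  moreover have "Theta U (tree_append C KC A B) = tree_append C KC (Theta U A) (Theta U B)"
    if "A \<in> cprod_tree C KC" "B \<in> cprod_tree C KC" for A B
    using that g by (elim cprod_treeE) (simp add: Theta_cl tree_append_cl celem_tact celem_append code_map_append)
  moreover have "arity C (Theta U A) = arity C A" if "A \<in> cprod_tree C KC" for A
    using that g by (elim cprod_treeE) (simp add: Theta_cl arity_cl celem_tact)
  ultimately show ?thesis
    using Theta_Bij[OF U] unfolding HAut_tree_def by blast
qed

lemma Theta_HAut:
  assumes U: "U \<in> cprod C GC"
  shows "Theta U \<in> carrier (HAut_group C K F \<Psi>)"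
proof -
  obtain g where g: "celem C GC g" "U = cl C GC g" using U by (rule cprodE)
  have "singleton_tuple C KC (hyperpoly_eval C K P (Theta U A)) =
      Theta U (singleton_tuple C KC (hyperpoly_eval C K P A))"
    if "P \<in> hyperpolys C" "A \<in> cprod_tree C KC" for P A
  proof -
    from that obtain p a where *: "celem C (\<lambda>i. int_polys) p" "celem C TC a"
      "P = cl C (\<lambda>i. int_polys) p" "A = cl C TC a"
      unfolding hyperpolys_def by (elim cprod_treeE cprodE) blast
    note ev = celem_poly_eval[OF celem_represented[OF *(1)]]
    have "\<forall>\<^sub>F i in cofin C. list_encode [poly_eval (K i) (p i) (list_decode (tact i (g i) (a i)))] =
      tact i (g i) (list_encode [poly_eval (K i) (p i) (list_decode (a i))])"
      using g(1)[THEN celem_mem] *(2)[THEN celem_mem]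
    proof eventually_elim
      case (elim i)
      then show ?case
        using hom_poly_eval[OF ring_K act_hom, of "g i" i "list_decode (a i)" "p i"]
        by (simp add: code_map_def tuples_iff del: list_encode.simps)
    qed
    from cl_cong[OF this] show ?thesis
      using * g by (simp add: Theta_cl hyperpoly_eval_cl singleton_tuple_cl celem_singleton ev celem_tact
          del: list_encode.simps)
  qed
  moreover have "Theta U (tree_emb C K \<Psi> A) = tree_emb C K \<Psi> A" if "A \<in> cprod_tree C (\<lambda>i. carrier F)" for A
  proof -
    from that obtain c where c: "celem C (\<lambda>i. tuples (carrier F)) c" "A = cl C (\<lambda>i. tuples (carrier F)) c"
      unfolding cprod_tree_def by (rule cprodE)
    have "\<forall>\<^sub>F i in cofin C. tact i (g i) (code_map (\<Psi> i) (c i)) = code_map (\<Psi> i) (c i)"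
      using g(1)[THEN celem_mem] c(1)[THEN celem_mem]
      by eventually_elim (auto simp: code_map_code_map act_Psi intro: code_map_cong)
    from cl_cong[OF this] show ?thesis
      using g c by (simp add: tree_emb_cl Theta_cl celem_map_Psi)
  qed
  ultimately show ?thesis
    using Theta_HAut_tree[OF U] by (simp add: HAut_group_def HAut_fields_def)
qed

lemma Theta_hom: "Theta \<in> hom (cprod_group C G) (HAut_group C K F \<Psi>)"
proof (rule homI; (unfold carrier_cprod_group)?)
  interpret P: group "cprod_group C G" by (rule group_cprod_group)
  fix U V assume U: "U \<in> cprod C GC" and V: "V \<in> cprod C GC"
  then have UV: "U \<otimes>\<^bsub>cprod_group C G\<^esub> V \<in> cprod C GC"
    using P.m_closed by (simp add: carrier_cprod_group)
  have "Theta (U \<otimes>\<^bsub>cprod_group C G\<^esub> V) = compose (cprod_tree C KC) (Theta U) (Theta V)"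
  proof (rule extensionalityI[of _ "cprod_tree C KC"])
    show "Theta (U \<otimes>\<^bsub>cprod_group C G\<^esub> V) A = compose (cprod_tree C KC) (Theta U) (Theta V) A"
      if "A \<in> cprod_tree C KC" for A
      using Theta_mult[OF U V that] that by (simp add: compose_def)
  qed (simp_all add: Theta_def)
  then show "Theta (U \<otimes>\<^bsub>cprod_group C G\<^esub> V) = Theta U \<otimes>\<^bsub>HAut_group C K F \<Psi>\<^esub> Theta V"
    using Theta_Bij U V by (simp add: HAut_group_def BijGroup_def)
qed (rule Theta_HAut)

lemma Theta_inj: "inj_on Theta (cprod C GC)"
proof (rule inj_onI)
  fix U V assume "U \<in> cprod C GC" "V \<in> cprod C GC" and eq: "Theta U = Theta V"
  then obtain g h where gh: "celem C GC g" "celem C GC h" "U = cl C GC g" "V = cl C GC h"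
    by (elim cprodE) blast
  note [intro!] = celem_represented[OF gh(1)] celem_represented[OF gh(2)]
  have "(\<forall>\<^sub>F i in cofin C. g i = h i) \<or> (\<forall>\<^sub>F i in cofin C. g i \<noteq> h i)"
    by (rule cohesive_dichotomy[OF cohesive]) (intro usemidec_eq ucomputable_represented, auto)
  then show "U = V"
  proof
    assume "\<forall>\<^sub>F i in cofin C. g i = h i"
    then show ?thesis unfolding gh by (rule cl_cong)
  next
    assume neq: "\<forall>\<^sub>F i in cofin C. g i \<noteq> h i"
    \<comment> \<open>Asking for both values and for their difference makes separation by
      \<open>x\<close> something that a search can confirm. The one-entry tuple \<open>[x]\<close>
      then tells the two maps apart.\<close>
    let ?P = "\<lambda>i x. \<exists>y z. act_graph i (g i) x y \<and> act_graph i (h i) x z \<and> y \<noteq> z"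
    have "\<forall>\<^sub>F i in cofin C. \<exists>x. ?P i x"
      using neq gh(1,2)[THEN celem_mem]
      by eventually_elim (auto simp: act_graph_def dest: act_faithful)
    moreover have "usemidec C ?P"
      by (intro usemidec_logic usemidec_act_graph usemidec_neq ucomputable_intros) auto
    ultimately obtain x where x: "represented C x" "\<forall>\<^sub>F i in cofin C. ?P i (x i)"
      using represented_select by blast
    have xK: "celem C KC x"
      by (rule celem_K[OF x(1)]) (use x(2) in eventually_elim, auto simp: act_graph_def)
    have "Theta U (cl C TC (\<lambda>i. list_encode [x i])) = Theta V (cl C TC (\<lambda>i. list_encode [x i]))"
      using eq by simp
    then have "\<forall>\<^sub>F i in cofin C. tact i (g i) (list_encode [x i]) = tact i (h i) (list_encode [x i])"
      unfolding gh using celem_singleton[OF xK] gh(1,2)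
      by (simp add: Theta_cl cl_eq_iff celem_tact del: list_encode.simps)
    then have "\<forall>\<^sub>F i in cofin C. act i (g i) (x i) = act i (h i) (x i)"
      by eventually_elim (simp add: code_map_def)
    then have "\<forall>\<^sub>F i in cofin C. \<not> ?P i (x i)"
      by eventually_elim (auto simp: act_graph_def)
    with x(2) show ?thesis using cohesive_cofin_neq_bot[OF cohesive] by blast
  qed
qed

end

section \<open>Straight-line programs\<close>

context uniform_Galois
begin

text \<open>Both coordinates execute the same instruction, the first on \<open>us\<close> and the
  second on \<open>vs\<close>, with operands among the earlier pairs \<open>S\<close>. The pairs
  reachable in this way form the least relation that contains the pairs of generators and the
  diagonal of the base field and is closed under sums and products.\<close>

definition step :: "nat \<Rightarrow> nat list \<Rightarrow> nat list \<Rightarrow> (nat \<times> nat) set \<Rightarrow> nat \<times> nat \<Rightarrow> bool"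
  where "step i us vs S p \<longleftrightarrow> (\<exists>j<length us. p = (us ! j, vs ! j)) \<or>
    (\<exists>c\<in>carrier F. p = (\<Psi> i c, \<Psi> i c)) \<or>
    (\<exists>q\<in>S. \<exists>r\<in>S. p = (fst q \<oplus>\<^bsub>K i\<^esub> fst r, snd q \<oplus>\<^bsub>K i\<^esub> snd r)) \<or>
    (\<exists>q\<in>S. \<exists>r\<in>S. p = (fst q \<otimes>\<^bsub>K i\<^esub> fst r, snd q \<otimes>\<^bsub>K i\<^esub> snd r))"

definition program :: "nat \<Rightarrow> nat list \<Rightarrow> nat list \<Rightarrow> (nat \<times> nat) list \<Rightarrow> bool"
  where "program i us vs zs \<longleftrightarrow> (\<forall>k<length zs. step i us vs (set (take k zs)) (zs ! k))"

text \<open>The same condition on the codes \<open>A\<close> and \<open>B\<close> of the two projections of \<open>zs\<close>.\<close>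

definition code_step :: "nat \<Rightarrow> nat \<Rightarrow> nat \<Rightarrow> nat \<Rightarrow> nat \<Rightarrow> nat \<Rightarrow> bool"
  where "code_step i u v A B k \<longleftrightarrow>
    (\<exists>j. j < code_length u \<and> code_nth A k = code_nth u j \<and> code_nth B k = code_nth v j) \<or>
    (\<exists>c. Psi_graph i c (code_nth A k) \<and> Psi_graph i c (code_nth B k)) \<or>
    (\<exists>l m. l < k \<and> m < k \<and> add_graph i (code_nth A l) (code_nth A m) (code_nth A k) \<and>
      add_graph i (code_nth B l) (code_nth B m) (code_nth B k)) \<or>
    (\<exists>l m. l < k \<and> m < k \<and> mult_graph i (code_nth A l) (code_nth A m) (code_nth A k) \<and>
      mult_graph i (code_nth B l) (code_nth B m) (code_nth B k))"

definition code_program :: "nat \<Rightarrow> nat \<Rightarrow> nat \<Rightarrow> nat \<Rightarrow> nat \<Rightarrow> bool"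
  where "code_program i u v A B \<longleftrightarrow>
    code_length A = code_length B \<and> (\<forall>k<code_length A. code_step i u v A B k)"

lemma step_mono: "step i us vs S p \<Longrightarrow> S \<subseteq> S' \<Longrightarrow> step i us vs S' p"
  unfolding step_def by blast

text \<open>The operands of a sum or product may come from two different programs; concatenation
  makes both available in one.\<close>

lemma program_append:
  assumes "program i us vs zs" "program i us vs zs'" shows "program i us vs (zs @ zs')"
  unfolding program_def
proof (intro allI impI)
  fix k assume k: "k < length (zs @ zs')"
  show "step i us vs (set (take k (zs @ zs'))) ((zs @ zs') ! k)"
  proof (cases "k < length zs")
    case True
    then show ?thesis using assms(1) by (simp add: program_def nth_append)
  next
    case False
    then have "step i us vs (set (take (k - length zs) zs')) (zs' ! (k - length zs))"
      using assms(2) k by (simp add: program_def)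
    then show ?thesis using False by (auto simp: nth_append elim: step_mono)
  qed
qed

lemma program_snoc:
  assumes "program i us vs zs" "step i us vs (set zs) p" shows "program i us vs (zs @ [p])"
  using assms by (auto simp: program_def nth_append less_Suc_eq)

lemma program_closed:
  assumes "program i us vs zs" "set us \<subseteq> KC i" "set vs \<subseteq> KC i" "length us = length vs"
  shows "k < length zs \<Longrightarrow> fst (zs ! k) \<in> KC i \<and> snd (zs ! k) \<in> KC i"
proof (induction k rule: less_induct)
  case (less k)
  interpret ring "K i" by (rule ring_K)
  have "q \<in> KC i \<times> KC i" if "q \<in> set (take k zs)" for q
    using that less by (auto simp: in_set_conv_nth mem_Times_iff)
  moreover have "step i us vs (set (take k zs)) (zs ! k)"
    using assms(1) less.prems by (simp add: program_def)
  ultimately show ?case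
    unfolding step_def
    using assms(2-4) ring_hom_closed[OF Psi_hom] by (elim disjE) (fastforce simp: mem_Times_iff)+
qed

lemma code_program_if_program:
  assumes zs: "program i us vs zs" and us: "set us \<subseteq> KC i" "set vs \<subseteq> KC i" "length us = length vs"
  shows "code_program i (list_encode us) (list_encode vs) (list_encode (map fst zs)) (list_encode (map snd zs))"
  unfolding code_program_def
proof (intro conjI allI impI)
  fix k assume "k < code_length (list_encode (map fst zs))"
  then have k: "k < length zs" by simp
  have cl: "fst (zs ! l) \<in> KC i" "snd (zs ! l) \<in> KC i" if "l < length zs" for l
    using program_closed[OF assms that] by auto
  have nth: "\<exists>l<k. q = zs ! l" if "q \<in> set (take k zs)" for q
    using that k by (auto simp: in_set_conv_nth)
  have "step i us vs (set (take k zs)) (zs ! k)" using zs k by (simp add: program_def)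
  then consider j where "j < length us" "zs ! k = (us ! j, vs ! j)"
    | c where "c \<in> carrier F" "zs ! k = (\<Psi> i c, \<Psi> i c)"
    | l m where "l < k" "m < k" "zs ! k = (fst (zs ! l) \<oplus>\<^bsub>K i\<^esub> fst (zs ! m), snd (zs ! l) \<oplus>\<^bsub>K i\<^esub> snd (zs ! m))"
    | l m where "l < k" "m < k" "zs ! k = (fst (zs ! l) \<otimes>\<^bsub>K i\<^esub> fst (zs ! m), snd (zs ! l) \<otimes>\<^bsub>K i\<^esub> snd (zs ! m))"
    unfolding step_def by (elim disjE bexE exE conjE) (use nth in metis)+
  then show "code_step i (list_encode us) (list_encode vs) (list_encode (map fst zs)) (list_encode (map snd zs)) k"
  proof cases
    case 1
    then show ?thesis using k us(3) unfolding code_step_def by (intro disjI1 exI[of _ j]) simp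
  next
    case 2
    then show ?thesis using k unfolding code_step_def Psi_graph_def by - (rule disjI2, rule disjI1, intro exI[of _ c], simp)
  next
    case 3
    then show ?thesis using k cl unfolding code_step_def add_graph_def
      by - (rule disjI2, rule disjI2, rule disjI1, intro exI[of _ l] exI[of _ m], simp)
  next
    case 4
    then show ?thesis using k cl unfolding code_step_def mult_graph_def
      by - (rule disjI2, rule disjI2, rule disjI2, intro exI[of _ l] exI[of _ m], simp)
  qed
qed simp

text \<open>The pairs that occur in programs form a relation as required by
  \<open>related_tuples_conjugate\<close>, and the absence of a separating program is its condition
  on zero. Read contrapositively, tuples that are not conjugate have a finite certificate of this
  fact.\<close>

lemma conjugate_if_no_separating_program:
  assumes "u \<in> TC i" "v \<in> TC i" "code_length u = code_length v"
    and sep: "\<And>A B k. code_program i u v A B \<Longrightarrow> k < code_length A \<Longrightarrow>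
      code_nth A k = \<zero>\<^bsub>K i\<^esub> \<Longrightarrow> code_nth B k = \<zero>\<^bsub>K i\<^esub>"
  shows "\<exists>g\<in>GC i. v = tact i g u"
proof -
  let ?us = "list_decode u" and ?vs = "list_decode v"
  have us: "set ?us \<subseteq> KC i" "set ?vs \<subseteq> KC i" "length ?us = length ?vs"
    using assms(1-3) by (auto simp: tuples_iff code_length_def)
  let ?rel = "{p. \<exists>zs. program i ?us ?vs zs \<and> p \<in> set zs}"
  have rel_step: "p \<in> ?rel" if "program i ?us ?vs zs" "step i ?us ?vs (set zs) p" for zs p
    using program_snoc[OF that] by auto
  have nil: "program i ?us ?vs []" by (simp add: program_def)
  have "\<exists>\<gamma>\<in>carrier (Gal (K i) (\<Psi> i ` carrier F)). ?vs = map \<gamma> ?us"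
  proof (rule related_tuples_conjugate[OF finite_Galois, where rel = ?rel])
    show "x \<in> KC i \<and> y \<in> KC i" if "(x, y) \<in> ?rel" for x y
      using that program_closed[OF _ us] by (fastforce simp: in_set_conv_nth)
    fix x y x' y' assume "(x, y) \<in> ?rel" "(x', y') \<in> ?rel"
    then obtain zs zs' where zs: "program i ?us ?vs zs" "(x, y) \<in> set zs"
      and zs': "program i ?us ?vs zs'" "(x', y') \<in> set zs'" by blast
    note prog = program_append[OF zs(1) zs'(1)]
    have mem: "(x, y) \<in> set (zs @ zs')" "(x', y') \<in> set (zs @ zs')" using zs(2) zs'(2) by simp_all
    show "(x \<oplus>\<^bsub>K i\<^esub> x', y \<oplus>\<^bsub>K i\<^esub> y') \<in> ?rel"
      by (rule rel_step[OF prog], unfold step_def, rule disjI2, rule disjI2, rule disjI1,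
          rule bexI[OF _ mem(1)], rule bexI[OF _ mem(2)]) simp
    show "(x \<otimes>\<^bsub>K i\<^esub> x', y \<otimes>\<^bsub>K i\<^esub> y') \<in> ?rel"
      by (rule rel_step[OF prog], unfold step_def, rule disjI2, rule disjI2, rule disjI2,
          rule bexI[OF _ mem(1)], rule bexI[OF _ mem(2)]) simp
  next
    show "(e, e) \<in> ?rel" if "e \<in> \<Psi> i ` carrier F" for e
      by (rule rel_step[OF nil]) (use that in \<open>auto simp: step_def\<close>)
  next
    show "y = \<zero>\<^bsub>K i\<^esub>" if "(\<zero>\<^bsub>K i\<^esub>, y) \<in> ?rel" for y
    proof -
      from that obtain zs k where zs: "program i ?us ?vs zs" "k < length zs" "zs ! k = (\<zero>\<^bsub>K i\<^esub>, y)"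
        by (auto simp: in_set_conv_nth)
      from sep[of "list_encode (map fst zs)" "list_encode (map snd zs)" k] code_program_if_program[OF zs(1) us] zs(2,3)
      show ?thesis by simp
    qed
  next
    show "(?us ! j, ?vs ! j) \<in> ?rel" if "j < length ?us" for j
      by (rule rel_step[OF nil]) (use that in \<open>auto simp: step_def\<close>)
  qed (rule us)
  then obtain \<gamma> where \<gamma>: "\<gamma> \<in> carrier (Gal (K i) (\<Psi> i ` carrier F))" "?vs = map \<gamma> ?us" by blast
  from Gal_act[OF \<gamma>(1)] obtain g where g: "g \<in> GC i" "\<And>x. x \<in> KC i \<Longrightarrow> \<gamma> x = act i g x" by blast
  have "v = code_map \<gamma> u" using \<gamma>(2) by (simp add: code_map_def flip: \<gamma>(2))
  also have "\<dots> = tact i g u" by (rule code_map_cong[OF assms(1) g(2)])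
  finally show ?thesis using g(1) by blast
qed

lemma usemidec_code_program:
  assumes u: "represented C u" and v: "represented C v" and A: "ucomputable C A" and B: "ucomputable C B"
  shows "usemidec C (\<lambda>i n. code_program i (u i) (v i) (A i n) (B i n))"
  unfolding code_program_def code_step_def
  by (intro usemidec_logic
      usemidec_Psi_graph usemidec_add_graph usemidec_mult_graph
      ucomputable_subst[OF A] ucomputable_subst[OF B] A B ucomputable_intros u v)

end


section \<open>Hyper-automorphisms\<close>

lemma celem_cong: "celem C A a \<Longrightarrow> \<forall>\<^sub>F i in cofin C. a i = b i \<Longrightarrow> celem C A b"
  unfolding celem_def by (auto elim!: bexI[rotated] elim: eventually_elim2)

section \<open>Addition and multiplication as integral polynomials\<close>

definition poly_code :: "(int \<times> nat list) list \<Rightarrow> nat"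
  where "poly_code ts = list_encode (map (\<lambda>(c, e). \<langle>int_encode c, list_encode e\<rangle>) ts)"

lemma poly_terms_code [simp]: "poly_terms (poly_code ts) = ts"
  by (simp add: poly_terms_def poly_code_def comp_def case_prod_beta del: list_encode.simps)

text \<open>The exponent lists \<open>[1]\<close> and \<open>[0, 1]\<close> have the codes 3 and 7,
  which fixes the order of the two terms.\<close>

definition add_poly :: nat
  where "add_poly = poly_code [(1, [1]), (1, [0, 1])]"

definition mult_poly :: nat
  where "mult_poly = poly_code [(1, [1, 1])]"

lemma add_poly_in_int_polys: "add_poly \<in> int_polys"
  by (simp add: add_poly_def int_polys_def prod_encode_def numeral_eq_Suc)

lemma mult_poly_in_int_polys: "mult_poly \<in> int_polys"
  by (simp add: mult_poly_def int_polys_def)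

lemma poly_var_add_poly: "poly_var add_poly = 2"
  by (simp add: add_poly_def poly_var_def)

lemma poly_var_mult_poly: "poly_var mult_poly = 2"
  by (simp add: mult_poly_def poly_var_def)

lemma poly_eval_add_poly:
  assumes "ring R" "x \<in> carrier R" "y \<in> carrier R"
  shows "poly_eval R add_poly [x, y] = x \<oplus>\<^bsub>R\<^esub> y"
proof -
  interpret ring R by fact
  show ?thesis using assms(2,3)
    by (simp add: add_poly_def poly_eval_def monom_eval_def add_pow_int_ge)
qed

lemma poly_eval_mult_poly:
  assumes "ring R" "x \<in> carrier R" "y \<in> carrier R"
  shows "poly_eval R mult_poly [x, y] = x \<otimes>\<^bsub>R\<^esub> y"
proof -
  interpret ring R by fact
  show ?thesis using assms(2,3)
    by (simp add: mult_poly_def poly_eval_def monom_eval_def add_pow_int_ge)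
qed

lemma celem_const: "k \<in> A \<Longrightarrow> celem C (\<lambda>i. A) (\<lambda>i. k)"
  using computable_const[of k]
  unfolding celem_def cfun_def computable_def almost_subset_def
  by (intro bexI[of _ "\<lambda>i. Some k"]) (auto simp: dom_def)

locale hyper_automorphism = uniform_Galois +
  fixes \<tau> :: "(nat \<rightharpoonup> nat) set \<Rightarrow> (nat \<rightharpoonup> nat) set"
  assumes \<tau>: "\<tau> \<in> carrier (HAut_group C K F \<Psi>)"
begin

lemma \<tau>_tree: "\<tau> \<in> HAut_tree C KC" and \<tau>_fields: "\<tau> \<in> HAut_fields C K"
  and \<tau>_emb: "a \<in> cprod_tree C (\<lambda>i. carrier F) \<Longrightarrow> \<tau> (tree_emb C K \<Psi> a) = tree_emb C K \<Psi> a"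
  using \<tau> by (auto simp: HAut_group_def HAut_fields_def)

lemma \<tau>_bij: "bij_betw \<tau> (cprod_tree C KC) (cprod_tree C KC)"
  using \<tau>_tree by (simp add: HAut_tree_def Bij_def)

lemma \<tau>_arity: "A \<in> cprod_tree C KC \<Longrightarrow> arity C (\<tau> A) = arity C A"
  and \<tau>_append: "A \<in> cprod_tree C KC \<Longrightarrow> B \<in> cprod_tree C KC \<Longrightarrow>
    \<tau> (tree_append C KC A B) = tree_append C KC (\<tau> A) (\<tau> B)"
  using \<tau>_tree unfolding HAut_tree_def by blast+

text \<open>A relation between representatives, because \<open>\<tau>\<close> acts on classes and no
  representative of an image is distinguished.\<close>

definition maps :: "(nat \<Rightarrow> nat) \<Rightarrow> (nat \<Rightarrow> nat) \<Rightarrow> bool"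
  where "maps a b \<longleftrightarrow> celem C TC a \<and> celem C TC b \<and> \<tau> (cl C TC a) = cl C TC b"

definition emaps :: "(nat \<Rightarrow> nat) \<Rightarrow> (nat \<Rightarrow> nat) \<Rightarrow> bool"
  where "emaps x y \<longleftrightarrow> celem C KC x \<and> celem C KC y \<and> maps (\<lambda>i. list_encode [x i]) (\<lambda>i. list_encode [y i])"

lemma maps_celem: "maps a b \<Longrightarrow> celem C TC a" "maps a b \<Longrightarrow> celem C TC b"
  by (auto simp: maps_def)

lemma maps_ex:
  assumes "celem C TC a" obtains b where "maps a b"
proof -
  have "\<tau> (cl C TC a) \<in> cprod_tree C KC"
    using \<tau>_bij cl_in_cprod_tree[OF assms] by (auto simp: bij_betw_def)
  then obtain b where "celem C TC b" "\<tau> (cl C TC a) = cl C TC b" by (rule cprod_treeE)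
  with assms that show ?thesis by (auto simp: maps_def)
qed

lemma maps_unique:
  assumes "maps a b" "maps a' b'" "\<forall>\<^sub>F i in cofin C. a i = a' i"
  shows "\<forall>\<^sub>F i in cofin C. b i = b' i"
  using assms cl_cong[OF assms(3), of TC] cl_eq_iff[of C TC b b'] by (simp add: maps_def)

lemma maps_cong:
  assumes "maps a b" "\<forall>\<^sub>F i in cofin C. a i = a' i" "\<forall>\<^sub>F i in cofin C. b i = b' i"
  shows "maps a' b'"
  using assms cl_cong[OF assms(2), of TC] cl_cong[OF assms(3), of TC]
    celem_cong[of C TC a a'] celem_cong[of C TC b b'] by (simp add: maps_def)

lemma maps_length:
  assumes "maps a b" shows "\<forall>\<^sub>F i in cofin C. code_length (b i) = code_length (a i)"
proof -
  have "arity C (cl C TC b) = arity C (cl C TC a)"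
    using assms \<tau>_arity[of "cl C TC a"] cl_in_cprod_tree by (simp add: maps_def)
  moreover have "celem C (\<lambda>i. UNIV) (\<lambda>i. code_length (b i))"
    by (intro celem_nat represented_code_length celem_represented[OF maps_celem(2)[OF assms]])
  ultimately show ?thesis
    using assms by (simp add: maps_def arity_cl cl_eq_iff)
qed

lemma maps_append:
  assumes "maps a b" "maps a' b'"
  shows "maps (\<lambda>i. code_append (a i) (a' i)) (\<lambda>i. code_append (b i) (b' i))"
proof -
  have "\<tau> (tree_append C KC (cl C TC a) (cl C TC a')) =
      tree_append C KC (\<tau> (cl C TC a)) (\<tau> (cl C TC a'))"
    using assms cl_in_cprod_tree by (intro \<tau>_append) (auto simp: maps_def)
  with assms show ?thesis by (simp add: maps_def tree_append_cl celem_append)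
qed

text \<open>Cutting \<open>a\<close> just before and just after position \<open>j\<close> gives
  three elements of the tree. Their images have the same arities and concatenate to
  \<open>b\<close>, so they cut \<open>b\<close> at the same places. The position may vary with the
  index, so nonstandard positions are included.\<close>

lemma maps_nth:
  assumes ab: "maps a b" and j: "represented C j" and less: "\<forall>\<^sub>F i in cofin C. j i < code_length (a i)"
  shows "emaps (\<lambda>i. code_nth (a i) (j i)) (\<lambda>i. code_nth (b i) (j i))"
proof -
  note a = maps_celem(1)[OF ab] and b = maps_celem(2)[OF ab]
  let ?x = "\<lambda>i. code_nth (a i) (j i)" and ?y = "\<lambda>i. code_nth (b i) (j i)"
  have x: "celem C KC ?x"
    by (rule celem_K, rule represented_code_nth[OF celem_represented[OF a] j])
      (use celem_mem[OF a] less in eventually_elim, rule tuples_nth)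
  have y: "celem C KC ?y"
    by (rule celem_K, rule represented_code_nth[OF celem_represented[OF b] j])
      (use celem_mem[OF b] maps_length[OF ab] less in eventually_elim, auto intro: tuples_nth)
  have "celem C TC (\<lambda>i. code_take (j i) (a i))"
    by (rule celem_tuple, rule represented_code_take[OF celem_represented[OF a] j])
      ((use less in eventually_elim, simp), (use celem_mem[OF a] in eventually_elim,
          auto simp: tuples_iff code_take_def dest: in_set_takeD))
  then obtain b1 where b1: "maps (\<lambda>i. code_take (j i) (a i)) b1" by (rule maps_ex)
  obtain b2 where b2: "maps (\<lambda>i. list_encode [?x i]) b2" by (rule maps_ex[OF celem_singleton[OF x]])
  have "celem C TC (\<lambda>i. code_drop (a i) (Suc (j i)))"
    by (rule celem_tuple, rule represented_code_drop[OF celem_represented[OF a] represented_Suc[OF j]])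
      (use celem_mem[OF a] in eventually_elim, auto simp: tuples_iff list_decode_code_drop dest: in_set_dropD)
  then obtain b3 where b3: "maps (\<lambda>i. code_drop (a i) (Suc (j i))) b3" by (rule maps_ex)
  have "\<forall>\<^sub>F i in cofin C. code_append (code_take (j i) (a i))
      (code_append (list_encode [?x i]) (code_drop (a i) (Suc (j i)))) = a i"
    using less
  proof eventually_elim
    case (elim i)
    then have "take (j i) (list_decode (a i)) @ [?x i] @ drop (Suc (j i)) (list_decode (a i)) = list_decode (a i)"
      by (simp add: code_nth_eq code_length_def id_take_nth_drop[symmetric])
    then show ?case
      unfolding code_append_def code_take_def list_encode_inverse list_decode_code_drop by simp
  qed
  from maps_unique[OF maps_append[OF b1 maps_append[OF b2 b3]] ab this]
  have eq: "\<forall>\<^sub>F i in cofin C. code_append (b1 i) (code_append (b2 i) (b3 i)) = b i" .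
  \<comment> \<open>\<open>b1\<close> has length \<open>j\<close> and \<open>b2\<close> has length 1
    by preservation of arities, so the only entry of \<open>b2\<close> sits at position
    \<open>j\<close> of \<open>b\<close>.\<close>
  have "\<forall>\<^sub>F i in cofin C. b2 i = list_encode [?y i]"
    using eq less maps_length[OF b1] maps_length[OF b2] maps_length[OF ab]
  proof eventually_elim
    case (elim i)
    have len1: "length (list_decode (b1 i)) = j i"
      using elim(2,3) by (simp add: code_length_def code_take_def)
    obtain z where z: "list_decode (b2 i) = [z]"
      using elim(4) by (auto simp: code_length_def length_Suc_conv simp del: list_encode.simps)
    have "list_decode (b i) = list_decode (b1 i) @ [z] @ list_decode (b3 i)"
      using z by (simp add: code_append_def del: list_encode.simps flip: elim(1))
    then have "?y i = z"
      using elim(2,5) len1 by (simp add: code_nth_eq nth_append)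
    with z show ?case by (metis list_decode_inverse)
  qed
  from maps_cong[OF b2 _ this] have "maps (\<lambda>i. list_encode [?x i]) (\<lambda>i. list_encode [?y i])" by simp
  with x y show ?thesis by (simp add: emaps_def)
qed

lemma emaps_unique:
  assumes "emaps x y" "emaps x' y'" "\<forall>\<^sub>F i in cofin C. x i = x' i"
  shows "\<forall>\<^sub>F i in cofin C. y i = y' i"
proof -
  have "\<forall>\<^sub>F i in cofin C. list_encode [x i] = list_encode [x' i]"
    using assms(3) by eventually_elim simp
  from maps_unique[OF assms(1,2)[unfolded emaps_def, THEN conjunct2, THEN conjunct2] this]
  have "\<forall>\<^sub>F i in cofin C. list_encode [y i] = list_encode [y' i]" .
  then show ?thesis by eventually_elim simp
qed

text \<open>Stated for a fixed polynomial in two variables, since programs apply one binary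
  operation at a time.\<close>

lemma emaps_poly:
  assumes p: "p \<in> int_polys" "poly_var p = 2" and x: "emaps x x'" and y: "emaps y y'"
  shows "emaps (\<lambda>i. poly_eval (K i) p [x i, y i]) (\<lambda>i. poly_eval (K i) p [x' i, y' i])"
proof -
  let ?a = "\<lambda>i. code_append (list_encode [x i]) (list_encode [y i])"
  let ?b = "\<lambda>i. code_append (list_encode [x' i]) (list_encode [y' i])"
  have dec: "list_decode (?a i) = [x i, y i]" "list_decode (?b i) = [x' i, y' i]" for i
    by (simp_all add: code_append_def del: list_encode.simps)
  have ab: "maps ?a ?b" using maps_append x y by (simp add: emaps_def)
  note ab' = maps_celem[OF ab]
  have P: "celem C (\<lambda>i. int_polys) (\<lambda>i. p)" by (rule celem_const[OF p(1)])
  have len: "code_length (?a i) = poly_var p" for i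
    unfolding code_length_def dec p(2) by simp
  have "arity C (cl C TC ?a) = hyperpoly_var C (cl C (\<lambda>i. int_polys) (\<lambda>i. p))"
    unfolding arity_cl[OF ab'(1)] hyperpoly_var_def cmap1_cl[OF P] len ..
  moreover have "cl C (\<lambda>i. int_polys) (\<lambda>i. p) \<in> hyperpolys C"
    unfolding hyperpolys_def by (rule cl_in_cprod[OF P])
  ultimately have "singleton_tuple C KC (hyperpoly_eval C K (cl C (\<lambda>i. int_polys) (\<lambda>i. p)) (\<tau> (cl C TC ?a))) =
      \<tau> (singleton_tuple C KC (hyperpoly_eval C K (cl C (\<lambda>i. int_polys) (\<lambda>i. p)) (cl C TC ?a)))"
    using \<tau>_fields cl_in_cprod_tree[OF ab'(1)] unfolding HAut_fields_def by blast
  moreover have "celem C KC (\<lambda>i. poly_eval (K i) p (list_decode (?a i)))"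
    "celem C KC (\<lambda>i. poly_eval (K i) p (list_decode (?b i)))"
    by (intro celem_poly_eval ab' represented_const)+
  ultimately show ?thesis
    using ab ab' P celem_singleton
    by (simp add: emaps_def maps_def hyperpoly_eval_cl singleton_tuple_cl dec del: list_encode.simps)
qed

lemma emaps_cong:
  assumes "emaps x y" "\<forall>\<^sub>F i in cofin C. x i = x' i" "\<forall>\<^sub>F i in cofin C. y i = y' i"
  shows "emaps x' y'"
proof -
  have "\<forall>\<^sub>F i in cofin C. list_encode [x i] = list_encode [x' i]" "\<forall>\<^sub>F i in cofin C. list_encode [y i] = list_encode [y' i]"
    using assms(2,3) by (eventually_elim, simp)+
  from maps_cong[OF _ this] assms(1) celem_cong[OF _ assms(2)] celem_cong[OF _ assms(3)] show ?thesis
    by (simp add: emaps_def del: list_encode.simps)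
qed

lemma emaps_celem: "emaps x y \<Longrightarrow> celem C KC x" "emaps x y \<Longrightarrow> celem C KC y"
  by (auto simp: emaps_def)

lemma emaps_binary:
  assumes p: "p \<in> int_polys" "poly_var p = 2"
    and eval: "\<And>i x y. x \<in> KC i \<Longrightarrow> y \<in> KC i \<Longrightarrow> poly_eval (K i) p [x, y] = f i x y"
    and x: "emaps x x'" and y: "emaps y y'"
  shows "emaps (\<lambda>i. f i (x i) (y i)) (\<lambda>i. f i (x' i) (y' i))"
proof (rule emaps_cong[OF emaps_poly[OF p x y]])
  show "\<forall>\<^sub>F i in cofin C. poly_eval (K i) p [x i, y i] = f i (x i) (y i)"
    using emaps_celem(1)[OF x, THEN celem_mem] emaps_celem(1)[OF y, THEN celem_mem]
    by eventually_elim (rule eval)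
  show "\<forall>\<^sub>F i in cofin C. poly_eval (K i) p [x' i, y' i] = f i (x' i) (y' i)"
    using emaps_celem(2)[OF x, THEN celem_mem] emaps_celem(2)[OF y, THEN celem_mem]
    by eventually_elim (rule eval)
qed

lemmas emaps_add = emaps_binary[OF add_poly_in_int_polys poly_var_add_poly poly_eval_add_poly[OF ring_K]]
  and emaps_mult = emaps_binary[OF mult_poly_in_int_polys poly_var_mult_poly poly_eval_mult_poly[OF ring_K]]

text \<open>An element of \<open>F\<close> is a tuple of arity 1 over \<open>F\<close>, and
  \<open>\<tau>\<close> fixes all such tuples; this admits constants of \<open>F\<close> in
  programs.\<close>

lemma emaps_Psi:
  assumes c: "represented C c" "\<forall>\<^sub>F i in cofin C. c i \<in> carrier F"
  shows "emaps (\<lambda>i. \<Psi> i (c i)) (\<lambda>i. \<Psi> i (c i))"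
proof -
  have c': "celem C (\<lambda>i. tuples (carrier F)) (\<lambda>i. list_encode [c i])"
    by (rule celem_tuple_F[OF represented_singleton[OF c(1)]])
      (use c(2) in eventually_elim, simp del: list_encode.simps)
  have map: "code_map (\<Psi> i) (list_encode [c i]) = list_encode [\<Psi> i (c i)]" for i
    by (simp add: code_map_def del: list_encode.simps)
  note d = celem_map_Psi[OF c', unfolded map]
  have "represented C (\<lambda>i. code_nth (list_encode [\<Psi> i (c i)]) 0)"
    by (rule represented_code_nth[OF celem_represented[OF d] represented_const])
  then have "represented C (\<lambda>i. \<Psi> i (c i))" by (simp del: list_encode.simps)
  then have "celem C KC (\<lambda>i. \<Psi> i (c i))"
    by (rule celem_K) (use c(2) in eventually_elim, rule ring_hom_closed[OF Psi_hom])
  moreover have "\<tau> (cl C TC (\<lambda>i. list_encode [\<Psi> i (c i)])) = cl C TC (\<lambda>i. list_encode [\<Psi> i (c i)])"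
    using \<tau>_emb[of "cl C (\<lambda>i. tuples (carrier F)) (\<lambda>i. list_encode [c i])"] cl_in_cprod[OF c']
    unfolding tree_emb_cl[OF c'] map cprod_tree_def by blast
  ultimately show ?thesis using d by (simp add: emaps_def maps_def)
qed

text \<open>Otherwise \<open>B\<close> differs from the image \<open>Z\<close> of \<open>A\<close> at a first position \<open>k\<close>, which is
  computable, and \<open>\<tau>\<close> respects the step that produced this position.\<close>

lemma maps_code_program:
  assumes uv: "maps u v" and A: "represented C A" and B: "represented C B"
    and prog: "\<forall>\<^sub>F i in cofin C. code_program i (u i) (v i) (A i) (B i)"
  shows "maps A B"
proof -
  note uv' = celem_represented[OF maps_celem(1)[OF uv]] celem_represented[OF maps_celem(2)[OF uv]]
  have XK: "celem C TC A"
  proof (rule celem_tuple[OF A])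
    show "\<forall>\<^sub>F i in cofin C. A i \<in> TC i"
      using prog maps_celem(1)[OF uv, THEN celem_mem]
    proof eventually_elim
      case (elim i)
      interpret ring "K i" by (rule ring_K)
      have "code_nth (A i) k \<in> KC i" if "k < code_length (A i)" for k
      proof -
        have "code_step i (u i) (v i) (A i) (B i) k" using elim(1) that by (simp add: code_program_def)
        then show ?thesis
          unfolding code_step_def Psi_graph_def add_graph_def mult_graph_def
          using tuples_nth[OF elim(2)] ring_hom_closed[OF Psi_hom] by auto
      qed
      then show ?case by (simp add: tuples_iff_nth)
    qed
  qed
  then obtain Z where XZ: "maps A Z" by (rule maps_ex)
  have Z: "represented C Z" by (rule celem_represented[OF maps_celem(2)[OF XZ]])
  have "(\<forall>\<^sub>F i in cofin C. Z i = B i) \<or> (\<forall>\<^sub>F i in cofin C. Z i \<noteq> B i)"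
    by (rule cohesive_dichotomy[OF cohesive]) (intro usemidec_eq ucomputable_represented Z B)
  moreover have False if neq: "\<forall>\<^sub>F i in cofin C. Z i \<noteq> B i"
  proof -
    let ?P = "\<lambda>i k. k < code_length (A i) \<and> code_nth (Z i) k \<noteq> code_nth (B i) k \<and>
      (\<forall>l<k. code_nth (Z i) l = code_nth (B i) l)"
    have "usemidec C ?P"
      by (intro usemidec_logic ucomputable_intros A B Z)
    moreover have "\<forall>\<^sub>F i in cofin C. \<exists>k. ?P i k"
      using neq prog maps_length[OF XZ]
    proof eventually_elim
      case (elim i)
      then have "\<exists>k. k < code_length (A i) \<and> code_nth (Z i) k \<noteq> code_nth (B i) k"
        using list_decode_eq_iff_nth[of "Z i" "list_decode (B i)"]
        by (metis code_length_def code_nth_eq code_program_def list_decode_eq)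
      then obtain k where k: "k < code_length (A i) \<and> code_nth (Z i) k \<noteq> code_nth (B i) k"
        "\<And>l. l < k \<Longrightarrow> \<not> (l < code_length (A i) \<and> code_nth (Z i) l \<noteq> code_nth (B i) l)"
        by (subst (asm) exists_least_iff) blast
      then show ?case by (intro exI[of _ k]) auto
    qed
    ultimately obtain k where k: "represented C k" "\<forall>\<^sub>F i in cofin C. ?P i (k i)"
      by (rule represented_select)
    have kX: "\<forall>\<^sub>F i in cofin C. k i < code_length (A i)" using k(2) by eventually_elim simp
    \<comment> \<open>Before the first deviation \<open>Z\<close> and \<open>B\<close> agree, so
      there \<open>\<tau>\<close> takes the entries of \<open>A\<close> to those of
      \<open>B\<close>, also at nonstandard positions.\<close>
    have eqZ: "emaps (\<lambda>i. code_nth (A i) (l i)) (\<lambda>i. code_nth (B i) (l i))"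
      if l: "represented C l" "\<forall>\<^sub>F i in cofin C. l i < k i" for l
    proof -
      have "\<forall>\<^sub>F i in cofin C. l i < code_length (A i)" using l(2) k(2) by eventually_elim simp
      moreover have "\<forall>\<^sub>F i in cofin C. code_nth (Z i) (l i) = code_nth (B i) (l i)"
        using l(2) k(2) by eventually_elim simp
      ultimately show ?thesis
        by (intro emaps_cong[OF maps_nth[OF XZ l(1)]]) auto
    qed
    \<comment> \<open>It remains to realise the entries at \<open>k\<close> by some pair related
      through \<open>\<tau>\<close>: images are unique, so \<open>Z\<close> and \<open>B\<close>
      would then agree at \<open>k\<close>.\<close>
    have contra: False if y: "emaps x y" "\<forall>\<^sub>F i in cofin C. x i = code_nth (A i) (k i)"
      "\<forall>\<^sub>F i in cofin C. y i = code_nth (B i) (k i)" for x y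
    proof -
      have "\<forall>\<^sub>F i in cofin C. y i = code_nth (Z i) (k i)"
        by (rule emaps_unique[OF y(1) maps_nth[OF XZ k(1) kX] y(2)])
      with y(3) have "\<forall>\<^sub>F i in cofin C. \<not> ?P i (k i)" by eventually_elim simp
      with k(2) show False using cohesive_cofin_neq_bot[OF cohesive] by blast
    qed
    let ?Q1 = "\<lambda>i j. j < code_length (u i) \<and> code_nth (A i) (k i) = code_nth (u i) j \<and>
      code_nth (B i) (k i) = code_nth (v i) j"
    let ?Q2 = "\<lambda>i c. Psi_graph i c (code_nth (A i) (k i)) \<and> Psi_graph i c (code_nth (B i) (k i))"
    let ?Q = "\<lambda>R i l m. l < k i \<and> m < k i \<and> R i (code_nth (A i) l) (code_nth (A i) m) (code_nth (A i) (k i)) \<and>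
        R i (code_nth (B i) l) (code_nth (B i) m) (code_nth (B i) (k i))"
    note reps = A B k(1) uv'
    have Q1: "usemidec C ?Q1" by (intro usemidec_logic ucomputable_intros reps)
    have Q2: "usemidec C ?Q2" by (intro usemidec_conj usemidec_Psi_graph ucomputable_intros reps)
    have Q: "usemidec C (\<lambda>i l. \<exists>m. ?Q R i l m)"
      if "\<And>x y z. ucomputable C x \<Longrightarrow> ucomputable C y \<Longrightarrow> ucomputable C z \<Longrightarrow>
        usemidec C (\<lambda>i n. R i (x i n) (y i n) (z i n))" for R
      by (intro usemidec_logic that ucomputable_intros reps)
    have Q3: "usemidec C (\<lambda>i l. \<exists>m. ?Q add_graph i l m)"
      by (rule Q) (rule usemidec_add_graph)
    have binary: False
      if R: "\<And>x y z. ucomputable C x \<Longrightarrow> ucomputable C y \<Longrightarrow> ucomputable C z \<Longrightarrow>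
          usemidec C (\<lambda>i n. R i (x i n) (y i n) (z i n))" "\<And>i x y z. R i x y z \<Longrightarrow> f i x y = z"
        and emaps: "\<And>x x' y y'. emaps x x' \<Longrightarrow> emaps y y' \<Longrightarrow>
          emaps (\<lambda>i. f i (x i) (y i)) (\<lambda>i. f i (x' i) (y' i))"
        and case_R: "\<forall>\<^sub>F i in cofin C. \<exists>l m. ?Q R i l m"
      for R f
    proof -
      \<comment> \<open>The positions of the two operands are chosen by search, one after the other,
        so that both are represented and \<open>eqZ\<close> applies to them.\<close>
      have "usemidec C (\<lambda>i l. \<exists>m. ?Q R i l m)" by (rule Q) (rule R(1))
      from this case_R obtain l where l: "represented C l" "\<forall>\<^sub>F i in cofin C. \<exists>m. ?Q R i (l i) m"
        by (rule represented_select)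
      have "usemidec C (\<lambda>i m. ?Q R i (l i) m)"
        by (intro usemidec_logic R(1) ucomputable_intros reps l(1))
      from this l(2) obtain m where m: "represented C m" "\<forall>\<^sub>F i in cofin C. ?Q R i (l i) (m i)"
        by (rule represented_select)
      have "\<forall>\<^sub>F i in cofin C. l i < k i" "\<forall>\<^sub>F i in cofin C. m i < k i"
        using m(2) by (auto elim: eventually_mono)
      from emaps[OF eqZ[OF l(1) this(1)] eqZ[OF m(1) this(2)]] show False
        by (rule contra) (use m(2) in \<open>auto elim: eventually_mono intro: R(2)\<close>)
    qed
    have ex: "usemidec C (\<lambda>i n. \<exists>y. P i y)" if "usemidec C P" for P
      by (rule usemidec_ex) (rule usemidec_subst[OF that ucomputable_snd[OF ucomputable_var]])
    \<comment> \<open>The entry at \<open>k\<close> may be produced by different kinds of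
      instructions at different indices. Cohesiveness singles out one kind that occurs at almost all
      of them.\<close>
    have "\<forall>\<^sub>F i in cofin C. (\<exists>j. ?Q1 i j) \<or> (\<exists>c. ?Q2 i c) \<or>
        (\<exists>l m. ?Q add_graph i l m) \<or> (\<exists>l m. ?Q mult_graph i l m)"
      using prog k(2) by eventually_elim (simp add: code_program_def code_step_def)
    then consider "\<forall>\<^sub>F i in cofin C. \<exists>j. ?Q1 i j" | "\<forall>\<^sub>F i in cofin C. \<exists>c. ?Q2 i c"
      | "\<forall>\<^sub>F i in cofin C. \<exists>l m. ?Q add_graph i l m" | "\<forall>\<^sub>F i in cofin C. \<exists>l m. ?Q mult_graph i l m"
      by (elim cohesive_disj[OF cohesive ex[OF Q1], elim_format] cohesive_disj[OF cohesive ex[OF Q2], elim_format]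
          cohesive_disj[OF cohesive ex[OF Q3], elim_format] disjE)
    then show False
    proof cases
      case 1
      with Q1 obtain j where j: "represented C j" "\<forall>\<^sub>F i in cofin C. ?Q1 i (j i)"
        by (rule represented_select)
      then have "\<forall>\<^sub>F i in cofin C. j i < code_length (u i)" by (auto elim: eventually_mono)
      then show False
        by (rule contra[OF maps_nth[OF uv j(1)]]) (use j(2) in \<open>auto elim: eventually_mono\<close>)
    next
      case 2
      with Q2 obtain c where c: "represented C c" "\<forall>\<^sub>F i in cofin C. ?Q2 i (c i)"
        by (rule represented_select)
      then have "\<forall>\<^sub>F i in cofin C. c i \<in> carrier F" by (auto elim: eventually_mono simp: Psi_graph_def)
      then show False
        by (rule contra[OF emaps_Psi[OF c(1)]]) (use c(2) in \<open>auto elim: eventually_mono simp: Psi_graph_def\<close>)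
    next
      case 3
      show False by (rule binary[where f = "\<lambda>i x y. x \<oplus>\<^bsub>K i\<^esub> y", OF _ _ _ 3]; (rule usemidec_add_graph emaps_add)?;
          simp add: add_graph_def)
    next
      case 4
      show False by (rule binary[where f = "\<lambda>i x y. x \<otimes>\<^bsub>K i\<^esub> y", OF _ _ _ 4]; (rule usemidec_mult_graph emaps_mult)?;
          simp add: mult_graph_def)
    qed
  qed
  ultimately have "\<forall>\<^sub>F i in cofin C. Z i = B i" by blast
  from maps_cong[OF XZ _ this] show ?thesis by simp
qed

lemma maps_conjugate:
  assumes uv: "maps u v"
  shows "\<forall>\<^sub>F i in cofin C. \<exists>g\<in>GC i. v i = tact i g (u i)"
proof -
  note uv' = celem_represented[OF maps_celem(1)[OF uv]] celem_represented[OF maps_celem(2)[OF uv]]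
  let ?bad = "\<lambda>i A B k. code_program i (u i) (v i) A B \<and> k < code_length A \<and>
    code_nth A k = \<zero>\<^bsub>K i\<^esub> \<and> code_nth B k \<noteq> \<zero>\<^bsub>K i\<^esub>"
  \<comment> \<open>A separating program is a finite object that can be checked, so cohesiveness
    decides its existence. Absence almost always gives conjugacy at once; otherwise a program and
    the separating position can be chosen computably and handed to \<open>\<tau>\<close>.\<close>
  have "usemidec C (\<lambda>i n. \<exists>A B k. ?bad i A B k)"
    by (intro usemidec_logic usemidec_code_program usemidec_logic
        ucomputable_intros represented_constants uv')
  from cohesive_dichotomy[OF cohesive this] show ?thesis
  proof
    assume "\<forall>\<^sub>F i in cofin C. \<not> (\<exists>A B k. ?bad i A B k)"
    then show ?thesis
      using maps_celem(1)[OF uv, THEN celem_mem] maps_celem(2)[OF uv, THEN celem_mem] maps_length[OF uv]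
      by eventually_elim (rule conjugate_if_no_separating_program, auto)
  next
    assume bad: "\<forall>\<^sub>F i in cofin C. \<exists>A B k. ?bad i A B k"
    have "usemidec C (\<lambda>i A. \<exists>B k. ?bad i A B k)"
      by (intro usemidec_logic usemidec_code_program usemidec_logic
          ucomputable_intros represented_constants uv')
    from this bad obtain A where A: "represented C A" "\<forall>\<^sub>F i in cofin C. \<exists>B k. ?bad i (A i) B k"
      by (rule represented_select)
    have "usemidec C (\<lambda>i B. \<exists>k. ?bad i (A i) B k)"
      by (intro usemidec_logic usemidec_code_program usemidec_logic
          ucomputable_intros represented_constants uv' A(1))
    from this A(2) obtain B where B: "represented C B" "\<forall>\<^sub>F i in cofin C. \<exists>k. ?bad i (A i) (B i) k"
      by (rule represented_select)
    have "usemidec C (\<lambda>i k. ?bad i (A i) (B i) k)"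
      by (intro usemidec_conj usemidec_code_program usemidec_logic
          ucomputable_intros represented_constants uv' A(1) B(1))
    from this B(2) obtain k where k: "represented C k" "\<forall>\<^sub>F i in cofin C. ?bad i (A i) (B i) (k i)"
      by (rule represented_select)
    have "\<forall>\<^sub>F i in cofin C. code_program i (u i) (v i) (A i) (B i)"
      and kX: "\<forall>\<^sub>F i in cofin C. k i < code_length (A i)"
      and 0: "\<forall>\<^sub>F i in cofin C. code_nth (A i) (k i) = \<zero>\<^bsub>K i\<^esub>"
      using k(2) by (auto elim: eventually_mono)
    then have "maps A B" using maps_code_program[OF uv A(1) B(1)] by blast
    from maps_nth[OF this k(1) kX] have XY: "emaps (\<lambda>i. code_nth (A i) (k i)) (\<lambda>i. code_nth (B i) (k i))" .
    \<comment> \<open>Zero is the image of a constant of \<open>F\<close>, so \<open>\<tau>\<close>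
      sends it to itself, whereas \<open>B\<close> has a nonzero entry at \<open>k\<close>.\<close>
    interpret F: ring F by (rule ring_F)
    have "emaps (\<lambda>i. \<Psi> i \<zero>\<^bsub>F\<^esub>) (\<lambda>i. \<Psi> i \<zero>\<^bsub>F\<^esub>)" by (rule emaps_Psi[OF represented_const]) simp
    then have "emaps (\<lambda>i. \<zero>\<^bsub>K i\<^esub>) (\<lambda>i. \<zero>\<^bsub>K i\<^esub>)"
      by (simp add: ring_hom_zero[OF Psi_hom ring_F ring_K])
    from emaps_unique[OF XY this 0] have "\<forall>\<^sub>F i in cofin C. code_nth (B i) (k i) = \<zero>\<^bsub>K i\<^esub>" .
    then have "\<forall>\<^sub>F i in cofin C. \<not> ?bad i (A i) (B i) (k i)" by eventually_elim simp
    with k(2) show ?thesis using cohesive_cofin_neq_bot[OF cohesive] by blast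
  qed
qed

end

section \<open>A tuple with trivial stabilizers and the surjectivity of \<open>Theta\<close>\<close>

context hyper_automorphism
begin

lemma separating_tuple:
  assumes n: "represented C n" "\<forall>\<^sub>F i in cofin C. n i = order (G i)"
  obtains d where "celem C TC d"
    "\<forall>\<^sub>F i in cofin C. \<forall>g\<in>GC i. \<forall>h\<in>GC i. tact i g (d i) = tact i h (d i) \<longrightarrow> g = h"
proof -
  \<comment> \<open>A list of \<open>n i\<close> distinct elements is complete because
    \<open>n i\<close> is the order of \<open>G i\<close>; only this lets the search recognise that
    no element is missing.\<close>
  let ?E = "\<lambda>i l. code_length l = n i \<and>
    (\<forall>k<n i. code_nth l k \<in> GC i \<and> (\<forall>j<k. code_nth l j \<noteq> code_nth l k))"
  have "usemidec C ?E"
    by (intro usemidec_logic usemidec_G ucomputable_intros n(1))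
  moreover have "\<forall>\<^sub>F i in cofin C. \<exists>l. ?E i l"
    using n(2)
  proof eventually_elim
    case (elim i)
    obtain xs where xs: "set xs = GC i" "distinct xs"
      using finite_distinct_list[OF finite_G[of i]] by blast
    then have "length xs = n i" using elim by (simp add: order_def flip: distinct_card)
    with xs show ?case
      by (intro exI[of _ "list_encode xs"]) (auto simp: nth_eq_iff_index_eq simp flip: xs(1))
  qed
  ultimately obtain l where l: "represented C l" "\<forall>\<^sub>F i in cofin C. ?E i (l i)"
    by (rule represented_select)
  have surj: "\<forall>\<^sub>F i in cofin C. set (list_decode (l i)) = GC i"
    using l(2) n(2)
  proof eventually_elim
    case (elim i)
    have nth: "list_decode (l i) ! k = code_nth (l i) k" if "k < length (list_decode (l i))" for k
      using that by (simp add: code_nth_eq code_length_def)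
    have len: "length (list_decode (l i)) = n i" using elim by (simp add: code_length_def)
    have "distinct (list_decode (l i))"
      unfolding distinct_conv_nth using elim(1) nth len by (metis nat_neq_iff)
    then have "card (set (list_decode (l i))) = card (GC i)"
      using elim len by (simp add: distinct_card order_def)
    moreover have "set (list_decode (l i)) \<subseteq> GC i"
      using elim(1) nth len by (auto simp: in_set_conv_nth)
    ultimately show ?case using card_subset_eq[OF finite_G] by blast
  qed
  \<comment> \<open>Any two positions of the list are separated by some entry \<open>m\<close> of
    \<open>d\<close>. The bounded quantifiers range over the finite list rather than over
    \<open>G i\<close>, which keeps the condition semidecidable; pairs with \<open>j < k\<close>
    suffice by symmetry.\<close>
  let ?D = "\<lambda>i d. d \<in> TC i \<and> (\<forall>k<n i. \<forall>j<k. \<exists>m y z. m < code_length d \<and>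
    act_graph i (code_nth (l i) k) (code_nth d m) y \<and> act_graph i (code_nth (l i) j) (code_nth d m) z \<and> y \<noteq> z)"
  have "usemidec C ?D"
    by (intro usemidec_conj usemidec_tuples usemidec_logic
        usemidec_act_graph ucomputable_intros n(1) l(1))
  moreover have "\<forall>\<^sub>F i in cofin C. \<exists>d. ?D i d"
    using l(2)
  proof eventually_elim
    case (elim i)
    have "\<exists>x\<in>KC i. act i g x \<noteq> act i h x"
      if "g \<in> GC i" "h \<in> GC i" "g \<noteq> h" for g h
      using act_faithful[OF that(1,2)] that(3) by blast
    then obtain w where w: "\<And>g h. g \<in> GC i \<Longrightarrow> h \<in> GC i \<Longrightarrow> g \<noteq> h \<Longrightarrow>
        w g h \<in> KC i \<and> act i g (w g h) \<noteq> act i h (w g h)"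
      by metis
    \<comment> \<open>One separating element for each pair of distinct group elements; finiteness of
      the group lets them be collected in one tuple.\<close>
    let ?W = "(\<lambda>(g, h). w g h) ` {(g, h). g \<in> GC i \<and> h \<in> GC i \<and> g \<noteq> h}"
    have "finite ?W"
      by (intro finite_imageI finite_subset[OF _ finite_cartesian_product[OF finite_G[of i] finite_G[of i]]]) auto
    then obtain xs where xs: "set xs = ?W" using finite_list by blast
    have "?D i (list_encode xs)"
    proof (intro conjI allI impI)
      show "list_encode xs \<in> TC i" using xs w by auto
      fix k j assume kj: "k < n i" "j < k"
      let ?g = "code_nth (l i) k" and ?h = "code_nth (l i) j"
      have gh: "?g \<in> GC i" "?h \<in> GC i" "?g \<noteq> ?h" using elim kj by fastforce+
      then have "w ?g ?h \<in> set xs" unfolding xs by force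
      then obtain m where m: "m < length xs" "xs ! m = w ?g ?h" by (auto simp: in_set_conv_nth)
      show "\<exists>m y z. m < code_length (list_encode xs) \<and> act_graph i ?g (code_nth (list_encode xs) m) y \<and>
          act_graph i ?h (code_nth (list_encode xs) m) z \<and> y \<noteq> z"
        by (rule exI[of _ m]) (use m w[OF gh] gh in \<open>simp add: act_graph_def\<close>)
    qed
    then show ?case by blast
  qed
  ultimately obtain d where d: "represented C d" "\<forall>\<^sub>F i in cofin C. ?D i (d i)"
    by (rule represented_select)
  show ?thesis
  proof (rule that[of d])
    show "celem C TC d" by (rule celem_tuple[OF d(1)]) (use d(2) in eventually_elim, blast)
    show "\<forall>\<^sub>F i in cofin C. \<forall>g\<in>GC i. \<forall>h\<in>GC i. tact i g (d i) = tact i h (d i) \<longrightarrow> g = h"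
      using d(2) l(2) surj
    proof eventually_elim
      case (elim i)
      have sep: False if kj: "k < n i" "j < k" and eq: "tact i (code_nth (l i) k) (d i) = tact i (code_nth (l i) j) (d i)" for k j
      proof -
        obtain m y z where m: "m < code_length (d i)" "y \<noteq> z" "act_graph i (code_nth (l i) k) (code_nth (d i) m) y"
          "act_graph i (code_nth (l i) j) (code_nth (d i) m) z"
          using elim(1) kj by blast
        have "map (act i (code_nth (l i) k)) (list_decode (d i)) ! m = map (act i (code_nth (l i) j)) (list_decode (d i)) ! m"
          using arg_cong[OF eq, of list_decode] unfolding code_map_def list_encode_inverse by (rule arg_cong)
        with m show False by (simp add: act_graph_def code_nth_eq code_length_def)
      qed
      have ex: "\<exists>k<n i. g = code_nth (l i) k" if "g \<in> GC i" for g
        using that elim(2) by (auto simp: in_set_conv_nth code_nth_eq code_length_def simp flip: elim(3))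
      show ?case
      proof (intro ballI impI)
        fix g h assume "g \<in> GC i" "h \<in> GC i" and eq: "tact i g (d i) = tact i h (d i)"
        then obtain k j where "k < n i" "g = code_nth (l i) k" "j < n i" "h = code_nth (l i) j"
          using ex by blast
        with sep[of k j] sep[of j k] eq show "g = h" by (metis nat_neq_iff)
      qed
    qed
  qed
qed

lemma \<tau>_in_range_Theta:
  assumes "represented C n" "\<forall>\<^sub>F i in cofin C. n i = order (G i)"
  shows "\<tau> \<in> Theta ` cprod C GC"
proof -
  obtain d where d: "celem C TC d" and
    sep: "\<forall>\<^sub>F i in cofin C. \<forall>g\<in>GC i. \<forall>h\<in>GC i. tact i g (d i) = tact i h (d i) \<longrightarrow> g = h"
    by (rule separating_tuple[OF assms])
  obtain d' where dd': "maps d d'" using d by (rule maps_ex)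
  \<comment> \<open>Conjugacy only asserts that some group element exists at each index. Searching
    for one that moves \<open>d i\<close> to \<open>d' i\<close>, entry by entry, makes it an
    element of the cohesive product.\<close>
  let ?P = "\<lambda>i g. g \<in> GC i \<and> code_length (d' i) = code_length (d i) \<and>
    (\<forall>k<code_length (d i). act_graph i g (code_nth (d i) k) (code_nth (d' i) k))"
  have P: "?P i g \<longleftrightarrow> g \<in> GC i \<and> d' i = tact i g (d i)" if "d i \<in> TC i" for i g
  proof -
    have "act_graph i g (code_nth (d i) k) (code_nth (d' i) k) \<longleftrightarrow> code_nth (d' i) k = act i g (code_nth (d i) k)"
      if "g \<in> GC i" "k < code_length (d i)" for k
      using that tuples_nth[OF \<open>d i \<in> TC i\<close>] by (simp add: act_graph_def)
    then show ?thesis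
      unfolding code_map_def eq_list_encode_iff
      by (auto simp: code_nth_eq simp flip: code_length_def)
  qed
  have "usemidec C ?P"
    by (intro usemidec_conj usemidec_G usemidec_logic usemidec_act_graph ucomputable_intros
        celem_represented[OF maps_celem(1)[OF dd']] celem_represented[OF maps_celem(2)[OF dd']])
  moreover have "\<forall>\<^sub>F i in cofin C. \<exists>g. ?P i g"
    using maps_conjugate[OF dd'] celem_mem[OF d] by eventually_elim (use P in blast)
  ultimately obtain g where g: "represented C g" "\<forall>\<^sub>F i in cofin C. ?P i (g i)"
    by (rule represented_select)
  have gG: "celem C GC g"
    by (rule celem_G[OF g(1)]) (use g(2) in eventually_elim, blast)
  have gd: "\<forall>\<^sub>F i in cofin C. d' i = tact i (g i) (d i)"
    using g(2) celem_mem[OF d] by eventually_elim (use P in blast)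
  \<comment> \<open>The element \<open>h\<close> provided for the concatenated tuple might depend on
    \<open>a\<close>, but it moves the part \<open>d i\<close> as \<open>g i\<close> does and is
    therefore equal to \<open>g i\<close>.\<close>
  have eq: "\<forall>\<^sub>F i in cofin C. a' i = tact i (g i) (a i)" if aa': "maps a a'" for a a'
    using maps_conjugate[OF maps_append[OF dd' aa']] gd sep celem_mem[OF gG] maps_length[OF dd']
  proof eventually_elim
    case (elim i)
    then obtain h where h: "h \<in> GC i" "code_append (d' i) (a' i) = tact i h (code_append (d i) (a i))"
      by blast
    then have "list_decode (d' i) @ list_decode (a' i) =
        list_decode (tact i h (d i)) @ list_decode (tact i h (a i))"
      unfolding code_map_append unfolding code_append_def by (metis list_encode_inverse)
    moreover have "length (list_decode (d' i)) = length (list_decode (tact i h (d i)))"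
      using elim(5) by (simp add: code_length_def code_map_def)
    ultimately have "d' i = tact i h (d i)" "a' i = tact i h (a i)"
      by (simp_all add: list_decode_eq)
    with elim(2,3,4) h(1) show ?case by metis
  qed
  have "\<tau> = Theta (cl C GC g)"
  proof (rule extensionalityI[of _ "cprod_tree C KC"])
    show "\<tau> \<in> extensional (cprod_tree C KC)" using \<tau>_tree by (simp add: HAut_tree_def Bij_def)
    show "Theta (cl C GC g) \<in> extensional (cprod_tree C KC)" by (simp add: Theta_def)
    fix A assume "A \<in> cprod_tree C KC"
    then obtain a where a: "celem C TC a" "A = cl C TC a" by (rule cprod_treeE)
    obtain a' where aa': "maps a a'" using a(1) by (rule maps_ex)
    then have "\<tau> A = cl C TC a'" using a by (simp add: maps_def)
    also have "\<dots> = Theta (cl C GC g) A"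
      unfolding a(2) Theta_cl[OF gG a(1)] by (rule cl_cong[OF eq[OF aa']])
    finally show "\<tau> A = Theta (cl C GC g) A" .
  qed
  then show ?thesis using cl_in_cprod[OF gG] by blast
qed

end

theorem theorem5p16:
  fixes K :: "nat \<Rightarrow> nat ring" and F :: "nat ring" and \<Psi> :: "nat \<Rightarrow> nat \<Rightarrow> nat"
    and G :: "nat \<Rightarrow> nat monoid" and act :: "nat \<Rightarrow> nat \<Rightarrow> nat \<Rightarrow> nat" and C :: "nat set"
  assumes "ucomp_field_extensions K F \<Psi>"
    and "\<And>i. finite_Galois (K i) (\<Psi> i ` carrier F)"
    and "ucomp_groups G"
    and "\<And>i. Galois_action (G i) (K i) (\<Psi> i ` carrier F) (act i)"
    and "ucomp_actions G K act"
    and "cohesive C"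
    and "\<exists>\<phi>. partrec \<phi> \<and> C \<subseteq>\<^sup>* {i. \<phi> i = Some (order (G i))}"
  shows "HAut_group C K F \<Psi> \<cong> cprod_group C G"
proof -
  interpret uniform_Galois K F \<Psi> G act C
    using assms(1-6) by (intro uniform_Galois.intro)
  have order: "represented C (\<lambda>i. order (G i))"
    using assms(7) unfolding represented_def eventually_cofin .
  have "carrier (HAut_group C K F \<Psi>) \<subseteq> Theta ` cprod C GC"
  proof
    fix \<tau> assume "\<tau> \<in> carrier (HAut_group C K F \<Psi>)"
    then interpret hyper_automorphism K F \<Psi> G act C \<tau>
      by (intro hyper_automorphism.intro hyper_automorphism_axioms.intro uniform_Galois_axioms)
    show "\<tau> \<in> Theta ` cprod C GC" by (rule \<tau>_in_range_Theta[OF order]) simp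
  qed
  then have "bij_betw Theta (cprod C GC) (carrier (HAut_group C K F \<Psi>))"
    using Theta_inj Theta_HAut by (auto simp: bij_betw_def)
  then have "Theta \<in> iso (cprod_group C G) (HAut_group C K F \<Psi>)"
    using Theta_hom by (simp add: Group.iso_def carrier_cprod_group)
  then have "cprod_group C G \<cong> HAut_group C K F \<Psi>"
    unfolding is_iso_def by blast
  \<comment> \<open>Reversing an isomorphism uses the group axioms of its source; for the product
    group they are inherited coordinatewise from the \<open>G i\<close>.\<close>
  then show ?thesis by (rule group.iso_sym[OF group_cprod_group])
qed

end
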